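(* Let $\Delta t>0$ and let $L>0$ be the constant of Lipschitz continuity of $d(\cdot,\cdot)$, i.e. $|d(\boldsymbol v,\boldsymbol z)-d(\boldsymbol w,\boldsymbol z)|\le L\|\boldsymbol v-\boldsymbol w\|_{L^2(\Omega)}\|\boldsymbol z\|_{L^2(\Omega)}$ for all $\boldsymbol v,\boldsymbol w,\boldsymbol z\in\boldsymbol V$. Suppose that $\Delta t$ is small enough that $$L\,\Delta t<2 .$$ Then for any given $(\boldsymbol\sigma_h^k,\boldsymbol u_h^k)\in\boldsymbol\Sigma_h\times\boldsymbol V_h$ there exists a unique $(\boldsymbol\sigma_h^{k+1},\boldsymbol u_h^{k+1})\in\boldsymbol\Sigma_h\times\boldsymbol V_h$ such that $$\tfrac12 a(\boldsymbol\sigma_h^{k}+\boldsymbol\sigma_h^{k+1},\boldsymbol\tau)-\tfrac12 b(\boldsymbol\tau,\boldsymbol u_h^{k}+\boldsymbol u_h^{k+1})=0,$$ $$\tfrac12 b(\boldsymbol\sigma_h^{k}+\boldsymbol\sigma_h^{k+1},\boldsymbol v)+\tfrac1{\Delta t}c(\boldsymbol u_h^{k+1}-\boldsymbol u_h^{k},\boldsymbol v)-\tfrac12\bigl(d(\boldsymbol u_h^{k},\boldsymbol v)+d(\boldsymbol u_h^{k+1},\boldsymbol v)\bigr)=0$$ for all $(\boldsymbol\tau,\boldsymbol v)\in\boldsymbol\Sigma_h\times\boldsymbol V_h$.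
   Context: Domain and mesh: $\Omega\subset\mathbb R^d$ ($d=2,3$) is a bounded domain with Lipschitz continuous polygonal/polyhedral boundary. $\Omega_+,\Omega_-\subset\Omega$ are disjoint subdomains with polygonal/polyhedral boundaries, $\overline{\Omega_+}\cup\overline{\Omega_-}=\overline\Omega$, $\Gamma=\partial\Omega_+\cap\partial\Omega_-$, and $n$ is the unit normal on $\Gamma$ outward from $\Omega_+$. $\mathcal T_h$ is a triangulation of $\Omega$ by shape-regular triangles/tetrahedra without hanging nodes. Data: $N\ge1$ is an integer. For $1\le i\le N$, $K_i>0$ is a constant and $\kappa_i$ is a scalar diffusion coefficient on $\Omega$ bounded above and below by positive constants. The functions $f_i:\mathbb R^N\to\mathbb R$ are Lipschitz continuous: there are $L_i>0$ such that for all $v_j,w_j\in L^2(\Omega)$, $1\le j\le N$, and a.e. $x\in\Omega$, $$|f_i(v_1(x),\dots,v_N(x))-f_i(w_1(x),\dots,w_N(x))|\le L_i\Bigl(\sum_{j=1}^N|v_j(x)-w_j(x)|^2\Bigr)^{1/2}.$$ Spaces: $\Sigma=\{\tau\in H(\operatorname{div},\Omega):\tau\cdot n|_\Gamma\in L^2(\Gamma)\}$, $V=L^2(\Omega)$, $\boldsymbol\Sigma=\Sigma^N$, $\boldsymbol V=V^N$. $\mathcal P_m(T)$ and $\mathcal P_m(T;\mathbb R^d)$ denote scalar and $\mathbb R^d$-valued polynomials of degree at most $m$ on $T$. For a fixed integer $l\ge1$, put $\Sigma_h(T)=\mathcal P_{l-1}(T;\mathbb R^d)+x\,\mathcal P_{l-1}(T)$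 with $x=(x_1,\dots,x_d)^{T}$ (Raviart–Thomas–Nédélec element), $\Sigma_h=\{\tau\in\Sigma:\tau|_T\in\Sigma_h(T)\ \forall T\in\mathcal T_h\}$, $V_h=\{v\in V: v|_T\in\mathcal P_{l-1}(T)\ \forall T\in\mathcal T_h\}$, $\boldsymbol\Sigma_h=\Sigma_h^N$, $\boldsymbol V_h=V_h^N$. Forms: $(\cdot,\cdot)_\Omega$ and $\langle\cdot,\cdot\rangle_\Gamma$ are the $L^2$ inner products on $\Omega$ and $\Gamma$. For $\boldsymbol\tau=(\tau_i),\boldsymbol\eta=(\eta_i)\in\boldsymbol\Sigma$ and $\boldsymbol v=(v_i),\boldsymbol w=(w_i)\in\boldsymbol V$, $$a(\boldsymbol\tau,\boldsymbol\eta)=\sum_{i=1}^N(\kappa_i^{-1}\tau_i,\eta_i)_\Omega+\sum_{i=1}^N\langle K_i^{-1}\tau_i\cdot n,\eta_i\cdot n\rangle_\Gamma,\qquad b(\boldsymbol\tau,\boldsymbol v)=\sum_{i=1}^N(v_i,\operatorname{div}\tau_i)_\Omega,$$ $$c(\boldsymbol v,\boldsymbol w)=\sum_{i=1}^N(v_i,w_i)_\Omega,\qquad d(\boldsymbol v,\boldsymbol w)=\sum_{i=1}^N(f_i(v_1,\dots,v_N),w_i)_\Omega,$$ and $\|\boldsymbol v\|_{L^2(\Omega)}^2=c(\boldsymbol v,\boldsymbol v)$. *)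

theory Defs
  imports "HOL-Analysis.Analysis" "HOL-Library.Function_Algebras"
begin

section \<open>Domains\<close>

definition domain :: "(real^'d) set \<Rightarrow> bool" where
  "domain \<Omega> \<longleftrightarrow> open \<Omega> \<and> connected \<Omega> \<and> \<Omega> \<noteq> {}"

definition polyhedral_boundary :: "(real^'d) set \<Rightarrow> bool" where
  "polyhedral_boundary \<Omega> \<longleftrightarrow>
     (\<exists>\<F>. finite \<F> \<and> (\<forall>F\<in>\<F>. polytope F \<and> aff_dim F = int CARD('d) - 1) \<and> frontier \<Omega> = \<Union>\<F>)"

text \<open>Near each boundary point, the set is the part above the graph of a Lipschitz function of the
  coordinates orthogonal to some unit vector \<open>e\<close>.\<close>

definition lipschitz_boundary :: "(real^'d) set \<Rightarrow> bool" where
  "lipschitz_boundary \<Omega> \<longleftrightarrow>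
     (\<forall>x\<in>frontier \<Omega>. \<exists>U e C g. open U \<and> x \<in> U \<and> norm e = 1 \<and>
        C-lipschitz_on {z. z \<bullet> e = 0} g \<and>
        \<Omega> \<inter> U = {y \<in> U. y \<bullet> e > (g (y - (y \<bullet> e) *\<^sub>R e) :: real)})"

definition interface :: "(real^'d) set \<Rightarrow> (real^'d) set \<Rightarrow> (real^'d) set" where
  "interface \<Omega>\<^sub>p \<Omega>\<^sub>m = frontier \<Omega>\<^sub>p \<inter> frontier \<Omega>\<^sub>m"

text \<open>The library's \<^const>\<open>triangulation\<close> demands that the intersection of two simplices is a common
  face of both, which excludes hanging nodes.\<close>

definition mesh_of :: "(real^'d) set \<Rightarrow> (real^'d) set set \<Rightarrow> bool" where
  "mesh_of \<Omega> \<T> \<longleftrightarrow>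
     triangulation \<T> \<and> (\<forall>T\<in>\<T>. int CARD('d) simplex T) \<and> \<Union>\<T> = closure \<Omega>"

definition shape_regular :: "real \<Rightarrow> (real^'d) set set \<Rightarrow> bool" where
  "shape_regular \<gamma> \<T> \<longleftrightarrow>
     (\<forall>T\<in>\<T>. \<exists>z r. r > 0 \<and> cball z r \<subseteq> T \<and> diameter T \<le> \<gamma> * r)"


section \<open>Square integrable functions and surface measure\<close>

text \<open>Elements of \<open>L\<^sup>2\<close> are represented by functions; they are identified when they agree almost
  everywhere.\<close>

definition L2 :: "'a measure \<Rightarrow> ('a \<Rightarrow> 'b::euclidean_space) set" where
  "L2 M = {v. v \<in> borel_measurable M \<and> integrable M (\<lambda>x. (norm (v x))\<^sup>2)}"

text \<open>Normalised so that, for integer \<open>s\<close>, it agrees with Lebesgue measure on \<open>s\<close>-dimensional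
  flat pieces.  Boundedness of the covering sets is needed because \<^const>\<open>diameter\<close> is
  meaningless on unbounded sets.\<close>

definition hausdorff_outer :: "real \<Rightarrow> 'a::metric_space set \<Rightarrow> ennreal" where
  "hausdorff_outer s A =
     (SUP \<delta>\<in>{0<..}. INF C\<in>{C :: nat \<Rightarrow> 'a set. A \<subseteq> \<Union>(range C) \<and>
                                (\<forall>i. bounded (C i) \<and> diameter (C i) \<le> \<delta>)}.
        \<Sum>i. ennreal (unit_ball_vol s * (diameter (C i) / 2) powr s))"

definition surface_measure :: "(real^'d) set \<Rightarrow> (real^'d) measure" where
  "surface_measure \<Gamma> =
     restrict_space (measure_of UNIV (sets borel) (hausdorff_outer (real CARD('d) - 1))) \<Gamma>"


section \<open>The space \<open>H(div)\<close> and normal traces\<close>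

primrec Ck :: "nat \<Rightarrow> (real^'d \<Rightarrow> real) \<Rightarrow> bool" where
  "Ck 0 \<phi> \<longleftrightarrow> continuous_on UNIV \<phi>"
| "Ck (Suc k) \<phi> \<longleftrightarrow>
     (\<forall>x. \<phi> differentiable at x) \<and> (\<forall>b\<in>Basis. Ck k (\<lambda>x. frechet_derivative \<phi> (at x) b))"

definition test_functions :: "(real^'d) set \<Rightarrow> (real^'d \<Rightarrow> real) set" where
  "test_functions \<Omega> =
     {\<phi>. (\<forall>k. Ck k \<phi>) \<and> compact (closure {x. \<phi> x \<noteq> 0}) \<and> closure {x. \<phi> x \<noteq> 0} \<subseteq> \<Omega>}"

definition gradient :: "(real^'d \<Rightarrow> real) \<Rightarrow> real^'d \<Rightarrow> real^'d" where
  "gradient \<phi> x = (\<chi> j. frechet_derivative \<phi> (at x) (axis j 1))"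

definition is_weak_div ::
  "(real^'d) set \<Rightarrow> (real^'d \<Rightarrow> real^'d) \<Rightarrow> (real^'d \<Rightarrow> real) \<Rightarrow> bool" where
  "is_weak_div \<Omega> \<tau> w \<longleftrightarrow> w \<in> L2 (lebesgue_on \<Omega>) \<and>
     (\<forall>\<phi>\<in>test_functions \<Omega>.
        (LINT x|lebesgue_on \<Omega>. \<tau> x \<bullet> gradient \<phi> x) = - (LINT x|lebesgue_on \<Omega>. w x * \<phi> x))"

definition Hdiv :: "(real^'d) set \<Rightarrow> (real^'d \<Rightarrow> real^'d) set" where
  "Hdiv \<Omega> = {\<tau> \<in> L2 (lebesgue_on \<Omega>). \<exists>w. is_weak_div \<Omega> \<tau> w}"

text \<open>The weak divergence is determined up to a null set.\<close>

definition divergence :: "(real^'d) set \<Rightarrow> (real^'d \<Rightarrow> real^'d) \<Rightarrow> real^'d \<Rightarrow> real" where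
  "divergence \<Omega> \<tau> = (SOME w. is_weak_div \<Omega> \<tau> w)"

text \<open>A field in \<open>H(div)\<close> has no pointwise values on the interface \<open>\<Gamma>\<close>, so \<open>\<tau> \<cdot> n\<close> on \<open>\<Gamma>\<close> is the
  distribution given by Green's formula on \<open>\<Omega>\<^sub>p\<close>, \<open>n\<close> being the unit normal on \<open>\<Gamma>\<close> that points out
  of \<open>\<Omega>\<^sub>p\<close>.  The rest of the boundary of \<open>\<Omega>\<^sub>p\<close> contributes nothing: the test functions vanish near
  the boundary of \<open>\<Omega>\<close>, and the fluxes through the two sides of a slit cancel.  The trace is square integrable if some \<open>g\<close> in \<open>L\<^sup>2(\<Gamma>)\<close> represents this
  distribution.  The points of \<open>\<Gamma>\<close> on the boundary of \<open>\<Omega>\<close> form a null set of \<open>\<Gamma>\<close>; fixing \<open>g\<close>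
  to be \<open>0\<close> there only normalises the representative.\<close>

definition is_normal_trace ::
  "(real^'d) set \<Rightarrow> (real^'d) set \<Rightarrow> (real^'d) set \<Rightarrow> (real^'d \<Rightarrow> real^'d) \<Rightarrow> (real^'d \<Rightarrow> real) \<Rightarrow> bool"
  where
  "is_normal_trace \<Omega> \<Omega>\<^sub>p \<Omega>\<^sub>m \<tau> g \<longleftrightarrow>
     g \<in> L2 (surface_measure (interface \<Omega>\<^sub>p \<Omega>\<^sub>m)) \<and>
     (\<forall>x \<in> interface \<Omega>\<^sub>p \<Omega>\<^sub>m - \<Omega>. g x = 0) \<and>
     (\<forall>\<phi>\<in>test_functions \<Omega>.
        (LINT x|surface_measure (interface \<Omega>\<^sub>p \<Omega>\<^sub>m). g x * \<phi> x) =
        (LINT x|lebesgue_on \<Omega>\<^sub>p. \<tau> x \<bullet> gradient \<phi> x + divergence \<Omega> \<tau> x * \<phi> x))"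

definition normal_trace ::
  "(real^'d) set \<Rightarrow> (real^'d) set \<Rightarrow> (real^'d) set \<Rightarrow> (real^'d \<Rightarrow> real^'d) \<Rightarrow> real^'d \<Rightarrow> real" where
  "normal_trace \<Omega> \<Omega>\<^sub>p \<Omega>\<^sub>m \<tau> = (SOME g. is_normal_trace \<Omega> \<Omega>\<^sub>p \<Omega>\<^sub>m \<tau> g)"

definition Sigma_space ::
  "(real^'d) set \<Rightarrow> (real^'d) set \<Rightarrow> (real^'d) set \<Rightarrow> (real^'d \<Rightarrow> real^'d) set" where
  "Sigma_space \<Omega> \<Omega>\<^sub>p \<Omega>\<^sub>m = {\<tau> \<in> Hdiv \<Omega>. \<exists>g. is_normal_trace \<Omega> \<Omega>\<^sub>p \<Omega>\<^sub>m \<tau> g}"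


section \<open>Discrete spaces\<close>

definition polys :: "nat \<Rightarrow> (real^'d \<Rightarrow> real) set" where
  "polys m = {p. \<exists>c :: ('d \<Rightarrow> nat) \<Rightarrow> real.
     p = (\<lambda>x. \<Sum>\<alpha> | (\<Sum>i\<in>UNIV. \<alpha> i) \<le> m. c \<alpha> * (\<Prod>i\<in>UNIV. (x $ i) ^ \<alpha> i))}"

definition vec_polys :: "nat \<Rightarrow> (real^'d \<Rightarrow> real^'d) set" where
  "vec_polys m = {q. \<forall>j. (\<lambda>x. q x $ j) \<in> polys m}"

definition RT :: "nat \<Rightarrow> (real^'d \<Rightarrow> real^'d) set" where
  "RT l = {\<lambda>x. q x + p x *\<^sub>R x | q p. q \<in> vec_polys (l - 1) \<and> p \<in> polys (l - 1)}"

definition Sigma_h ::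
  "(real^'d) set \<Rightarrow> (real^'d) set \<Rightarrow> (real^'d) set \<Rightarrow> (real^'d) set set \<Rightarrow> nat
    \<Rightarrow> (real^'d \<Rightarrow> real^'d) set" where
  "Sigma_h \<Omega> \<Omega>\<^sub>p \<Omega>\<^sub>m \<T> l =
     {\<tau> \<in> Sigma_space \<Omega> \<Omega>\<^sub>p \<Omega>\<^sub>m. \<forall>T\<in>\<T>. \<exists>q\<in>RT l. AE x in lebesgue_on (T \<inter> \<Omega>). \<tau> x = q x}"

definition V_h :: "(real^'d) set \<Rightarrow> (real^'d) set set \<Rightarrow> nat \<Rightarrow> (real^'d \<Rightarrow> real) set" where
  "V_h \<Omega> \<T> l =
     {v \<in> L2 (lebesgue_on \<Omega>). \<forall>T\<in>\<T>. \<exists>p\<in>polys (l - 1). AE x in lebesgue_on (T \<inter> \<Omega>). v x = p x}"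

definition pow :: "'a set \<Rightarrow> ('N::finite \<Rightarrow> 'a) set" where
  "pow X = {v. \<forall>i. v i \<in> X}"


section \<open>Forms\<close>

definition form_a ::
  "(real^'d) set \<Rightarrow> (real^'d) set \<Rightarrow> (real^'d) set \<Rightarrow> ('N::finite \<Rightarrow> real^'d \<Rightarrow> real) \<Rightarrow> ('N \<Rightarrow> real)
    \<Rightarrow> ('N \<Rightarrow> real^'d \<Rightarrow> real^'d) \<Rightarrow> ('N \<Rightarrow> real^'d \<Rightarrow> real^'d) \<Rightarrow> real" where
  "form_a \<Omega> \<Omega>\<^sub>p \<Omega>\<^sub>m \<kappa> K \<tau> \<eta> =
     (\<Sum>i\<in>UNIV. LINT x|lebesgue_on \<Omega>. (inverse (\<kappa> i x) *\<^sub>R \<tau> i x) \<bullet> \<eta> i x) +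
     (\<Sum>i\<in>UNIV. LINT x|surface_measure (interface \<Omega>\<^sub>p \<Omega>\<^sub>m).
        (inverse (K i) * normal_trace \<Omega> \<Omega>\<^sub>p \<Omega>\<^sub>m (\<tau> i) x) * normal_trace \<Omega> \<Omega>\<^sub>p \<Omega>\<^sub>m (\<eta> i) x)"

definition form_b ::
  "(real^'d) set \<Rightarrow> ('N::finite \<Rightarrow> real^'d \<Rightarrow> real^'d) \<Rightarrow> ('N \<Rightarrow> real^'d \<Rightarrow> real) \<Rightarrow> real" where
  "form_b \<Omega> \<tau> v = (\<Sum>i\<in>UNIV. LINT x|lebesgue_on \<Omega>. v i x * divergence \<Omega> (\<tau> i) x)"

definition form_c ::
  "(real^'d) set \<Rightarrow> ('N::finite \<Rightarrow> real^'d \<Rightarrow> real) \<Rightarrow> ('N \<Rightarrow> real^'d \<Rightarrow> real) \<Rightarrow> real" where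
  "form_c \<Omega> v w = (\<Sum>i\<in>UNIV. LINT x|lebesgue_on \<Omega>. v i x * w i x)"

definition form_d ::
  "(real^'d) set \<Rightarrow> ('N::finite \<Rightarrow> real^'N \<Rightarrow> real)
    \<Rightarrow> ('N \<Rightarrow> real^'d \<Rightarrow> real) \<Rightarrow> ('N \<Rightarrow> real^'d \<Rightarrow> real) \<Rightarrow> real" where
  "form_d \<Omega> f v w = (\<Sum>i\<in>UNIV. LINT x|lebesgue_on \<Omega>. f i (\<chi> j. v j x) * w i x)"

definition norm_L2 :: "(real^'d) set \<Rightarrow> ('N::finite \<Rightarrow> real^'d \<Rightarrow> real) \<Rightarrow> real" where
  "norm_L2 \<Omega> v = sqrt (form_c \<Omega> v v)"

end

theory Submission
  imports Defs "HOL-Computational_Algebra.Polynomial" "HOL-Real_Asymp.Real_Asymp"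
begin

text \<open>
  In the unknowns \<open>s = \<sigma> + \<sigma>'\<close> and \<open>y = u + u'\<close> and with \<open>\<mu> = 2 / \<Delta>t\<close>, one step of the scheme reads
  \<open>a(s, \<tau>) = b(\<tau>, y)\<close>, \<open>b(s, v) + \<mu> c(y, v) = d(y - u, v) + 2 \<mu> c(u, v) + d(u, v)\<close>.
  The spaces are finite-dimensional and \<open>a\<close> is positive definite, so the first equation determines
  \<open>s\<close> as a linear function of \<open>y\<close>, and \<open>b(s, v)\<close> becomes a symmetric positive semidefinite form in
  \<open>y\<close> and \<open>v\<close>.  Adding \<open>\<mu> c\<close> makes it definite, hence the second equation with a given right hand
  side is solvable.  Freezing \<open>y\<close> in \<open>d(y - u, v)\<close> at \<open>z\<close> and solving for \<open>y\<close> gives a map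
  \<open>z \<mapsto> y\<close> that is a contraction with constant \<open>L / \<mu> = L \<Delta>t / 2 < 1\<close>; Banach's theorem yields
  existence (\<open>mixed_problem_solvable\<close>).  For uniqueness, the difference of two solutions is
  tested with itself: with \<open>\<epsilon>\<close> and \<open>e\<close> the differences of the fluxes and of the potentials,
  \<open>a(\<epsilon>, \<epsilon>) + \<mu> c(e, e) \<le> L c(e, e)\<close>, so both vanish almost everywhere.

  What takes work is that the forms are bilinear in the first place.  Functions represent classes
  modulo null sets, and the divergence and the normal trace are chosen among all representatives.
  Their linearity up to null sets rests on uniqueness: a function whose integrals against all test
  functions vanish is zero almost everywhere (\<open>AE_eq_0_of_test_functions\<close>, for an arbitrary Borel
  measure).  For the trace this is applied to the surface measure, and it requires that products of
  square integrable functions with test functions be integrable, which holds because the interface,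
  being contained in finitely many flat pieces, has finite Hausdorff measure
  (\<open>emeasure_interface_finite\<close>).

  All finite-dimensional linear algebra is done modulo null vectors, with orthonormal sets in place of
  bases.  The discrete spaces are finite-dimensional in this sense because their elements are almost
  everywhere combinations of finitely many monomials cut off to pieces of the mesh
  (\<open>Sigma_h_finite_dimensional\<close>, \<open>V_h_finite_dimensional\<close>).
\<close>


section \<open>Semi-inner products and a nonlinear mixed problem\<close>

text \<open>Makes span and linear independence of functions available.\<close>

instantiation "fun" :: (type, real_vector) real_vector
begin

definition scaleR_fun :: "real \<Rightarrow> ('a \<Rightarrow> 'b) \<Rightarrow> 'a \<Rightarrow> 'b"
  where "scaleR_fun r f = (\<lambda>x. r *\<^sub>R f x)"

instance
  by standard (auto simp: scaleR_fun_def fun_eq_iff algebra_simps)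

end

lemma scaleR_fun_apply [simp]: "(r *\<^sub>R f) x = r *\<^sub>R f x" for f :: "'a \<Rightarrow> 'b::real_vector"
  by (simp add: scaleR_fun_def)

lemma sum_fun_apply: "(\<Sum>i\<in>I. f i) x = (\<Sum>i\<in>I. f i x)" for f :: "'i \<Rightarrow> 'a \<Rightarrow> 'b::comm_monoid_add"
  by (induction I rule: infinite_finite_induct) auto

text \<open>The form lives on a subspace because integrals of products are bilinear only where the
  products are integrable.  It is only semidefinite, as functions that vanish almost everywhere
  are null vectors.\<close>

locale semi_inner_product =
  fixes W :: "'a::real_vector set" and p :: "'a \<Rightarrow> 'a \<Rightarrow> real"
  assumes subspace_W: "subspace W"
    and sym: "x \<in> W \<Longrightarrow> y \<in> W \<Longrightarrow> p x y = p y x"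
    and add_left: "x \<in> W \<Longrightarrow> y \<in> W \<Longrightarrow> z \<in> W \<Longrightarrow> p (x + y) z = p x z + p y z"
    and scale_left: "x \<in> W \<Longrightarrow> z \<in> W \<Longrightarrow> p (r *\<^sub>R x) z = r * p x z"
    and nonneg: "x \<in> W \<Longrightarrow> p x x \<ge> 0"
begin

lemmas W_closed = subspace_0[OF subspace_W] subspace_add[OF subspace_W]
  subspace_diff[OF subspace_W] subspace_scale[OF subspace_W] subspace_sum[OF subspace_W]

lemma diff_left: "x \<in> W \<Longrightarrow> y \<in> W \<Longrightarrow> z \<in> W \<Longrightarrow> p (x - y) z = p x z - p y z"
  using add_left[of x "(-1) *\<^sub>R y" z] scale_left[of y z "-1"] W_closed(4)[of y "-1"] by simp

lemma add_right: "x \<in> W \<Longrightarrow> y \<in> W \<Longrightarrow> z \<in> W \<Longrightarrow> p z (x + y) = p z x + p z y"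
  using add_left sym W_closed by metis

lemma scale_right: "x \<in> W \<Longrightarrow> z \<in> W \<Longrightarrow> p z (r *\<^sub>R x) = r * p z x"
  using scale_left sym W_closed by metis

lemma zero_left: "z \<in> W \<Longrightarrow> p 0 z = 0"
  using scale_left[of 0 z 0] W_closed(1) by simp

lemma sum_left:
  assumes "\<And>i. i \<in> I \<Longrightarrow> x i \<in> W" "z \<in> W"
  shows "p (\<Sum>i\<in>I. r i *\<^sub>R x i) z = (\<Sum>i\<in>I. r i * p (x i) z)"
  using assms(1)
proof (induction I rule: infinite_finite_induct)
  case (insert i I)
  then have "p (r i *\<^sub>R x i + (\<Sum>i\<in>I. r i *\<^sub>R x i)) z = r i * p (x i) z + (\<Sum>i\<in>I. r i * p (x i) z)"
    using assms(2) by (subst add_left) (auto simp: scale_left intro!: W_closed)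
  with insert show ?case by simp
qed (use assms(2) in \<open>auto simp: zero_left\<close>)

text \<open>The discriminant of the nonnegative quadratic polynomial \<open>p (x + t y) (x + t y)\<close> in \<open>t\<close>.\<close>

lemma Cauchy_Schwarz:
  assumes "x \<in> W" "y \<in> W"
  shows "(p x y)\<^sup>2 \<le> p x x * p y y"
proof -
  have *: "0 \<le> p x x + 2 * t * p x y + t\<^sup>2 * p y y" for t
  proof -
    have "0 \<le> p (x + t *\<^sub>R y) (x + t *\<^sub>R y)"
      using assms by (intro nonneg W_closed)
    also have "\<dots> = p x x + 2 * t * p x y + t\<^sup>2 * p y y"
      using assms sym[of x y]
      by (simp add: add_left add_right scale_left scale_right W_closed power2_eq_square algebra_simps)
    finally show ?thesis .
  qed
  show ?thesis
  proof (cases "p y y = 0")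
    case True
    have "p x y = 0"
    proof (rule ccontr)
      assume "p x y \<noteq> 0"
      then show False using *[of "- (p x x + 1) / (2 * p x y)"] True by (simp add: field_simps)
    qed
    with True show ?thesis by simp
  next
    case False
    then have pos: "p y y > 0" using nonneg[OF assms(2)] by simp
    have "0 \<le> p x x - (p x y)\<^sup>2 / p y y"
      using *[of "- p x y / p y y"] pos by (simp add: field_simps power2_eq_square)
    then show ?thesis using pos by (simp add: field_simps)
  qed
qed

lemma null_left: "x \<in> W \<Longrightarrow> y \<in> W \<Longrightarrow> p x x = 0 \<Longrightarrow> p x y = 0"
  using Cauchy_Schwarz[of x y] by simp

lemma abs_le_sqrt: "x \<in> W \<Longrightarrow> y \<in> W \<Longrightarrow> \<bar>p x y\<bar> \<le> sqrt (p x x) * sqrt (p y y)"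
  using real_sqrt_le_mono[OF Cauchy_Schwarz[of x y]] by (simp add: real_sqrt_mult)

definition orthonormal :: "'a set \<Rightarrow> bool" where
  "orthonormal E \<longleftrightarrow> finite E \<and> E \<subseteq> W \<and> (\<forall>e\<in>E. \<forall>e'\<in>E. p e e' = (if e = e' then 1 else 0))"

text \<open>Two vectors that differ by a null vector have the same products, so replacing each member of an
  orthonormal set by its representative in the span of \<open>G\<close> gives an independent set in that span.\<close>

lemma card_orthonormal_le:
  assumes E: "orthonormal E" and G: "finite G" "G \<subseteq> W"
    and span: "\<And>e. e \<in> E \<Longrightarrow> \<exists>g\<in>span G. p (e - g) (e - g) = 0"
  shows "card E \<le> card G"
proof -
  obtain \<phi> where \<phi>: "\<And>e. e \<in> E \<Longrightarrow> \<phi> e \<in> span G \<and> p (e - \<phi> e) (e - \<phi> e) = 0"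
    using span by metis
  have spanW: "span G \<subseteq> W"
    using G subspace_W span_minimal by blast
  have inW: "e \<in> W" "\<phi> e \<in> W" if "e \<in> E" for e
    using that E \<phi> spanW by (auto simp: orthonormal_def)
  have same: "p (\<phi> e) (\<phi> e') = p e e'" if "e \<in> E" "e' \<in> E" for e e'
  proof -
    have "p (e - \<phi> e) e' = 0" "p (e' - \<phi> e') (\<phi> e) = 0"
      by (rule null_left; use that inW \<phi> in \<open>auto intro!: W_closed\<close>)+
    then show ?thesis
      using that inW sym[of e' "\<phi> e"] sym[of "\<phi> e'" "\<phi> e"] by (simp add: diff_left)
  qed
  have inj: "inj_on \<phi> E"
  proof (rule inj_onI)
    fix e e' assume *: "e \<in> E" "e' \<in> E" "\<phi> e = \<phi> e'"
    then have "p e e' = p e e" using same[of e e'] same[of e e] by simp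
    then show "e = e'" using * E by (auto simp: orthonormal_def split: if_splits)
  qed
  have fin: "finite (\<phi> ` E)" using E by (simp add: orthonormal_def)
  have "independent (\<phi> ` E)"
  proof
    assume "dependent (\<phi> ` E)"
    then obtain r v where r: "v \<in> \<phi> ` E" "r v \<noteq> 0" "(\<Sum>v\<in>\<phi> ` E. r v *\<^sub>R v) = 0"
      using fin by (auto simp: dependent_finite)
    then obtain e where e: "e \<in> E" "v = \<phi> e" by auto
    have "0 = p (\<Sum>v\<in>\<phi> ` E. r v *\<^sub>R v) (\<phi> e)"
      using r(3) e inW by (simp add: zero_left)
    also have "\<dots> = p (\<Sum>e'\<in>E. r (\<phi> e') *\<^sub>R \<phi> e') (\<phi> e)"
      using inj by (simp add: sum.reindex)
    also have "\<dots> = (\<Sum>e'\<in>E. r (\<phi> e') * p (\<phi> e') (\<phi> e))"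
      using inW e by (intro sum_left) auto
    also have "\<dots> = (\<Sum>e'\<in>E. if e' = e then r (\<phi> e') else 0)"
      using E e by (intro sum.cong) (auto simp: same orthonormal_def)
    also have "\<dots> = r v" using e E by (simp add: orthonormal_def)
    finally show False using r by simp
  qed
  then have "card (\<phi> ` E) \<le> card G"
    using independent_span_bound[OF G(1)] \<phi> by auto
  then show ?thesis using inj by (simp add: card_image)
qed

text \<open>An orthonormal set of largest cardinality: a vector with a non-null residual could be
  normalised and added.  The set \<open>G\<close> bounds the cardinality; its elements may be rougher than those of
  \<open>U\<close>.\<close>

theorem ex_orthonormal_basis:
  assumes U: "subspace U" "U \<subseteq> W" and G: "finite G" "G \<subseteq> W"
    and span: "\<And>w. w \<in> U \<Longrightarrow> \<exists>g\<in>span G. p (w - g) (w - g) = 0"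
  shows "\<exists>E\<subseteq>U. orthonormal E \<and>
     (\<forall>w\<in>U. p (w - (\<Sum>e\<in>E. p w e *\<^sub>R e)) (w - (\<Sum>e\<in>E. p w e *\<^sub>R e)) = 0)"
proof -
  let ?P = "\<lambda>E. E \<subseteq> U \<and> orthonormal E"
  have "?P {}" by (simp add: orthonormal_def)
  moreover have "\<forall>E. ?P E \<longrightarrow> card E < Suc (card G)"
    using card_orthonormal_le[OF _ G] span by (auto simp: less_Suc_eq_le)
  ultimately obtain E where E: "?P E" and max: "\<And>E'. ?P E' \<Longrightarrow> card E' \<le> card E"
    using ex_has_greatest_nat[of ?P "{}" card "Suc (card G)"] by blast
  have "p (w - (\<Sum>e\<in>E. p w e *\<^sub>R e)) (w - (\<Sum>e\<in>E. p w e *\<^sub>R e)) = 0" if w: "w \<in> U" for w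
  proof (rule ccontr)
    define r where "r = w - (\<Sum>e\<in>E. p w e *\<^sub>R e)"
    assume "p (w - (\<Sum>e\<in>E. p w e *\<^sub>R e)) (w - (\<Sum>e\<in>E. p w e *\<^sub>R e)) \<noteq> 0"
    then have nz: "p r r \<noteq> 0" by (simp add: r_def)
    have rU: "r \<in> U"
      unfolding r_def using w E U(1)
      by (intro subspace_diff subspace_sum subspace_scale) auto
    then have rW: "r \<in> W" using U by auto
    have pos: "p r r > 0" using nz nonneg[OF rW] by simp
    have orth: "p r e = 0" if e: "e \<in> E" for e
    proof -
      have eW: "e \<in> W" and EW: "E \<subseteq> W" using e E U by auto
      have "p (\<Sum>e'\<in>E. p w e' *\<^sub>R e') e = (\<Sum>e'\<in>E. p w e' * p e' e)"
        using EW eW by (intro sum_left) auto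
      also have "\<dots> = (\<Sum>e'\<in>E. if e' = e then p w e' else 0)"
        using E e by (intro sum.cong) (auto simp: orthonormal_def)
      also have "\<dots> = p w e" using e E by (simp add: orthonormal_def)
      finally show ?thesis
        using w U EW eW unfolding r_def by (subst diff_left) (auto intro!: W_closed)
    qed
    define q where "q = (1 / sqrt (p r r)) *\<^sub>R r"
    have qU: "q \<in> U" unfolding q_def using rU U(1) by (rule subspace_scale[rotated])
    have qq: "p q q = 1" using pos rW
      by (simp add: q_def scale_left scale_right W_closed)
    have qe: "p q e = 0" "p e q = 0" if e: "e \<in> E" for e
    proof -
      have "e \<in> W" using e E U by auto
      then show "p q e = 0" "p e q = 0" using rW orth[OF e] sym[of r e]
        by (auto simp: q_def scale_left scale_right)
    qed
    have notin: "q \<notin> E" using qq qe by force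
    have "?P (insert q E)"
      using E qU qq qe U(2) notin unfolding orthonormal_def by auto
    from max[OF this] show False
      using notin E by (simp add: orthonormal_def)
  qed
  then show ?thesis using E by blast
qed

text \<open>Expanding \<open>w\<close> in the orthonormal set leaves a null vector, which \<open>F\<close> annihilates.\<close>

lemma Riesz_representation:
  assumes E: "orthonormal E"
    and complete: "\<And>w. w \<in> W \<Longrightarrow> p (w - (\<Sum>e\<in>E. p w e *\<^sub>R e)) (w - (\<Sum>e\<in>E. p w e *\<^sub>R e)) = 0"
    and add: "\<And>x y. x \<in> W \<Longrightarrow> y \<in> W \<Longrightarrow> F (x + y) = F x + F y"
    and scale: "\<And>x r. x \<in> W \<Longrightarrow> F (r *\<^sub>R x) = r * F x"
    and null: "\<And>x. x \<in> W \<Longrightarrow> p x x = 0 \<Longrightarrow> F x = 0"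
    and w: "w \<in> W"
  shows "p (\<Sum>e\<in>E. F e *\<^sub>R e) w = F w"
proof -
  have EW: "e \<in> W" if "e \<in> E" for e using that E by (auto simp: orthonormal_def)
  have F0: "F 0 = 0" using scale[of 0 0] W_closed(1) by simp
  have F_sum: "F (\<Sum>e\<in>E'. r e *\<^sub>R e) = (\<Sum>e\<in>E'. r e * F e)" if "E' \<subseteq> E" for r E'
    using that
  proof (induction E' rule: infinite_finite_induct)
    case (insert e E')
    then show ?case using EW by (simp add: add scale W_closed subset_eq)
  qed (auto simp: F0)
  define s where "s = (\<Sum>e\<in>E. p w e *\<^sub>R e)"
  have sW: "s \<in> W" unfolding s_def using EW by (auto intro!: W_closed)
  have "F w = F ((w - s) + s)" by simp
  also have "\<dots> = F (w - s) + F s" using w sW by (intro add W_closed)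
  also have "F (w - s) = 0" using complete[OF w] w sW by (intro null W_closed) (auto simp: s_def)
  also have "F s = (\<Sum>e\<in>E. p w e * F e)" unfolding s_def by (rule F_sum) simp
  also have "(\<Sum>e\<in>E. p w e * F e) = (\<Sum>e\<in>E. F e * p e w)"
    using EW w by (intro sum.cong) (auto simp: sym[of w])
  also have "\<dots> = p (\<Sum>e\<in>E. F e *\<^sub>R e) w"
    using EW w by (intro sum_left[symmetric]) auto
  finally show ?thesis by simp
qed

lemma orthonormal_expansion:
  assumes E: "orthonormal E"
  shows "p (\<Sum>e\<in>E. r e *\<^sub>R e) (\<Sum>e\<in>E. r e *\<^sub>R e) = (\<Sum>e\<in>E. (r e)\<^sup>2)"
    and "e' \<in> E \<Longrightarrow> p (\<Sum>e\<in>E. r e *\<^sub>R e) e' = r e'"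
proof -
  have EW: "e \<in> W" if "e \<in> E" for e using that E by (auto simp: orthonormal_def)
  show *: "p (\<Sum>e\<in>E. r e *\<^sub>R e) e' = r e'" if e': "e' \<in> E" for e'
  proof -
    have "p (\<Sum>e\<in>E. r e *\<^sub>R e) e' = (\<Sum>e\<in>E. r e * p e e')"
      using EW e' by (intro sum_left) auto
    also have "\<dots> = (\<Sum>e\<in>E. if e = e' then r e else 0)"
      using E e' by (intro sum.cong) (auto simp: orthonormal_def)
    finally show ?thesis using e' E by (simp add: orthonormal_def)
  qed
  have sW: "(\<Sum>e\<in>E. r e *\<^sub>R e) \<in> W" using EW by (auto intro!: W_closed)
  have "p (\<Sum>e\<in>E. r e *\<^sub>R e) (\<Sum>e\<in>E. r e *\<^sub>R e) = (\<Sum>e\<in>E. r e * p e (\<Sum>e\<in>E. r e *\<^sub>R e))"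
    using EW sW by (intro sum_left) auto
  also have "\<dots> = (\<Sum>e\<in>E. (r e)\<^sup>2)"
  proof (rule sum.cong)
    fix e assume "e \<in> E"
    then show "r e * p e (\<Sum>e\<in>E. r e *\<^sub>R e) = (r e)\<^sup>2"
      using *[of e] sym[OF sW EW, of e] by (simp add: power2_eq_square)
  qed simp
  finally show "p (\<Sum>e\<in>E. r e *\<^sub>R e) (\<Sum>e\<in>E. r e *\<^sub>R e) = (\<Sum>e\<in>E. (r e)\<^sup>2)" .
qed

lemma orthonormal_span_coords:
  assumes E: "orthonormal E" and x: "x \<in> span E"
  shows "x = (\<Sum>e\<in>E. p x e *\<^sub>R e)"
proof -
  obtain r where r: "x = (\<Sum>e\<in>E. r e *\<^sub>R e)"
    using x E by (auto simp: orthonormal_def span_finite)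
  show ?thesis
    unfolding r using orthonormal_expansion(2)[OF E, of _ r] by (intro sum.cong) auto
qed

lemma span_orthonormal_subset: "orthonormal E \<Longrightarrow> span E \<subseteq> W"
  using span_minimal[OF _ subspace_W] by (auto simp: orthonormal_def)

lemma triangle:
  assumes "x \<in> W" "y \<in> W"
  shows "sqrt (p (x + y) (x + y)) \<le> sqrt (p x x) + sqrt (p y y)"
proof (rule real_le_lsqrt)
  have "p (x + y) (x + y) = p x x + 2 * p x y + p y y"
    using assms sym[of x y] by (simp add: add_left add_right W_closed)
  also have "\<dots> \<le> p x x + 2 * (sqrt (p x x) * sqrt (p y y)) + p y y"
    using abs_le_sqrt[OF assms] by linarith
  also have "\<dots> = (sqrt (p x x) + sqrt (p y y))\<^sup>2"
    using nonneg assms by (simp add: power2_sum)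
  finally show "p (x + y) (x + y) \<le> (sqrt (p x x) + sqrt (p y y))\<^sup>2" .
qed (use nonneg assms in auto)

text \<open>On the span of an orthonormal set the form is definite and induces a metric.  The value \<open>0\<close>
  outside the span makes the distance nonnegative and symmetric for all arguments, as
  \<^locale>\<open>Metric_space\<close> demands.\<close>

definition span_dist :: "'a set \<Rightarrow> 'a \<Rightarrow> 'a \<Rightarrow> real" where
  "span_dist E x y = (if x \<in> span E \<and> y \<in> span E then sqrt (p (x - y) (x - y)) else 0)"

lemma Metric_space_span_dist:
  assumes E: "orthonormal E"
  shows "Metric_space (span E) (span_dist E)"
proof
  note sub = span_orthonormal_subset[OF E]
  show "0 \<le> span_dist E x y" for x y
    using sub by (auto simp: span_dist_def intro!: nonneg W_closed)
  show "span_dist E x y = span_dist E y x" for x y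
  proof (cases "x \<in> span E \<and> y \<in> span E")
    case True
    then have "x - y \<in> W" using sub by (auto intro!: W_closed)
    then have "p (- (x - y)) (- (x - y)) = p (x - y) (x - y)"
      using scale_left[of "x - y" _ "-1"] scale_right[of "x - y" _ "-1"] W_closed(4)[of "x - y" "-1"]
      by simp
    then show ?thesis by (simp add: span_dist_def)
  qed (auto simp: span_dist_def)
  show "span_dist E x y = 0 \<longleftrightarrow> x = y" if xy: "x \<in> span E" "y \<in> span E" for x y
  proof
    assume "span_dist E x y = 0"
    then have null: "p (x - y) (x - y) = 0" using xy by (simp add: span_dist_def)
    have d: "x - y \<in> span E" using xy by (rule span_diff)
    have "p (x - y) e = 0" if "e \<in> E" for e
      by (rule null_left; use null d sub span_base[OF that] in auto)
    then have "(\<Sum>e\<in>E. p (x - y) e *\<^sub>R e) = 0" by simp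
    then have "x - y = 0"
      by (rule trans[OF orthonormal_span_coords[OF E d]])
    then show "x = y" by simp
  qed (use xy zero_left W_closed(1) in \<open>auto simp: span_dist_def\<close>)
  show "span_dist E x z \<le> span_dist E x y + span_dist E y z"
    if "x \<in> span E" "y \<in> span E" "z \<in> span E" for x y z
    using triangle[of "x - y" "y - z"] that sub
    by (auto simp: span_dist_def intro!: W_closed)
qed

text \<open>The coordinates of a Cauchy sequence are Cauchy sequences of real numbers.\<close>

lemma mcomplete_span_dist:
  assumes E: "orthonormal E"
  shows "Metric_space.mcomplete (span E) (span_dist E)"
proof -
  interpret M: Metric_space "span E" "span_dist E" by (rule Metric_space_span_dist[OF E])
  note sub = span_orthonormal_subset[OF E]
  have EW: "e \<in> W" if "e \<in> E" for e using that E by (auto simp: orthonormal_def)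
  show ?thesis
    unfolding M.mcomplete_def
  proof (intro allI impI)
    fix x assume x: "M.MCauchy x"
    then have x_in: "x n \<in> span E" for n by (auto simp: M.MCauchy_def)
    have dist: "span_dist E (x m) y = sqrt (p (x m - y) (x m - y))" if "y \<in> span E" for m y
      using x_in that by (simp add: span_dist_def)
    have "Cauchy (\<lambda>n. p (x n) e)" if e: "e \<in> E" for e
      unfolding Cauchy_def
    proof (intro allI impI)
      fix \<epsilon> :: real assume "0 < \<epsilon>"
      then obtain N where N: "\<And>m n. N \<le> m \<Longrightarrow> N \<le> n \<Longrightarrow> span_dist E (x m) (x n) < \<epsilon>"
        using x unfolding M.MCauchy_def by blast
      have "dist (p (x m) e) (p (x n) e) < \<epsilon>" if "m \<ge> N" "n \<ge> N" for m n
      proof -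
        have xW: "x m \<in> W" "x n \<in> W" "x m - x n \<in> W"
          using x_in sub by (auto intro!: W_closed)
        have "dist (p (x m) e) (p (x n) e) = \<bar>p (x m - x n) e\<bar>"
          using xW EW[OF e] by (simp add: dist_real_def diff_left)
        also have "\<dots> \<le> span_dist E (x m) (x n)"
          using abs_le_sqrt[OF xW(3) EW[OF e]] e E by (simp add: dist x_in orthonormal_def)
        finally show ?thesis using N[OF that] by simp
      qed
      then show "\<exists>M. \<forall>m\<ge>M. \<forall>n\<ge>M. dist (p (x m) e) (p (x n) e) < \<epsilon>" by blast
    qed
    then have "\<exists>l. (\<lambda>n. p (x n) e) \<longlonglongrightarrow> l" if "e \<in> E" for e
      using that by (simp add: Cauchy_convergent_iff convergent_def)
    then obtain r where r: "\<And>e. e \<in> E \<Longrightarrow> (\<lambda>n. p (x n) e) \<longlonglongrightarrow> r e" by metis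
    define y where "y = (\<Sum>e\<in>E. r e *\<^sub>R e)"
    have y: "y \<in> span E" unfolding y_def by (intro span_sum span_scale span_base)
    have "span_dist E (x n) y = sqrt (\<Sum>e\<in>E. (p (x n) e - r e)\<^sup>2)" for n
    proof -
      have "x n - y = (\<Sum>e\<in>E. p (x n) e *\<^sub>R e) - y"
        by (rule arg_cong[OF orthonormal_span_coords[OF E x_in]])
      also have "\<dots> = (\<Sum>e\<in>E. (p (x n) e - r e) *\<^sub>R e)"
        by (simp add: y_def scaleR_diff_left sum_subtractf)
      finally have "x n - y = (\<Sum>e\<in>E. (p (x n) e - r e) *\<^sub>R e)" .
      then show ?thesis
        using dist[OF y, of n] orthonormal_expansion(1)[OF E, of "\<lambda>e. p (x n) e - r e"] by simp
    qed
    moreover have "(\<lambda>n. sqrt (\<Sum>e\<in>E. (p (x n) e - r e)\<^sup>2)) \<longlonglongrightarrow> sqrt (\<Sum>e\<in>E. (r e - r e)\<^sup>2)"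
      by (intro tendsto_intros r)
    ultimately have "(\<lambda>n. span_dist E (x n) y) \<longlonglongrightarrow> 0" by simp
    then have "limitin M.mtopology x y sequentially"
      using y x_in unfolding M.limit_metric_sequentially
      by (auto simp: lim_sequentially dist_real_def)
    then show "\<exists>y. limitin M.mtopology x y sequentially" by blast
  qed
qed

end

text \<open>The form \<open>B (y, v) = \<Sum> b(e, y) b(e, v) + \<mu> c(y, v)\<close>, where \<open>e\<close> runs through an \<open>a\<close>-orthonormal basis of
  the flux space, is what remains of the mixed system after the flux has been eliminated: the flux
  belonging to \<open>y\<close> is \<open>\<Sum> b(e, y) e\<close>.  Solving the linear problem with right hand side \<open>G z\<close> defines a map
  \<open>z \<mapsto> T z\<close>.  Testing the difference of two such problems with the difference of their solutions shows that
  \<open>T\<close> contracts the \<open>B\<close>-norm by the factor \<open>L / \<mu>\<close>, because \<open>B\<close> dominates \<open>\<mu> c\<close>.\<close>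

theorem mixed_problem_solvable:
  fixes S :: "'a::real_vector set" and V :: "'b::real_vector set"
  assumes "semi_inner_product S a" "semi_inner_product V c"
    and S_fin: "finite GS" "GS \<subseteq> S" "\<And>s. s \<in> S \<Longrightarrow> \<exists>g\<in>span GS. a (s - g) (s - g) = 0"
    and V_fin: "finite GV" "GV \<subseteq> V" "\<And>v. v \<in> V \<Longrightarrow> \<exists>g\<in>span GV. c (v - g) (v - g) = 0"
    and b_add_left: "\<And>s t v. s \<in> S \<Longrightarrow> t \<in> S \<Longrightarrow> v \<in> V \<Longrightarrow> b (s + t) v = b s v + b t v"
    and b_scale_left: "\<And>s v r. s \<in> S \<Longrightarrow> v \<in> V \<Longrightarrow> b (r *\<^sub>R s) v = r * b s v"
    and b_add_right: "\<And>s v w. s \<in> S \<Longrightarrow> v \<in> V \<Longrightarrow> w \<in> V \<Longrightarrow> b s (v + w) = b s v + b s w"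
    and b_scale_right: "\<And>s v r. s \<in> S \<Longrightarrow> v \<in> V \<Longrightarrow> b s (r *\<^sub>R v) = r * b s v"
    and b_null_left: "\<And>s v. s \<in> S \<Longrightarrow> v \<in> V \<Longrightarrow> a s s = 0 \<Longrightarrow> b s v = 0"
    and b_null_right: "\<And>s v. s \<in> S \<Longrightarrow> v \<in> V \<Longrightarrow> c v v = 0 \<Longrightarrow> b s v = 0"
    and G_add: "\<And>z v w. z \<in> V \<Longrightarrow> v \<in> V \<Longrightarrow> w \<in> V \<Longrightarrow> G z (v + w) = G z v + G z w"
    and G_scale: "\<And>z v r. z \<in> V \<Longrightarrow> v \<in> V \<Longrightarrow> G z (r *\<^sub>R v) = r * G z v"
    and G_null: "\<And>z v. z \<in> V \<Longrightarrow> v \<in> V \<Longrightarrow> c v v = 0 \<Longrightarrow> G z v = 0"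
    and G_lipschitz: "\<And>y z v. y \<in> V \<Longrightarrow> z \<in> V \<Longrightarrow> v \<in> V \<Longrightarrow>
       \<bar>G y v - G z v\<bar> \<le> L * sqrt (c (y - z) (y - z)) * sqrt (c v v)"
    and L: "0 \<le> L" "L < \<mu>"
  shows "\<exists>s\<in>S. \<exists>y\<in>V. (\<forall>t\<in>S. a s t = b t y) \<and> (\<forall>v\<in>V. b s v + \<mu> * c y v = G y v)"
proof -
  interpret a: semi_inner_product S a by fact
  interpret c: semi_inner_product V c by fact
  obtain D where D: "D \<subseteq> S" "a.orthonormal D"
    and D_complete: "\<And>s. s \<in> S \<Longrightarrow> a (s - (\<Sum>e\<in>D. a s e *\<^sub>R e)) (s - (\<Sum>e\<in>D. a s e *\<^sub>R e)) = 0"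
    using a.ex_orthonormal_basis[OF a.subspace_W order_refl S_fin] by blast
  define B where "B = (\<lambda>y v. (\<Sum>e\<in>D. b e y * b e v) + \<mu> * c y v)"
  have b_sum: "b (\<Sum>e\<in>D'. r e *\<^sub>R e) v = (\<Sum>e\<in>D'. r e * b e v)"
    if v: "v \<in> V" and "D' \<subseteq> S" for r v D'
    using that(2)
  proof (induction D' rule: infinite_finite_induct)
    case (insert e D')
    then show ?case using v by (simp add: b_add_left b_scale_left a.W_closed subset_eq)
  qed (use v b_scale_left[of 0 v 0] a.W_closed(1) in auto)
  have lam: "\<mu> > 0" using L by simp
  have B_ge: "\<mu> * c v v \<le> B v v" for v
    by (auto simp: B_def intro: sum_nonneg)
  have DS: "e \<in> S" if "e \<in> D" for e using that D by auto
  interpret B: semi_inner_product V B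
  proof
    show "subspace V" by (rule c.subspace_W)
    fix x y z r assume xy: "x \<in> V"
    show "B x y = B y x" if "y \<in> V"
      using xy that by (simp add: B_def mult.commute c.sym)
    show "B (x + y) z = B x z + B y z" if "y \<in> V" "z \<in> V"
      using xy that DS by (simp add: B_def b_add_right c.add_left algebra_simps sum.distrib)
    show "B (r *\<^sub>R x) z = r * B x z" if "z \<in> V"
      using xy that DS by (simp add: B_def b_scale_right c.scale_left algebra_simps sum_distrib_left)
    show "0 \<le> B x x"
      using B_ge[of x] c.nonneg[OF xy] lam by (meson mult_nonneg_nonneg order_trans less_imp_le)
  qed
  have B_null: "B v v = 0 \<longleftrightarrow> c v v = 0" if "v \<in> V" for v
  proof
    assume "B v v = 0"
    then show "c v v = 0" using B_ge[of v] c.nonneg[OF that] lam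
      by (metis antisym mult_le_0_iff not_less)
  next
    assume "c v v = 0"
    then show "B v v = 0" using that DS by (simp add: B_def b_null_right)
  qed
  have "\<exists>g\<in>span GV. B (v - g) (v - g) = 0" if v: "v \<in> V" for v
  proof -
    obtain g where g: "g \<in> span GV" "c (v - g) (v - g) = 0" using V_fin(3)[OF v] by blast
    have "g \<in> V" using g(1) V_fin(2) span_minimal[OF _ c.subspace_W] by blast
    then show ?thesis using g v B_null[of "v - g"] by (auto intro!: c.W_closed bexI[of _ g])
  qed
  then obtain E where E: "E \<subseteq> V" "B.orthonormal E"
    and E_complete: "\<And>v. v \<in> V \<Longrightarrow> B (v - (\<Sum>e\<in>E. B v e *\<^sub>R e)) (v - (\<Sum>e\<in>E. B v e *\<^sub>R e)) = 0"
    using B.ex_orthonormal_basis[OF B.subspace_W order_refl V_fin(1,2)] by blast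
  define T where "T = (\<lambda>z. \<Sum>e\<in>E. G z e *\<^sub>R e)"
  have T: "B (T z) v = G z v" if "z \<in> V" "v \<in> V" for z v
    unfolding T_def using that E_complete
    by (intro B.Riesz_representation[OF E(2)]) (auto simp: G_add G_scale G_null B_null)
  have T_span: "T z \<in> span E" for z
    unfolding T_def by (intro span_sum span_scale span_base)
  have spanV: "span E \<subseteq> V" by (rule B.span_orthonormal_subset[OF E(2)])
  interpret M: Metric_space "span E" "B.span_dist E" by (rule B.Metric_space_span_dist[OF E(2)])
  have contraction: "B.span_dist E (T y) (T z) \<le> (L / \<mu>) * B.span_dist E y z"
    if yz: "y \<in> span E" "z \<in> span E" for y z
  proof -
    define e where "e = T y - T z"
    define k where "k = y - z"
    have V: "y \<in> V" "z \<in> V" "T y \<in> V" "T z \<in> V" "e \<in> V" "k \<in> V"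
      using yz T_span spanV by (auto simp: e_def k_def intro!: B.W_closed)
    have sqrt_c: "sqrt \<mu> * sqrt (c v v) \<le> sqrt (B v v)" for v
      using B_ge[of v] by (simp flip: real_sqrt_mult)
    have "B e e = G y e - G z e"
      using V by (simp add: e_def B.diff_left T)
    also have "\<dots> \<le> L * sqrt (c k k) * sqrt (c e e)"
      using G_lipschitz[of y z e] V by (simp add: k_def)
    also have "\<dots> = (L / \<mu>) * ((sqrt \<mu> * sqrt (c k k)) * (sqrt \<mu> * sqrt (c e e)))"
      using lam by (simp add: field_simps)
    also have "\<dots> \<le> (L / \<mu>) * (sqrt (B k k) * sqrt (B e e))"
      using sqrt_c L lam c.nonneg V B.nonneg by (intro mult_left_mono mult_mono) auto
    finally have le: "sqrt (B e e) * sqrt (B e e) \<le> (L / \<mu>) * sqrt (B k k) * sqrt (B e e)"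
      using B.nonneg[OF V(5)] by simp
    have "sqrt (B e e) \<le> (L / \<mu>) * sqrt (B k k)"
    proof (cases "B e e = 0")
      case True
      then show ?thesis using L lam B.nonneg[OF V(6)] by simp
    next
      case False
      then have "sqrt (B e e) > 0" using B.nonneg[OF V(5)] by simp
      with le show ?thesis by (rule mult_right_le_imp_le)
    qed
    then show ?thesis using yz T_span by (simp add: B.span_dist_def e_def k_def)
  qed
  obtain y where y: "y \<in> span E" "T y = y"
    using M.Banach_fixedpoint_thm[OF B.mcomplete_span_dist[OF E(2)], of T "L / \<mu>"]
      contraction T_span L lam span_zero[of E] by (auto simp: field_simps)
  then have yV: "y \<in> V" using spanV by auto
  define s where "s = (\<Sum>e\<in>D. b e y *\<^sub>R e)"
  have "s \<in> S" unfolding s_def using DS by (auto intro!: a.W_closed)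
  moreover have "a s t = b t y" if "t \<in> S" for t
    unfolding s_def using that D_complete yV
    by (intro a.Riesz_representation[OF D(2)]) (auto simp: b_add_left b_scale_left b_null_left)
  moreover have "b s v + \<mu> * c y v = G y v" if "v \<in> V" for v
    using T[OF yV that] y b_sum[OF that D(1), of "\<lambda>e. b e y"] by (simp add: s_def B_def)
  ultimately show ?thesis using yV by blast
qed

section \<open>Smooth bump functions and the fundamental lemma of the calculus of variations\<close>

lemma Ck_SucD: "Ck (Suc k) \<phi> \<Longrightarrow> Ck k \<phi>"
proof (induction k arbitrary: \<phi>)
  case 0
  then show ?case
    by (auto simp: continuous_on_eq_continuous_at intro: differentiable_imp_continuous_within)
qed auto

lemma Ck_const: "Ck k (\<lambda>x. c)"
  by (induction k arbitrary: c) (auto simp: frechet_derivative_const)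

lemma Ck_add: "Ck k \<phi> \<Longrightarrow> Ck k \<psi> \<Longrightarrow> Ck k (\<lambda>x. \<phi> x + \<psi> x)"
proof (induction k arbitrary: \<phi> \<psi>)
  case (Suc k)
  have "frechet_derivative (\<lambda>x. \<phi> x + \<psi> x) (at x) =
      (\<lambda>b. frechet_derivative \<phi> (at x) b + frechet_derivative \<psi> (at x) b)" for x
    using Suc.prems
    by (intro frechet_derivative_at[symmetric] has_derivative_add)
       (auto simp: frechet_derivative_works)
  then show ?case
    using Suc by (auto intro!: Suc.IH)
qed (auto intro: continuous_intros)

lemma Ck_mult: "Ck k \<phi> \<Longrightarrow> Ck k \<psi> \<Longrightarrow> Ck k (\<lambda>x. \<phi> x * \<psi> x)"
proof (induction k arbitrary: \<phi> \<psi>)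
  case (Suc k)
  have "frechet_derivative (\<lambda>x. \<phi> x * \<psi> x) (at x) =
      (\<lambda>b. \<phi> x * frechet_derivative \<psi> (at x) b + frechet_derivative \<phi> (at x) b * \<psi> x)" for x
    using Suc.prems
    by (intro frechet_derivative_at[symmetric] has_derivative_mult)
       (auto simp: frechet_derivative_works)
  then show ?case
    using Suc Ck_SucD[of k \<phi>] Ck_SucD[of k \<psi>] by (auto intro!: Ck_add Suc.IH)
qed (auto intro: continuous_intros)

lemma Ck_prod: "(\<And>i. i \<in> I \<Longrightarrow> Ck k (\<phi> i)) \<Longrightarrow> Ck k (\<lambda>x. \<Prod>i\<in>I. \<phi> i x)"
  by (induction I rule: infinite_finite_induct) (auto intro!: Ck_const Ck_mult)

text \<open>These functions are flat to all orders at \<open>0\<close>, and the family is closed under differentiation, so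
  every member is smooth; \<open>flat 1\<close> is the classical \<open>exp (- 1 / x)\<close>, extended by \<open>0\<close>.\<close>

definition flat :: "real poly \<Rightarrow> real \<Rightarrow> real" where
  "flat P x = (if x > 0 then poly P (1 / x) * exp (- (1 / x)) else 0)"

lemma poly_times_exp_tendsto_0: "((\<lambda>y. poly P y * exp (- y)) \<longlongrightarrow> (0::real)) at_top"
proof -
  have "((\<lambda>y. \<Sum>i\<le>degree P. coeff P i * (y ^ i / exp y)) \<longlongrightarrow> (\<Sum>i\<le>degree P. coeff P i * 0)) at_top"
    by (intro tendsto_intros tendsto_power_div_exp_0)
  then show ?thesis
    by (simp add: poly_altdef sum_distrib_right sum_divide_distrib exp_minus field_simps)
qed

lemma flat_has_derivative:
  "(flat P has_real_derivative flat (monom 1 2 * (P - pderiv P)) x) (at x)"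
proof -
  consider "x > 0" | "x < 0" | "x = 0" by linarith
  then show ?thesis
  proof cases
    case 1
    have "((\<lambda>x. poly P (1 / x) * exp (- (1 / x))) has_real_derivative
        flat (monom 1 2 * (P - pderiv P)) x) (at x)"
      using 1 by (auto intro!: derivative_eq_intros
        simp: flat_def poly_monom power2_eq_square field_simps)
    then show ?thesis
      by (rule has_field_derivative_transform_within_open[where S = "{0<..}"])
         (use 1 in \<open>auto simp: flat_def\<close>)
  next
    case 2
    have "((\<lambda>x. 0) has_real_derivative flat (monom 1 2 * (P - pderiv P)) x) (at x)"
      using 2 by (auto simp: flat_def)
    then show ?thesis
      by (rule has_field_derivative_transform_within_open[where S = "{..<0}"])
         (use 2 in \<open>auto simp: flat_def\<close>)
  next
    case 3
    have "((\<lambda>h. flat P h / h) \<longlongrightarrow> 0) (at_left 0)"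
      by (rule tendsto_eventually) (auto simp: flat_def eventually_at_left_field intro!: exI[of _ "-1"])
    moreover have "((\<lambda>h. flat P h / h) \<longlongrightarrow> 0) (at_right 0)"
    proof (rule Lim_transform_eventually)
      show "((\<lambda>h. poly (pCons 0 P) (inverse h) * exp (- inverse h)) \<longlongrightarrow> 0) (at_right (0::real))"
        by (rule filterlim_compose[OF poly_times_exp_tendsto_0 filterlim_inverse_at_top_right])
      show "\<forall>\<^sub>F h in at_right 0. poly (pCons 0 P) (inverse h) * exp (- inverse h) = flat P h / h"
        by (auto simp: eventually_at_right_field flat_def field_simps intro!: exI[of _ 1])
    qed
    ultimately have "((\<lambda>h. flat P h / h) \<longlongrightarrow> 0) (at 0)"
      by (simp add: filterlim_at_split)
    then show ?thesis
      using 3 by (simp add: DERIV_def flat_def)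
  qed
qed

text \<open>The statement covers all \<open>P\<close> at once because differentiation changes \<open>P\<close>.\<close>

lemma Ck_flat: "Ck k (\<lambda>x :: real^'d. flat P (r * x $ i + s))"
proof (induction k arbitrary: P)
  case 0
  have "isCont (flat P) x" for x
    using flat_has_derivative by (rule DERIV_isCont)
  then have "continuous_on UNIV (flat P)" by (simp add: continuous_on_eq_continuous_at)
  then have "continuous_on UNIV (\<lambda>x :: real^'d. flat P (r * x $ i + s))"
    by (rule continuous_on_compose2) (auto intro!: continuous_intros)
  then show ?case by simp
next
  case (Suc k)
  let ?Q = "monom 1 2 * (P - pderiv P)"
  have *: "((\<lambda>x :: real^'d. flat P (r * x $ i + s)) has_derivative
      (\<lambda>b. r * b $ i * flat ?Q (r * x $ i + s))) (at x)" for x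
    by (rule DERIV_compose_FDERIV[OF flat_has_derivative])
       (auto intro!: derivative_eq_intros bounded_linear.has_derivative[OF bounded_linear_vec_nth])
  then show ?case
    by (auto simp: frechet_derivative_at[OF *, symmetric] differentiable_def
        intro!: Ck_mult Ck_const Suc.IH)
qed

text \<open>A factor \<open>flat 1 ((n + 1) (x - a) - 1)\<close> tends to \<open>1\<close> for \<open>x > a\<close> and is \<open>0\<close> for
  \<open>x \<le> a\<close>.\<close>

definition box_bump :: "real^'d \<Rightarrow> real^'d \<Rightarrow> nat \<Rightarrow> real^'d \<Rightarrow> real" where
  "box_bump a b n x = (\<Prod>i\<in>UNIV. flat 1 (real (Suc n) * x $ i + (- real (Suc n) * a $ i - 1)) *
     flat 1 (- real (Suc n) * x $ i + (real (Suc n) * b $ i - 1)))"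

lemma flat_1_range: "0 \<le> flat 1 x" "flat 1 x \<le> 1"
  by (auto simp: flat_def)

lemma flat_1_eq_0: "flat 1 x = 0 \<longleftrightarrow> x \<le> 0"
  by (auto simp: flat_def)

lemma flat_1_tendsto:
  assumes "t > 0"
  shows "(\<lambda>n. flat 1 (real (Suc n) * t - 1)) \<longlonglongrightarrow> 1"
proof -
  have "filterlim (\<lambda>n. real (Suc n) * t - 1) at_top sequentially"
    using assms by real_asymp
  moreover have "((\<lambda>x. flat 1 x) \<longlongrightarrow> 1) at_top"
  proof (rule Lim_transform_eventually)
    show "((\<lambda>x::real. exp (- (1 / x))) \<longlongrightarrow> 1) at_top" by real_asymp
    show "\<forall>\<^sub>F x in at_top. exp (- (1 / x)) = flat 1 x"
      using eventually_gt_at_top[of 0] by eventually_elim (auto simp: flat_def)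
  qed
  ultimately show ?thesis by (rule filterlim_compose[rotated])
qed

lemma box_bump_range: "\<bar>box_bump a b n x\<bar> \<le> 1"
proof -
  have "0 \<le> box_bump a b n x" "box_bump a b n x \<le> 1"
    unfolding box_bump_def using flat_1_range
    by (auto intro!: prod_nonneg prod_le_1 mult_le_one)
  then show ?thesis by simp
qed

text \<open>A factor of \<open>box_bump a b n\<close> is positive only where the coordinate is more than \<open>1 / (n + 1)\<close>
  inside the box.  This keeps the support of \<open>box_bump a b n\<close> inside the open box, so that the
  closure of the box need not lie in the domain.\<close>

lemma box_bump_test_function:
  assumes "box a b \<subseteq> \<Omega>"
  shows "box_bump a b n \<in> test_functions \<Omega>"
proof -
  define K where "K = cbox (a + (\<chi> i. 1 / real (Suc n))) (b - (\<chi> i. 1 / real (Suc n)))"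
  have "x \<in> K" if "box_bump a b n x \<noteq> 0" for x
    unfolding K_def mem_box_cart
  proof
    fix i
    have "0 < real (Suc n) * x $ i + (- real (Suc n) * a $ i - 1)"
      "0 < - real (Suc n) * x $ i + (real (Suc n) * b $ i - 1)"
      using that unfolding box_bump_def by (auto simp: flat_1_eq_0 not_le simp del: of_nat_Suc)
    then show "(a + (\<chi> i. 1 / real (Suc n))) $ i \<le> x $ i \<and> x $ i \<le> (b - (\<chi> i. 1 / real (Suc n))) $ i"
      by (simp add: field_simps)
  qed
  then have sub: "closure {x. box_bump a b n x \<noteq> 0} \<subseteq> K"
    by (intro closure_minimal) (auto simp: K_def closed_cbox)
  have "K \<subseteq> box a b"
  proof
    fix x assume x: "x \<in> K"
    have "a $ i < x $ i \<and> x $ i < b $ i" for i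
    proof -
      have "0 < 1 / real (Suc n)" by simp
      moreover have "a $ i + 1 / real (Suc n) \<le> x $ i" "x $ i \<le> b $ i - 1 / real (Suc n)"
        using x by (auto simp: K_def mem_box_cart simp del: of_nat_Suc)
      ultimately show ?thesis by linarith
    qed
    then show "x \<in> box a b" by (simp add: mem_box_cart)
  qed
  moreover have "Ck k (box_bump a b n)" for k
    unfolding box_bump_def by (intro Ck_prod Ck_mult Ck_flat)
  moreover have "compact (closure {x. box_bump a b n x \<noteq> 0})"
    using sub bounded_subset[of K] by (simp add: compact_eq_bounded_closed K_def)
  ultimately show ?thesis
    using sub assms by (auto simp: test_functions_def)
qed

lemma box_bump_tendsto:
  fixes a b x :: "real^'d"
  shows "(\<lambda>n. box_bump a b n x) \<longlonglongrightarrow> indicator (box a b) x"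
proof (cases "x \<in> box a b")
  case True
  have "(\<lambda>n. \<Prod>i\<in>UNIV. flat 1 (real (Suc n) * (x $ i - a $ i) - 1) *
     flat 1 (real (Suc n) * (b $ i - x $ i) - 1)) \<longlonglongrightarrow> (\<Prod>i\<in>(UNIV :: 'd set). 1 * 1)"
    using True by (intro tendsto_prod tendsto_mult flat_1_tendsto) (auto simp: mem_box_cart)
  then show ?thesis using True by (simp add: box_bump_def algebra_simps)
next
  case False
  then obtain i where "x $ i \<le> a $ i \<or> b $ i \<le> x $ i" by (auto simp: mem_box_cart not_less)
  then have "flat 1 (real (Suc n) * x $ i + (- real (Suc n) * a $ i - 1)) = 0 \<or>
     flat 1 (- real (Suc n) * x $ i + (real (Suc n) * b $ i - 1)) = 0" for n
    unfolding flat_1_eq_0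
  proof (elim disj_forward)
    show "real (Suc n) * x $ i + (- real (Suc n) * a $ i - 1) \<le> 0" if "x $ i \<le> a $ i"
      using mult_left_mono[OF that, of "real (Suc n)"] by (simp add: algebra_simps)
    show "- real (Suc n) * x $ i + (real (Suc n) * b $ i - 1) \<le> 0" if "b $ i \<le> x $ i"
      using mult_left_mono[OF that, of "real (Suc n)"] by (simp add: algebra_simps)
  qed
  then have "box_bump a b n x = 0" for n
    unfolding box_bump_def by (intro prod_zero) auto
  then show ?thesis using False by simp
qed

lemma test_function_continuous: "\<phi> \<in> test_functions \<Omega> \<Longrightarrow> continuous_on UNIV \<phi>"
  unfolding test_functions_def using Ck.simps(1) by blast

lemma test_function_measurable [measurable_dest]:
  "\<phi> \<in> test_functions \<Omega> \<Longrightarrow> \<phi> \<in> borel_measurable borel"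
  using test_function_continuous borel_measurable_continuous_onI by blast

lemma integral_box_eq_0:
  fixes f :: "real^'d \<Rightarrow> real"
  assumes M: "sets M = sets borel" and f: "integrable M f"
    and orth: "\<And>\<phi>. \<phi> \<in> test_functions \<Omega> \<Longrightarrow> (LINT x|M. f x * \<phi> x) = 0"
    and sub: "box a b \<subseteq> \<Omega>"
  shows "(LINT x|M. indicator (box a b) x * f x) = 0"
proof -
  have [measurable]: "f \<in> borel_measurable M" "box_bump a b n \<in> borel_measurable M"
    "box a b \<in> sets M" for n
    using f test_function_measurable[OF box_bump_test_function[OF sub]]
    by (auto simp: M measurable_cong_sets[OF M refl])
  have "(\<lambda>n. LINT x|M. f x * box_bump a b n x) \<longlonglongrightarrow> (LINT x|M. f x * indicator (box a b) x)"
  proof (rule integral_dominated_convergence[where w = "\<lambda>x. \<bar>f x\<bar>"])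
    show "AE x in M. (\<lambda>n. f x * box_bump a b n x) \<longlonglongrightarrow> f x * indicator (box a b) x"
      by (intro AE_I2 tendsto_intros box_bump_tendsto)
    show "AE x in M. norm (f x * box_bump a b n x) \<le> \<bar>f x\<bar>" for n
      using box_bump_range[of a b n] by (intro AE_I2) (simp add: abs_mult mult_left_le)
  qed (use f in auto)
  then show ?thesis
    using orth[OF box_bump_test_function[OF sub]] by (simp add: LIMSEQ_const_iff mult.commute)
qed

lemma box_Int_box_cart:
  "box a b \<inter> box c d = box (\<chi> i. max (a $ i) (c $ i)) (\<chi> i. min (b $ i) (d $ i))"
  for a :: "real^'d"
  by (auto simp: mem_box_cart)

text \<open>Integrals over boxes in \<open>\<Omega>\<close> vanish in the limit of the bumps; boxes are stable under
  intersection and generate the Borel sets, so the integrals over all Borel subsets of such a box vanish.\<close>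

theorem AE_eq_0_of_test_functions:
  fixes f :: "real^'d \<Rightarrow> real"
  assumes M: "sets M = sets borel" and f: "integrable M f" and \<Omega>: "open \<Omega>"
    and outside: "\<And>x. x \<notin> \<Omega> \<Longrightarrow> f x = 0"
    and orth: "\<And>\<phi>. \<phi> \<in> test_functions \<Omega> \<Longrightarrow> (LINT x|M. f x * \<phi> x) = 0"
  shows "AE x in M. f x = 0"
proof -
  have [measurable]: "f \<in> borel_measurable M" using f by auto
  have spM: "space M = UNIV" using sets_eq_imp_space_eq[OF M] by simp
  have [measurable]: "box a b \<in> sets M" for a b by (simp add: M)
  have stable: "Int_stable (range (\<lambda>(a, b). box a b :: (real^'d) set))"
    by (auto simp: Int_stable_def box_Int_box_cart)
  have gen: "range (\<lambda>(a, b). box a b :: (real^'d) set) \<subseteq> Pow UNIV" by simp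
  have AE_box: "AE x in M. indicator (box a b) x * f x = 0" if sub: "box a b \<subseteq> \<Omega>" for a b
  proof (rule density_unique_real)
    have int: "integrable M (\<lambda>x. indicator (box a b) x * f x)"
      using integrable_real_mult_indicator[OF _ f, of "box a b"] by (simp add: mult.commute)
    then show "integrable M (\<lambda>x. indicator (box a b) x * f x)" .
    show "integrable M (\<lambda>x. 0)" by simp
    fix A assume "A \<in> sets M"
    then have "A \<in> sigma_sets UNIV (range (\<lambda>(a, b). box a b :: (real^'d) set))"
      unfolding M borel_eq_box by (simp add: sets_measure_of)
    with stable gen have "(LINT x:A|M. indicator (box a b) x * f x) = 0"
    proof (induction rule: sigma_sets_induct_disjoint)
      case (basic A)
      then obtain c d where A: "A = box c d" by auto
      have "(LINT x:A|M. indicator (box a b) x * f x) = (LINT x|M. indicator (box c d \<inter> box a b) x * f x)"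
        by (simp add: set_lebesgue_integral_def A indicator_inter_arith mult.assoc)
      also have "\<dots> = 0"
        using sub unfolding box_Int_box_cart
        by (intro integral_box_eq_0[OF M f orth]) (auto simp flip: box_Int_box_cart)
      finally show ?case .
    next
      case (compl A)
      then have A: "A \<in> sets M" unfolding M borel_eq_box by (simp add: sets_measure_of)
      have "(LINT x:UNIV - A|M. indicator (box a b) x * f x) =
          (LINT x|M. indicator (box a b) x * f x) - (LINT x:A|M. indicator (box a b) x * f x)"
        unfolding set_lebesgue_integral_def
          Bochner_Integration.integral_diff[OF int integrable_mult_indicator[OF A int], symmetric]
        by (rule Bochner_Integration.integral_cong) (auto simp: indicator_def)
      then show ?case using compl integral_box_eq_0[OF M f orth sub] by simp
    next
      case (union A)
      then have A: "A i \<in> sets M" for i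
        unfolding M borel_eq_box by (auto simp: sets_measure_of)
      have "set_integrable M (\<Union>i. A i) (\<lambda>x. indicator (box a b) x * f x)"
        unfolding set_integrable_def using int A by (intro integrable_mult_indicator) auto
      with A union show ?case
        by (subst lebesgue_integral_countable_add) (auto simp: disjoint_family_on_def)
    qed (simp add: set_lebesgue_integral_def)
    then show "(LINT x:A|M. indicator (box a b) x * f x) = (LINT x:A|M. 0)"
      by (simp add: set_lebesgue_integral_def)
  qed
  obtain D where D: "countable D" "\<And>X. X \<in> D \<Longrightarrow> X \<subseteq> \<Omega>" "\<And>X. X \<in> D \<Longrightarrow> \<exists>a b. X = box a b" "\<Union>D = \<Omega>"
    using open_countable_Union_open_box[OF \<Omega>] by (metis PowD subsetD)
  have "AE x in M. indicator X x * f x = 0" if "X \<in> D" for X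
    using D(2,3)[OF that] AE_box by blast
  then have "AE x in M. \<forall>X\<in>D. indicator X x * f x = 0"
    by (subst AE_ball_countable[OF D(1)]) blast
  then show ?thesis
  proof eventually_elim
    case (elim x)
    then show ?case using outside[of x] D(4) by (cases "x \<in> \<Omega>") (auto simp: indicator_def)
  qed
qed

section \<open>Finite surface measure of the interface\<close>

text \<open>A finite cover is padded with empty sets; these weigh nothing since \<open>0 powr s = 0\<close>.\<close>

lemma hausdorff_outer_le_of_covers:
  assumes "\<And>\<delta>. \<delta> > 0 \<Longrightarrow> \<exists>I c. finite (I :: 'i set) \<and> A \<subseteq> (\<Union>i\<in>I. c i) \<and>
       (\<forall>i\<in>I. bounded (c i) \<and> diameter (c i) \<le> \<delta>) \<and>
       (\<Sum>i\<in>I. unit_ball_vol s * (diameter (c i) / 2) powr s) \<le> C"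
    and s: "0 < s"
  shows "hausdorff_outer s A \<le> ennreal C"
  unfolding hausdorff_outer_def
proof (rule SUP_least)
  fix \<delta> :: real assume "\<delta> \<in> {0<..}"
  then have "\<delta> > 0" by simp
  then obtain I :: "'i set" and c where I: "finite I" and cover: "A \<subseteq> (\<Union>i\<in>I. c i)"
    and c: "\<And>i. i \<in> I \<Longrightarrow> bounded (c i)" "\<And>i. i \<in> I \<Longrightarrow> diameter (c i) \<le> \<delta>"
    and C: "(\<Sum>i\<in>I. unit_ball_vol s * (diameter (c i) / 2) powr s) \<le> C"
    using assms(1)[of \<delta>] by blast
  let ?w = "\<lambda>X. unit_ball_vol s * (diameter X / 2) powr s"
  obtain h where h: "bij_betw h {..<card I} I"
    using I ex_bij_betw_nat_finite[of I] by (auto simp: atLeast0LessThan)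
  define D where "D = (\<lambda>n. if n < card I then c (h n) else {})"
  have hI: "h n \<in> I" if "n < card I" for n using h that by (auto simp: bij_betw_def)
  have "(\<Sum>n. ennreal (?w (D n))) = (\<Sum>n<card I. ennreal (?w (D n)))"
    using s by (intro suminf_finite) (auto simp: D_def)
  also have "\<dots> = (\<Sum>i\<in>I. ennreal (?w (c i)))"
    unfolding sum.reindex_bij_betw[OF h, symmetric] by (intro sum.cong) (auto simp: D_def)
  also have "\<dots> = ennreal (\<Sum>i\<in>I. ?w (c i))"
    using s by (intro sum_ennreal) (auto simp: unit_ball_vol_nonneg)
  also have "\<dots> \<le> ennreal C" using C by (intro ennreal_leI)
  finally have "(\<Sum>n. ennreal (?w (D n))) \<le> ennreal C" .
  moreover have "A \<subseteq> \<Union>(range D)"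
  proof
    fix x assume "x \<in> A"
    then obtain i where i: "i \<in> I" "x \<in> c i" using cover by blast
    then obtain n where "n < card I" "i = h n" using h by (auto simp: bij_betw_def)
    then have "x \<in> D n" using i by (simp add: D_def)
    then show "x \<in> \<Union>(range D)" by blast
  qed
  moreover have "\<forall>n. bounded (D n) \<and> diameter (D n) \<le> \<delta>"
    using c hI \<open>\<delta> > 0\<close> by (auto simp: D_def)
  ultimately show "(INF C\<in>{C. A \<subseteq> \<Union>(range C) \<and> (\<forall>i. bounded (C i) \<and> diameter (C i) \<le> \<delta>)}.
      \<Sum>i. ennreal (?w (C i))) \<le> ennreal C"
    by (intro INF_lower2[of D]) auto
qed

text \<open>In a hyperplane the coordinate along the largest component of the normal vector is
  controlled by the other coordinates.\<close>

lemma hyperplane_norm_le: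
  fixes a :: "real^'d"
  assumes j: "\<And>i. \<bar>a $ i\<bar> \<le> \<bar>a $ j\<bar>" "a \<noteq> 0" and eq: "a \<bullet> x = a \<bullet> y"
  shows "norm (x - y) \<le> 2 * (\<Sum>i\<in>UNIV - {j}. \<bar>x $ i - y $ i\<bar>)"
proof -
  have aj: "\<bar>a $ j\<bar> > 0"
  proof -
    obtain i where "a $ i \<noteq> 0" using j(2) by (auto simp: vec_eq_iff)
    then show ?thesis using j(1)[of i] by linarith
  qed
  have "(\<Sum>i\<in>UNIV. a $ i * (x $ i - y $ i)) = 0"
    using eq by (simp add: inner_vec_def algebra_simps sum_subtractf)
  then have "a $ j * (x $ j - y $ j) = - (\<Sum>i\<in>UNIV - {j}. a $ i * (x $ i - y $ i))"
    by (simp add: sum.remove[of UNIV j])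
  then have "\<bar>a $ j\<bar> * \<bar>x $ j - y $ j\<bar> = \<bar>\<Sum>i\<in>UNIV - {j}. a $ i * (x $ i - y $ i)\<bar>"
    by (simp flip: abs_mult)
  also have "\<dots> \<le> (\<Sum>i\<in>UNIV - {j}. \<bar>a $ j\<bar> * \<bar>x $ i - y $ i\<bar>)"
    using j by (intro order_trans[OF sum_abs] sum_mono) (auto simp: abs_mult intro: mult_right_mono)
  also have "\<dots> = \<bar>a $ j\<bar> * (\<Sum>i\<in>UNIV - {j}. \<bar>x $ i - y $ i\<bar>)"
    by (simp add: sum_distrib_left)
  finally have "\<bar>x $ j - y $ j\<bar> \<le> (\<Sum>i\<in>UNIV - {j}. \<bar>x $ i - y $ i\<bar>)"
    using aj by simp
  moreover have "norm (x - y) \<le> (\<Sum>i\<in>UNIV. \<bar>x $ i - y $ i\<bar>)"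
    using norm_le_l1_cart[of "x - y"] by simp
  moreover have "(\<Sum>i\<in>UNIV. \<bar>x $ i - y $ i\<bar>) = \<bar>x $ j - y $ j\<bar> + (\<Sum>i\<in>UNIV - {j}. \<bar>x $ i - y $ i\<bar>)"
    by (simp add: sum.remove[of UNIV j])
  ultimately show ?thesis by linarith
qed

text \<open>Cutting the range of each of the \<open>d - 1\<close> other coordinates into \<open>m\<close> equal parts covers the set by
  \<open>m ^ (d - 1)\<close> pieces whose diameter is of order \<open>1 / m\<close>, so the sum of the \<open>(d - 1)\<close>-st powers of the
  diameters stays bounded as \<open>m\<close> grows.\<close>

lemma hausdorff_outer_hyperplane_finite:
  fixes F :: "(real^'d) set"
  assumes a: "a \<noteq> 0" "F \<subseteq> {x. a \<bullet> x = b}" and F: "bounded F" and d: "CARD('d) \<ge> 2"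
  shows "hausdorff_outer (real CARD('d) - 1) F < \<infinity>"
proof -
  define s where "s = CARD('d) - 1"
  have s: "s > 0" "real CARD('d) - 1 = real s" using d by (auto simp: s_def)
  obtain j where j: "\<And>i. \<bar>a $ i\<bar> \<le> \<bar>a $ j\<bar>"
  proof -
    have "Max (range (\<lambda>i. \<bar>a $ i\<bar>)) \<in> range (\<lambda>i. \<bar>a $ i\<bar>)" by (intro Max_in) auto
    then obtain j where "Max (range (\<lambda>i. \<bar>a $ i\<bar>)) = \<bar>a $ j\<bar>" by (rule imageE)
    then show ?thesis using that[of j] Max_ge[of "range (\<lambda>i. \<bar>a $ i\<bar>)"] by auto
  qed
  obtain R where R: "R > 0" "\<And>x. x \<in> F \<Longrightarrow> norm x \<le> R"
    using F by (meson bounded_pos)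
  define J where "J = UNIV - {j}"
  have cardJ: "card J = s" "finite J" by (auto simp: J_def s_def)
  define Q where "Q = 4 * R * real s"
  have Q: "Q > 0" using R s by (simp add: Q_def)
  have "hausdorff_outer (real s) F \<le> ennreal (unit_ball_vol (real s) * (Q / 2) powr real s)"
  proof (rule hausdorff_outer_le_of_covers[where 'i = "'d \<Rightarrow> nat"])
    fix \<delta> :: real assume \<delta>: "\<delta> > 0"
    obtain m :: nat where m': "Q / \<delta> < real m" using reals_Archimedean2 by blast
    have m: "m > 0" "Q / real m \<le> \<delta>"
    proof -
      have "0 < Q / \<delta>" using Q \<delta> by simp
      then have "0 < real m" using m' by linarith
      then show "m > 0" "Q / real m \<le> \<delta>" using m' \<delta> by (auto simp: field_simps)
    qed
    define H where "H = 2 * R / real m"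
    have H: "H > 0" using R m by (simp add: H_def)
    define I where "I = J \<rightarrow>\<^sub>E {..<m}"
    define c where "c = (\<lambda>\<kappa>. {x \<in> F. \<forall>i\<in>J. real (\<kappa> i) * H \<le> x $ i + R \<and> x $ i + R \<le> real (\<kappa> i + 1) * H})"
    have I: "finite I" "card I = m ^ s"
      using cardJ by (auto simp: I_def finite_PiE card_PiE)
    have cover: "F \<subseteq> (\<Union>\<kappa>\<in>I. c \<kappa>)"
    proof
      fix x assume x: "x \<in> F"
      have xi: "0 \<le> x $ i + R" "x $ i + R \<le> 2 * R" for i
        using component_le_norm_cart[of x i] R(2)[OF x] by auto
      \<comment> \<open>a coordinate at the right end of the range belongs to the last part\<close>
      define \<kappa> where "\<kappa> = restrict (\<lambda>i. min (nat \<lfloor>(x $ i + R) / H\<rfloor>) (m - 1)) J"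
      have "\<kappa> \<in> I" using m by (auto simp: \<kappa>_def I_def)
      moreover have "real (\<kappa> i) * H \<le> x $ i + R \<and> x $ i + R \<le> real (\<kappa> i + 1) * H" if i: "i \<in> J" for i
      proof -
        define q where "q = (x $ i + R) / H"
        have "0 \<le> q" using xi[of i] H by (simp add: q_def)
        moreover have "q \<le> 2 * R / H"
          unfolding q_def using xi(2) H by (intro divide_right_mono) auto
        ultimately have q: "0 \<le> q" "q \<le> real m" "x $ i + R = q * H"
          using H m R by (auto simp: q_def H_def)
        have k: "\<kappa> i = min (nat \<lfloor>q\<rfloor>) (m - 1)" using i by (simp add: \<kappa>_def q_def)
        have n: "real (nat \<lfloor>q\<rfloor>) \<le> q" "q \<le> real (nat \<lfloor>q\<rfloor>) + 1"
          using q by (auto simp: of_nat_nat)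
        have "real (\<kappa> i) \<le> q \<and> q \<le> real (\<kappa> i) + 1"
        proof (cases "nat \<lfloor>q\<rfloor> \<le> m - 1")
          case True
          then have "\<kappa> i = nat \<lfloor>q\<rfloor>" using k by simp
          then show ?thesis using n by simp
        next
          case False
          then have "\<kappa> i = m - 1" "m \<le> nat \<lfloor>q\<rfloor>" using k by simp_all
          then have "real (\<kappa> i) = real m - 1" "real m \<le> real (nat \<lfloor>q\<rfloor>)"
            using m(1) by (simp_all add: of_nat_diff)
          then show ?thesis using n q by linarith
        qed
        then show ?thesis using H q(3) by (auto simp: mult_right_mono)
      qed
      ultimately show "x \<in> (\<Union>\<kappa>\<in>I. c \<kappa>)" using x by (auto simp: c_def)
    qed
    have bdd: "bounded (c \<kappa>)" for \<kappa>
      by (rule bounded_subset[OF F]) (auto simp: c_def)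
    have diam: "diameter (c \<kappa>) \<le> Q / real m" for \<kappa>
    proof (rule diameter_le)
      show "c \<kappa> \<noteq> {} \<or> 0 \<le> Q / real m" using Q m by simp
      fix x y assume xy: "x \<in> c \<kappa>" "y \<in> c \<kappa>"
      then have "a \<bullet> x = a \<bullet> y" using a by (auto simp: c_def)
      then have "norm (x - y) \<le> 2 * (\<Sum>i\<in>J. \<bar>x $ i - y $ i\<bar>)"
        unfolding J_def by (rule hyperplane_norm_le[OF j a(1)])
      also have "\<dots> \<le> 2 * (\<Sum>i\<in>J. H)"
      proof (intro mult_left_mono sum_mono)
        fix i assume "i \<in> J"
        then have "real (\<kappa> i) * H \<le> x $ i + R" "x $ i + R \<le> real (\<kappa> i) * H + H"
          "real (\<kappa> i) * H \<le> y $ i + R" "y $ i + R \<le> real (\<kappa> i) * H + H"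
          using xy by (auto simp: c_def algebra_simps)
        then show "\<bar>x $ i - y $ i\<bar> \<le> H" by linarith
      qed simp
      also have "\<dots> = Q / real m" by (simp add: cardJ Q_def H_def)
      finally show "norm (x - y) \<le> Q / real m" .
    qed
    have total: "(\<Sum>\<kappa>\<in>I. unit_ball_vol (real s) * (diameter (c \<kappa>) / 2) powr real s)
        \<le> unit_ball_vol (real s) * (Q / 2) powr real s"
    proof -
      have "(\<Sum>\<kappa>\<in>I. unit_ball_vol (real s) * (diameter (c \<kappa>) / 2) powr real s)
          \<le> (\<Sum>\<kappa>\<in>I. unit_ball_vol (real s) * (Q / real m / 2) powr real s)"
        using diam diameter_ge_0[OF bdd]
        by (intro sum_mono mult_left_mono powr_mono2 divide_right_mono) (auto simp: unit_ball_vol_nonneg)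
      also have "\<dots> = unit_ball_vol (real s) * (Q / 2) powr real s"
        using Q m s by (simp add: I powr_realpow field_simps power_divide)
      finally show ?thesis .
    qed
    show "\<exists>I c. finite (I :: ('d \<Rightarrow> nat) set) \<and> F \<subseteq> (\<Union>i\<in>I. c i) \<and>
       (\<forall>i\<in>I. bounded (c i) \<and> diameter (c i) \<le> \<delta>) \<and>
       (\<Sum>i\<in>I. unit_ball_vol (real s) * (diameter (c i) / 2) powr real s)
         \<le> unit_ball_vol (real s) * (Q / 2) powr real s"
      using I(1) cover bdd order_trans[OF diam m(2)] total by (intro exI[of _ I] exI[of _ c]) simp
  qed (use s in simp)
  then show ?thesis unfolding s(2) by (simp add: le_less_trans)
qed

abbreviation hausdorff_borel :: "(real^'d) measure" where
  "hausdorff_borel \<equiv> measure_of UNIV (sets borel) (hausdorff_outer (real CARD('d) - 1))"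

lemma sets_hausdorff_borel: "sets hausdorff_borel = sets borel"
  using sets.sigma_sets_eq[of borel] by (simp add: sets_measure_of_conv)

lemma closed_interface: "closed (interface \<Omega>\<^sub>p \<Omega>\<^sub>m)"
  by (auto simp: interface_def)

text \<open>The faces of the polyhedral boundary of \<open>\<Omega>\<^sub>p\<close> contain the interface.\<close>

theorem emeasure_interface_finite:
  fixes \<Omega>\<^sub>p \<Omega>\<^sub>m :: "(real^'d) set"
  assumes "polyhedral_boundary \<Omega>\<^sub>p" and d: "CARD('d) \<ge> 2"
  shows "emeasure hausdorff_borel (interface \<Omega>\<^sub>p \<Omega>\<^sub>m) < \<infinity>"
proof -
  obtain \<F> where \<F>: "finite \<F>" "\<And>F. F \<in> \<F> \<Longrightarrow> polytope F"
      "\<And>F. F \<in> \<F> \<Longrightarrow> aff_dim F = int CARD('d) - 1" "frontier \<Omega>\<^sub>p = \<Union>\<F>"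
    using assms(1) unfolding polyhedral_boundary_def by blast
  have F_sets: "F \<in> sets hausdorff_borel" if "F \<in> \<F>" for F
    using polytope_imp_closed[OF \<F>(2)[OF that]] by (simp add: sets_hausdorff_borel)
  have "emeasure hausdorff_borel F < \<infinity>" if F: "F \<in> \<F>" for F
  proof -
    have "aff_dim F < int DIM(real^'d)" using \<F>(3)[OF F] by simp
    then obtain a b where ab: "a \<noteq> 0" "F \<subseteq> {x. a \<bullet> x = b}"
      by (rule aff_lowdim_subset_hyperplane)
    \<comment> \<open>an inequality rather than an equation, because \<^const>\<open>measure_of\<close> gives the zero measure
      for a function that is not a measure on the Borel sets\<close>
    have "emeasure hausdorff_borel F \<le> hausdorff_outer (real CARD('d) - 1) F"
      by (simp add: emeasure_measure_of_conv)
    also have "\<dots> < \<infinity>"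
      using ab polytope_imp_bounded[OF \<F>(2)[OF F]] d by (rule hausdorff_outer_hyperplane_finite)
    finally show ?thesis .
  qed
  then have "(\<Sum>F\<in>\<F>. emeasure hausdorff_borel F) < \<infinity>"
    using \<F>(1) by (simp add: less_top)
  moreover have "emeasure hausdorff_borel (interface \<Omega>\<^sub>p \<Omega>\<^sub>m) \<le> emeasure hausdorff_borel (\<Union>F\<in>\<F>. F)"
    using \<F>(1,4) F_sets by (intro emeasure_mono sets.finite_UN) (auto simp: interface_def)
  moreover have "\<dots> \<le> (\<Sum>F\<in>\<F>. emeasure hausdorff_borel F)"
    using \<F>(1) F_sets by (intro emeasure_subadditive_finite) auto
  ultimately show ?thesis by (meson le_less_trans)
qed

lemma finite_surface_measure:
  fixes \<Omega>\<^sub>p \<Omega>\<^sub>m :: "(real^'d) set"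
  assumes "polyhedral_boundary \<Omega>\<^sub>p" and d: "CARD('d) \<ge> 2"
  shows "finite_measure (surface_measure (interface \<Omega>\<^sub>p \<Omega>\<^sub>m))"
proof
  have "interface \<Omega>\<^sub>p \<Omega>\<^sub>m \<in> sets hausdorff_borel"
    using closed_interface[of \<Omega>\<^sub>p \<Omega>\<^sub>m] by (simp add: sets_hausdorff_borel)
  then show "emeasure (surface_measure (interface \<Omega>\<^sub>p \<Omega>\<^sub>m))
      (space (surface_measure (interface \<Omega>\<^sub>p \<Omega>\<^sub>m))) \<noteq> \<infinity>"
    using emeasure_interface_finite[OF assms, of \<Omega>\<^sub>m]
    by (simp add: surface_measure_def space_restrict_space emeasure_restrict_space less_top
        sets.sets_into_space Int_absorb2 space_measure_of_conv)
qed

section \<open>Square integrable functions\<close>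

lemma L2_inner_integrable:
  fixes v w :: "'a \<Rightarrow> 'b::euclidean_space"
  assumes "v \<in> L2 M" "w \<in> L2 M"
  shows "integrable M (\<lambda>x. v x \<bullet> w x)"
proof (rule Bochner_Integration.integrable_bound)
  show "integrable M (\<lambda>x. (norm (v x))\<^sup>2 + (norm (w x))\<^sup>2)"
    using assms by (auto simp: L2_def)
  show "(\<lambda>x. v x \<bullet> w x) \<in> borel_measurable M"
    using assms by (auto simp: L2_def)
  show "AE x in M. norm (v x \<bullet> w x) \<le> norm ((norm (v x))\<^sup>2 + (norm (w x))\<^sup>2)"
  proof (rule AE_I2)
    fix x
    have "\<bar>v x \<bullet> w x\<bar> \<le> norm (v x) * norm (w x)" by (rule Cauchy_Schwarz_ineq2)
    also have "\<dots> \<le> (norm (v x))\<^sup>2 + (norm (w x))\<^sup>2"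
      using sum_squares_bound[of "norm (v x)" "norm (w x)"]
        mult_nonneg_nonneg[OF norm_ge_zero[of "v x"] norm_ge_zero[of "w x"]] by linarith
    finally show "norm (v x \<bullet> w x) \<le> norm ((norm (v x))\<^sup>2 + (norm (w x))\<^sup>2)" by simp
  qed
qed

lemma L2_mult_integrable:
  fixes v w :: "'a \<Rightarrow> real"
  shows "v \<in> L2 M \<Longrightarrow> w \<in> L2 M \<Longrightarrow> integrable M (\<lambda>x. v x * w x)"
  using L2_inner_integrable[of v M w] by simp

text \<open>Expanding \<open>|v + w|\<^sup>2\<close> leaves a mixed term, which is integrable by the previous lemmas.\<close>

lemma L2_add:
  assumes "v \<in> L2 M" "w \<in> L2 M"
  shows "v + w \<in> L2 M"
proof -
  have "(norm (v x + w x))\<^sup>2 = (norm (v x))\<^sup>2 + 2 * (v x \<bullet> w x) + (norm (w x))\<^sup>2" for x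
    by (simp add: power2_norm_eq_inner inner_add_left inner_add_right inner_commute)
  then show ?thesis
    using assms L2_inner_integrable[OF assms] by (auto simp: L2_def plus_fun_def)
qed

lemma L2_scale: "v \<in> L2 M \<Longrightarrow> r *\<^sub>R v \<in> L2 M"
  by (auto simp: L2_def scaleR_fun_def power_mult_distrib)

lemma subspace_L2: "subspace (L2 M)"
  by (rule subspaceI) (auto simp: L2_add L2_scale, simp add: L2_def zero_fun_def)

lemma subspace_pow: "subspace X \<Longrightarrow> subspace (pow X :: ('n::finite \<Rightarrow> 'a::real_vector) set)"
  by (auto simp: subspace_def pow_def)

lemma L2_bound:
  fixes w :: "'a \<Rightarrow> 'b::euclidean_space" and v :: "'a \<Rightarrow> 'c::euclidean_space"
  assumes "v \<in> L2 M" "w \<in> borel_measurable M" "AE x in M. norm (w x) \<le> C * norm (v x)"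
  shows "w \<in> L2 M"
proof -
  have "integrable M (\<lambda>x. (norm (w x))\<^sup>2)"
  proof (rule Bochner_Integration.integrable_bound)
    show "integrable M (\<lambda>x. C\<^sup>2 * (norm (v x))\<^sup>2)"
      using assms(1) by (auto simp: L2_def)
    show "AE x in M. norm ((norm (w x))\<^sup>2) \<le> norm (C\<^sup>2 * (norm (v x))\<^sup>2)"
      using assms(3)
    proof eventually_elim
      case (elim x)
      then have "(norm (w x))\<^sup>2 \<le> (C * norm (v x))\<^sup>2" by (intro power_mono) auto
      then show ?case by (simp add: power_mult_distrib)
    qed
  qed (use assms(2) in simp)
  then show ?thesis using assms(2) by (simp add: L2_def)
qed

lemma L2_const: "finite_measure M \<Longrightarrow> (\<lambda>x. c) \<in> L2 M"
  by (simp add: L2_def finite_measure.integrable_const)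

lemma L2_bounded:
  fixes w :: "'a \<Rightarrow> 'b::euclidean_space"
  assumes "finite_measure M" "w \<in> borel_measurable M" "bounded (w ` space M)"
  shows "w \<in> L2 M"
proof -
  obtain C where "\<And>x. x \<in> space M \<Longrightarrow> norm (w x) \<le> C"
    using assms(3) by (auto simp: bounded_iff)
  then have "AE x in M. norm (w x) \<le> C * norm (1 :: real)" by (intro AE_I2) auto
  with L2_const[OF assms(1), of "1::real"] assms(2) show ?thesis by (rule L2_bound)
qed

lemma L2_integrable:
  fixes v :: "'a \<Rightarrow> real"
  assumes "finite_measure M" "v \<in> L2 M"
  shows "integrable M v"
  using L2_mult_integrable[OF assms(2) L2_const[OF assms(1), of 1]] by simp

definition L2_inner :: "'a measure \<Rightarrow> ('n::finite \<Rightarrow> 'a \<Rightarrow> 'b::euclidean_space) \<Rightarrow> ('n \<Rightarrow> 'a \<Rightarrow> 'b) \<Rightarrow> real" where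
  "L2_inner M v w = (\<Sum>i\<in>UNIV. LINT x|M. v i x \<bullet> w i x)"

lemma semi_inner_product_L2:
  "semi_inner_product (pow (L2 M) :: ('n::finite \<Rightarrow> 'a \<Rightarrow> 'b::euclidean_space) set) (L2_inner M)"
proof
  show "subspace (pow (L2 M) :: ('n \<Rightarrow> 'a \<Rightarrow> 'b) set)" by (intro subspace_pow subspace_L2)
  fix x y z :: "'n \<Rightarrow> 'a \<Rightarrow> 'b" and r :: real
  assume x: "x \<in> pow (L2 M)"
  show "L2_inner M x y = L2_inner M y x" by (simp add: L2_inner_def inner_commute)
  show "L2_inner M (x + y) z = L2_inner M x z + L2_inner M y z"
    if "y \<in> pow (L2 M)" "z \<in> pow (L2 M)"
    using x that
    by (auto simp: L2_inner_def inner_add_left pow_def L2_inner_integrable simp flip: sum.distrib)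
  show "L2_inner M (r *\<^sub>R x) z = r * L2_inner M x z"
    by (simp add: L2_inner_def sum_distrib_left)
  show "0 \<le> L2_inner M x x"
    by (simp add: L2_inner_def sum_nonneg)
qed

lemma L2_inner_null_iff:
  assumes "v \<in> pow (L2 M)"
  shows "L2_inner M v v = 0 \<longleftrightarrow> (\<forall>i. AE x in M. v i x = 0)"
proof -
  have v: "v i \<in> L2 M" for i using assms by (simp add: pow_def)
  have "L2_inner M v v = 0 \<longleftrightarrow> (\<forall>i. (LINT x|M. v i x \<bullet> v i x) = 0)"
    by (simp add: L2_inner_def sum_nonneg_eq_0_iff)
  also have "\<dots> \<longleftrightarrow> (\<forall>i. AE x in M. v i x = 0)"
    using L2_inner_integrable[OF v v] by (simp add: integral_nonneg_eq_0_iff_AE)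
  finally show ?thesis .
qed

lemma form_c_eq: "form_c \<Omega> = L2_inner (lebesgue_on \<Omega>)"
  by (simp add: form_c_def L2_inner_def fun_eq_iff)

lemma AE_lebesgue_on_subset:
  assumes "AE x in lebesgue_on \<Omega>. P x" "S \<subseteq> \<Omega>" "S \<in> sets lebesgue" "\<Omega> \<in> sets lebesgue"
  shows "AE x in lebesgue_on S. P x"
proof -
  have "AE x in lebesgue. x \<in> \<Omega> \<longrightarrow> P x"
    using assms(1,4) by (simp add: AE_restrict_space_iff)
  then have "AE x in lebesgue. x \<in> S \<longrightarrow> P x"
    using assms(2) by (auto elim: eventually_mono)
  then show ?thesis using assms(3) by (simp add: AE_restrict_space_iff)
qed

lemma L2_lebesgue_on_subset:
  assumes "v \<in> L2 (lebesgue_on \<Omega>)" "S \<subseteq> \<Omega>" "S \<in> sets lebesgue" "\<Omega> \<in> sets lebesgue"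
  shows "v \<in> L2 (lebesgue_on S)"
proof -
  have "set_integrable lebesgue \<Omega> (\<lambda>x. (norm (v x))\<^sup>2)"
    using assms(1,4) by (simp add: L2_def integrable_restrict_space set_integrable_def)
  then have "set_integrable lebesgue S (\<lambda>x. (norm (v x))\<^sup>2)"
    using assms(3,2) by (rule set_integrable_subset)
  then have "integrable (lebesgue_on S) (\<lambda>x. (norm (v x))\<^sup>2)"
    using assms(3) by (simp add: integrable_restrict_space set_integrable_def)
  moreover have "v \<in> borel_measurable (lebesgue_on S)"
    by (rule measurable_restrict_mono[OF _ assms(2)]) (use assms(1) in \<open>simp add: L2_def\<close>)
  ultimately show ?thesis by (simp add: L2_def)
qed

lemma finite_measure_lebesgue_on_bounded:
  "bounded \<Omega> \<Longrightarrow> \<Omega> \<in> sets lebesgue \<Longrightarrow> finite_measure (lebesgue_on \<Omega>)"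
  by (intro finite_measure_lebesgue_on bounded_set_imp_lmeasurable)

lemma continuous_image_bounded:
  fixes f :: "'a::heine_borel \<Rightarrow> 'b::metric_space"
  assumes "bounded S" "continuous_on UNIV f"
  shows "bounded (f ` S)"
proof -
  have "compact (f ` closure S)"
    using assms by (intro compact_continuous_image) (auto intro: continuous_on_subset)
  then show ?thesis
    using closure_subset by (meson bounded_subset compact_imp_bounded image_mono)
qed

lemma continuous_L2_lebesgue_on:
  fixes f :: "'a::euclidean_space \<Rightarrow> 'b::euclidean_space"
  assumes "bounded \<Omega>" "\<Omega> \<in> sets lebesgue" "continuous_on UNIV f"
  shows "f \<in> L2 (lebesgue_on \<Omega>)"
proof (rule L2_bounded)
  show "f \<in> borel_measurable (lebesgue_on \<Omega>)"
    using assms by (intro continuous_imp_measurable_on_sets_lebesgue) (auto intro: continuous_on_subset)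
qed (use assms in \<open>auto simp: finite_measure_lebesgue_on_bounded continuous_image_bounded\<close>)

section \<open>Linearity of the weak divergence and of the normal trace\<close>

lemma gradient_continuous:
  assumes "\<phi> \<in> test_functions \<Omega>"
  shows "continuous_on UNIV (gradient \<phi>)"
proof -
  have "Ck (Suc 0) \<phi>" using assms by (simp add: test_functions_def)
  then have "continuous_on UNIV (\<lambda>x. frechet_derivative \<phi> (at x) (axis j 1))" for j
    by (simp add: axis_in_Basis_iff)
  then show ?thesis
    by (auto simp: gradient_def[abs_def] intro: continuous_on_vec_lambda)
qed

text \<open>Openness gives enough test functions, boundedness makes continuous functions square integrable,
  and the polyhedral boundary makes the surface measure of the interface finite; in dimension at least
  two the Hausdorff measure on the interface has positive order.\<close>

locale interface_problem =
  fixes \<Omega> \<Omega>\<^sub>p \<Omega>\<^sub>m :: "(real^'d) set"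
  assumes open_\<Omega>: "open \<Omega>" and bounded_\<Omega>: "bounded \<Omega>"
    and open_\<Omega>p: "open \<Omega>\<^sub>p" and \<Omega>p_subset: "\<Omega>\<^sub>p \<subseteq> \<Omega>" and polyhedral: "polyhedral_boundary \<Omega>\<^sub>p"
    and dim_ge_2: "CARD('d) \<ge> 2"
begin

abbreviation "\<Gamma> \<equiv> interface \<Omega>\<^sub>p \<Omega>\<^sub>m"
abbreviation "dvg \<equiv> divergence \<Omega>"
abbreviation "ntrace \<equiv> normal_trace \<Omega> \<Omega>\<^sub>p \<Omega>\<^sub>m"

lemma \<Omega>_sets [measurable, simp]: "\<Omega> \<in> sets lebesgue" "\<Omega>\<^sub>p \<in> sets lebesgue"
  using open_\<Omega> open_\<Omega>p by auto

lemma finite_\<Omega>: "finite_measure (lebesgue_on \<Omega>)"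
  using bounded_\<Omega> by (simp add: finite_measure_lebesgue_on_bounded)

lemma continuous_L2: "continuous_on UNIV f \<Longrightarrow> f \<in> L2 (lebesgue_on \<Omega>)"
  for f :: "real^'d \<Rightarrow> 'b::euclidean_space"
  using bounded_\<Omega> by (simp add: continuous_L2_lebesgue_on)

lemma test_function_L2:
  assumes "\<phi> \<in> test_functions \<Omega>"
  shows "\<phi> \<in> L2 (lebesgue_on \<Omega>)" "gradient \<phi> \<in> L2 (lebesgue_on \<Omega>)"
  using test_function_continuous[OF assms] gradient_continuous[OF assms] by (auto intro: continuous_L2)

lemma AE_\<Omega>p: "AE x in lebesgue_on \<Omega>. P x \<Longrightarrow> AE x in lebesgue_on \<Omega>\<^sub>p. P x"
  by (rule AE_lebesgue_on_subset[OF _ \<Omega>p_subset]) auto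

lemma L2_\<Omega>p: "v \<in> L2 (lebesgue_on \<Omega>) \<Longrightarrow> v \<in> L2 (lebesgue_on \<Omega>\<^sub>p)"
  by (rule L2_lebesgue_on_subset[OF _ \<Omega>p_subset]) auto

text \<open>The uniqueness lemma needs a Borel measure, so the Lebesgue measurable function is replaced by
  a Borel function that agrees with it almost everywhere.\<close>

lemma AE_eq_0_in_\<Omega>:
  assumes z: "z \<in> L2 (lebesgue_on \<Omega>)"
    and orth: "\<And>\<phi>. \<phi> \<in> test_functions \<Omega> \<Longrightarrow> (LINT x|lebesgue_on \<Omega>. z x * \<phi> x) = 0"
  shows "AE x in lebesgue_on \<Omega>. z x = 0"
proof -
  define z0 where "z0 = (\<lambda>x. indicator \<Omega> x * z x)"
  have int: "integrable lebesgue z0"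
    using L2_integrable[OF finite_\<Omega> z] by (simp add: integrable_restrict_space z0_def)
  then obtain z1 where z1: "z1 \<in> borel_measurable lborel" "AE x in lborel. z0 x = z1 x"
    using completion_ex_borel_measurable_real[of z0 lborel] by auto
  define f where "f = (\<lambda>x. indicator \<Omega> x * z1 x)"
  have f_meas [measurable]: "f \<in> borel_measurable borel"
    using z1(1) open_\<Omega> by (auto simp: f_def)
  have f_ae: "AE x in lborel. f x = z0 x"
    using z1(2) by eventually_elim (auto simp: f_def z0_def indicator_def)
  have f_ae': "AE x in lebesgue. f x = z0 x"
    using f_ae by (rule AE_completion)
  have "AE x in lborel. f x = 0"
  proof (rule AE_eq_0_of_test_functions)
    have "integrable lebesgue f \<longleftrightarrow> integrable lebesgue z0"
      using f_ae' int by (intro integrable_cong_AE) (auto intro: measurable_completion)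
    then show "integrable lborel f"
      using int by (simp add: integrable_completion)
    fix \<phi> assume \<phi>: "\<phi> \<in> test_functions \<Omega>"
    then have [measurable]: "\<phi> \<in> borel_measurable borel" by (rule test_function_measurable)
    have "(LINT x|lborel. f x * \<phi> x) = (LINT x|lebesgue. f x * \<phi> x)"
      by (simp add: integral_completion)
    also have "\<dots> = (LINT x|lebesgue. indicator \<Omega> x * (z x * \<phi> x))"
    proof (rule integral_cong_AE)
      show "AE x in lebesgue. f x * \<phi> x = indicator \<Omega> x * (z x * \<phi> x)"
        using f_ae' by eventually_elim (simp add: z0_def)
      have "(\<lambda>x. z0 x * \<phi> x) \<in> borel_measurable lebesgue"
        using int by (intro borel_measurable_times) (auto intro: measurable_completion)
      then show "(\<lambda>x. indicator \<Omega> x * (z x * \<phi> x)) \<in> borel_measurable lebesgue"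
        by (simp add: z0_def mult.assoc)
      show "(\<lambda>x. f x * \<phi> x) \<in> borel_measurable lebesgue"
        by (rule measurable_completion) simp
    qed
    also have "\<dots> = 0" using orth[OF \<phi>] by (simp add: integral_restrict_space)
    finally show "(LINT x|lborel. f x * \<phi> x) = 0" .
  qed (auto simp: open_\<Omega> f_def)
  then have "AE x in lebesgue. f x = 0" by (rule AE_completion)
  with f_ae' have "AE x in lebesgue. x \<in> \<Omega> \<longrightarrow> z x = 0"
    by eventually_elim (auto simp: z0_def)
  then show ?thesis by (simp add: AE_restrict_space_iff)
qed

lemma weak_div_unique:
  assumes "is_weak_div \<Omega> \<tau> w" "is_weak_div \<Omega> \<tau> w'"
  shows "AE x in lebesgue_on \<Omega>. w x = w' x"
proof -
  have L2: "w \<in> L2 (lebesgue_on \<Omega>)" "w' \<in> L2 (lebesgue_on \<Omega>)"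
    using assms by (auto simp: is_weak_div_def)
  have "AE x in lebesgue_on \<Omega>. (w - w') x = 0"
  proof (rule AE_eq_0_in_\<Omega>)
    show "w - w' \<in> L2 (lebesgue_on \<Omega>)" using L2 by (rule subspace_diff[OF subspace_L2])
    fix \<phi> assume \<phi>: "\<phi> \<in> test_functions \<Omega>"
    then show "(LINT x|lebesgue_on \<Omega>. (w - w') x * \<phi> x) = 0"
      using assms L2_mult_integrable[OF _ test_function_L2(1)[OF \<phi>]] L2
      by (simp add: is_weak_div_def left_diff_distrib)
  qed
  then show ?thesis by simp
qed

lemma weak_div_add:
  assumes "\<tau> \<in> L2 (lebesgue_on \<Omega>)" "\<eta> \<in> L2 (lebesgue_on \<Omega>)" "is_weak_div \<Omega> \<tau> w" "is_weak_div \<Omega> \<eta> z"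
  shows "is_weak_div \<Omega> (\<tau> + \<eta>) (w + z)"
  using assms test_function_L2
  by (auto simp: is_weak_div_def L2_add inner_add_left distrib_right L2_mult_integrable L2_inner_integrable)

lemma weak_div_scale: "is_weak_div \<Omega> \<tau> w \<Longrightarrow> is_weak_div \<Omega> (r *\<^sub>R \<tau>) (r *\<^sub>R w)"
  by (auto simp: is_weak_div_def L2_scale mult.assoc)

lemma weak_div_0:
  assumes "AE x in lebesgue_on \<Omega>. \<tau> x = 0"
  shows "is_weak_div \<Omega> \<tau> 0"
proof -
  have "(LINT x|lebesgue_on \<Omega>. \<tau> x \<bullet> gradient \<phi> x) = 0" for \<phi>
    using assms by (intro integral_eq_zero_AE) (auto elim: eventually_mono)
  then show ?thesis using subspace_0[OF subspace_L2] by (simp add: is_weak_div_def)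
qed

lemma Hdiv_weak_div: "\<tau> \<in> Hdiv \<Omega> \<Longrightarrow> is_weak_div \<Omega> \<tau> (dvg \<tau>)"
  using someI_ex[of "is_weak_div \<Omega> \<tau>"] by (simp add: divergence_def Hdiv_def)

lemma Hdiv_L2: "\<tau> \<in> Hdiv \<Omega> \<Longrightarrow> \<tau> \<in> L2 (lebesgue_on \<Omega>)" "\<tau> \<in> Hdiv \<Omega> \<Longrightarrow> dvg \<tau> \<in> L2 (lebesgue_on \<Omega>)"
  using Hdiv_weak_div[of \<tau>] by (auto simp: Hdiv_def is_weak_div_def)

lemma subspace_Hdiv: "subspace (Hdiv \<Omega>)"
proof (rule subspaceI)
  show "0 \<in> Hdiv \<Omega>"
    using weak_div_0[of 0] subspace_0[OF subspace_L2] by (auto simp: Hdiv_def)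
qed (auto simp: Hdiv_def L2_add L2_scale dest: weak_div_add weak_div_scale)

lemma div_add:
  "\<tau> \<in> Hdiv \<Omega> \<Longrightarrow> \<eta> \<in> Hdiv \<Omega> \<Longrightarrow> AE x in lebesgue_on \<Omega>. dvg (\<tau> + \<eta>) x = dvg \<tau> x + dvg \<eta> x"
  using weak_div_unique[OF Hdiv_weak_div[of "\<tau> + \<eta>"] weak_div_add[of \<tau> \<eta> "dvg \<tau>" "dvg \<eta>"]]
    subspace_add[OF subspace_Hdiv] Hdiv_weak_div Hdiv_L2 by auto

lemma div_scale:
  "\<tau> \<in> Hdiv \<Omega> \<Longrightarrow> AE x in lebesgue_on \<Omega>. dvg (r *\<^sub>R \<tau>) x = r * dvg \<tau> x"
  using weak_div_unique[OF Hdiv_weak_div[of "r *\<^sub>R \<tau>"] weak_div_scale[of \<tau> "dvg \<tau>"]]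
    subspace_scale[OF subspace_Hdiv] Hdiv_weak_div by auto

lemma div_null:
  "\<tau> \<in> Hdiv \<Omega> \<Longrightarrow> AE x in lebesgue_on \<Omega>. \<tau> x = 0 \<Longrightarrow> AE x in lebesgue_on \<Omega>. dvg \<tau> x = 0"
  using weak_div_unique[OF Hdiv_weak_div weak_div_0, of \<tau>] by auto

abbreviation "S \<equiv> Sigma_space \<Omega> \<Omega>\<^sub>p \<Omega>\<^sub>m"
abbreviation "\<mu>\<Gamma> \<equiv> surface_measure \<Gamma>"

lemma finite_\<mu>\<Gamma>: "finite_measure \<mu>\<Gamma>"
  using polyhedral dim_ge_2 by (rule finite_surface_measure)

lemma \<Gamma>_sets: "\<Gamma> \<inter> space hausdorff_borel \<in> sets hausdorff_borel"
  using closed_interface[of \<Omega>\<^sub>p \<Omega>\<^sub>m] by (simp add: sets_hausdorff_borel space_measure_of_conv)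

lemma borel_measurable_surface: "f \<in> borel_measurable borel \<Longrightarrow> f \<in> borel_measurable \<mu>\<Gamma>"
  unfolding surface_measure_def
  by (intro measurable_restrict_space1) (simp add: measurable_cong_sets[OF sets_hausdorff_borel refl])

lemma test_function_L2_surface:
  assumes "\<phi> \<in> test_functions \<Omega>"
  shows "\<phi> \<in> L2 \<mu>\<Gamma>"
proof (rule L2_bounded[OF finite_\<mu>\<Gamma>])
  show "\<phi> \<in> borel_measurable \<mu>\<Gamma>"
    using test_function_measurable[OF assms] by (rule borel_measurable_surface)
  have "space \<mu>\<Gamma> \<subseteq> closure \<Omega>"
    using \<Omega>p_subset closure_mono[of \<Omega>\<^sub>p \<Omega>]
    by (auto simp: surface_measure_def space_restrict_space interface_def frontier_def)
  then show "bounded (\<phi> ` space \<mu>\<Gamma>)"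
    using bounded_subset[OF bounded_closure[OF bounded_\<Omega>]] test_function_continuous[OF assms]
    by (intro continuous_image_bounded)
qed

text \<open>The difference of two representatives is extended by \<open>0\<close> from \<open>\<Gamma>\<close> to the whole space.  The test
  functions see it only inside \<open>\<Omega>\<close>, but a normal trace vanishes on the rest of \<open>\<Gamma>\<close>.\<close>

lemma trace_unique:
  assumes "is_normal_trace \<Omega> \<Omega>\<^sub>p \<Omega>\<^sub>m \<tau> g" "is_normal_trace \<Omega> \<Omega>\<^sub>p \<Omega>\<^sub>m \<tau> g'"
  shows "AE x in \<mu>\<Gamma>. g x = g' x"
proof -
  have L2: "g \<in> L2 \<mu>\<Gamma>" "g' \<in> L2 \<mu>\<Gamma>"
    using assms by (auto simp: is_normal_trace_def)
  define z where "z = g - g'"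
  have z: "z \<in> L2 \<mu>\<Gamma>" unfolding z_def using L2 by (rule subspace_diff[OF subspace_L2])
  have orth: "(LINT x|\<mu>\<Gamma>. z x * \<phi> x) = 0" if \<phi>: "\<phi> \<in> test_functions \<Omega>" for \<phi>
    using assms \<phi> L2_mult_integrable[OF _ test_function_L2_surface[OF \<phi>]] L2
    by (simp add: is_normal_trace_def z_def left_diff_distrib)
  have "AE x in hausdorff_borel. indicator \<Gamma> x * z x = 0"
  proof (rule AE_eq_0_of_test_functions)
    show "sets hausdorff_borel = sets (borel :: (real^'d) measure)" by (rule sets_hausdorff_borel)
    show "integrable hausdorff_borel (\<lambda>x. indicator \<Gamma> x * z x)"
      using L2_integrable[OF finite_\<mu>\<Gamma> z] \<Gamma>_sets
      by (simp add: surface_measure_def integrable_restrict_space)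
    show "indicator \<Gamma> x * z x = 0" if "x \<notin> \<Omega>" for x
      using assms that by (auto simp: is_normal_trace_def z_def indicator_def)
    show "(LINT x|hausdorff_borel. indicator \<Gamma> x * z x * \<phi> x) = 0" if "\<phi> \<in> test_functions \<Omega>" for \<phi>
      using orth[OF that] \<Gamma>_sets
      by (simp add: surface_measure_def integral_restrict_space mult.assoc)
  qed (rule open_\<Omega>)
  then have "AE x in \<mu>\<Gamma>. z x = 0"
    unfolding surface_measure_def AE_restrict_space_iff[OF \<Gamma>_sets]
    by eventually_elim (simp add: indicator_def split: if_splits)
  then show ?thesis by (simp add: z_def)
qed

text \<open>Additivity of Green's formula needs integrability on both sides; this is where test functions have to
  be square integrable with their gradients.\<close>

lemma Green_integrable:
  assumes "\<tau> \<in> Hdiv \<Omega>" "\<phi> \<in> test_functions \<Omega>"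
  shows "integrable (lebesgue_on \<Omega>\<^sub>p) (\<lambda>x. \<tau> x \<bullet> gradient \<phi> x + dvg \<tau> x * \<phi> x)"
  using assms Hdiv_L2 test_function_L2
  by (intro Bochner_Integration.integrable_add L2_inner_integrable L2_mult_integrable L2_\<Omega>p)

lemma Green_measurable:
  assumes "\<tau> \<in> Hdiv \<Omega>" "\<phi> \<in> test_functions \<Omega>"
  shows "(\<lambda>x. \<tau> x \<bullet> gradient \<phi> x + dvg \<tau> x * \<phi> x) \<in> borel_measurable (lebesgue_on \<Omega>\<^sub>p)"
  using Green_integrable[OF assms] by (rule borel_measurable_integrable)

lemma trace_add:
  assumes "\<tau> \<in> Hdiv \<Omega>" "\<eta> \<in> Hdiv \<Omega>"
    "is_normal_trace \<Omega> \<Omega>\<^sub>p \<Omega>\<^sub>m \<tau> g" "is_normal_trace \<Omega> \<Omega>\<^sub>p \<Omega>\<^sub>m \<eta> h"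
  shows "is_normal_trace \<Omega> \<Omega>\<^sub>p \<Omega>\<^sub>m (\<tau> + \<eta>) (g + h)"
proof -
  have "(LINT x|\<mu>\<Gamma>. (g + h) x * \<phi> x) =
      (LINT x|lebesgue_on \<Omega>\<^sub>p. (\<tau> + \<eta>) x \<bullet> gradient \<phi> x + dvg (\<tau> + \<eta>) x * \<phi> x)"
    if \<phi>: "\<phi> \<in> test_functions \<Omega>" for \<phi>
  proof -
    have "(LINT x|\<mu>\<Gamma>. (g + h) x * \<phi> x) = (LINT x|\<mu>\<Gamma>. g x * \<phi> x) + (LINT x|\<mu>\<Gamma>. h x * \<phi> x)"
      using assms(3,4) L2_mult_integrable[OF _ test_function_L2_surface[OF \<phi>]]
      by (simp add: is_normal_trace_def distrib_right)
    also have "\<dots> = (LINT x|lebesgue_on \<Omega>\<^sub>p. (\<tau> x \<bullet> gradient \<phi> x + dvg \<tau> x * \<phi> x) +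
        (\<eta> x \<bullet> gradient \<phi> x + dvg \<eta> x * \<phi> x))"
      using assms \<phi> Green_integrable by (simp add: is_normal_trace_def)
    also have "\<dots> = (LINT x|lebesgue_on \<Omega>\<^sub>p. (\<tau> + \<eta>) x \<bullet> gradient \<phi> x + dvg (\<tau> + \<eta>) x * \<phi> x)"
    proof (rule integral_cong_AE)
      show "AE x in lebesgue_on \<Omega>\<^sub>p. (\<tau> x \<bullet> gradient \<phi> x + dvg \<tau> x * \<phi> x) +
          (\<eta> x \<bullet> gradient \<phi> x + dvg \<eta> x * \<phi> x) =
          (\<tau> + \<eta>) x \<bullet> gradient \<phi> x + dvg (\<tau> + \<eta>) x * \<phi> x"
        using AE_\<Omega>p[OF div_add[OF assms(1,2)]]
        by eventually_elim (simp add: inner_add_left algebra_simps)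
      show "(\<lambda>x. (\<tau> x \<bullet> gradient \<phi> x + dvg \<tau> x * \<phi> x) +
          (\<eta> x \<bullet> gradient \<phi> x + dvg \<eta> x * \<phi> x)) \<in> borel_measurable (lebesgue_on \<Omega>\<^sub>p)"
        by (rule borel_measurable_add[OF Green_measurable Green_measurable]) (use assms \<phi> in auto)
      show "(\<lambda>x. (\<tau> + \<eta>) x \<bullet> gradient \<phi> x + dvg (\<tau> + \<eta>) x * \<phi> x)
          \<in> borel_measurable (lebesgue_on \<Omega>\<^sub>p)"
        by (intro Green_measurable subspace_add[OF subspace_Hdiv] assms \<phi>)
    qed
    finally show ?thesis .
  qed
  then show ?thesis
    using assms by (auto simp: is_normal_trace_def L2_add)
qed

lemma trace_scale:
  assumes "\<tau> \<in> Hdiv \<Omega>" "is_normal_trace \<Omega> \<Omega>\<^sub>p \<Omega>\<^sub>m \<tau> g"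
  shows "is_normal_trace \<Omega> \<Omega>\<^sub>p \<Omega>\<^sub>m (r *\<^sub>R \<tau>) (r *\<^sub>R g)"
proof -
  have "(LINT x|\<mu>\<Gamma>. (r *\<^sub>R g) x * \<phi> x) =
      (LINT x|lebesgue_on \<Omega>\<^sub>p. (r *\<^sub>R \<tau>) x \<bullet> gradient \<phi> x + dvg (r *\<^sub>R \<tau>) x * \<phi> x)"
    if \<phi>: "\<phi> \<in> test_functions \<Omega>" for \<phi>
  proof -
    have "(LINT x|\<mu>\<Gamma>. (r *\<^sub>R g) x * \<phi> x) = r * (LINT x|\<mu>\<Gamma>. g x * \<phi> x)"
      by (simp add: mult.assoc)
    also have "\<dots> = (LINT x|lebesgue_on \<Omega>\<^sub>p. r * (\<tau> x \<bullet> gradient \<phi> x + dvg \<tau> x * \<phi> x))"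
      using assms \<phi> by (simp add: is_normal_trace_def)
    also have "\<dots> = (LINT x|lebesgue_on \<Omega>\<^sub>p. (r *\<^sub>R \<tau>) x \<bullet> gradient \<phi> x + dvg (r *\<^sub>R \<tau>) x * \<phi> x)"
    proof (rule integral_cong_AE)
      show "AE x in lebesgue_on \<Omega>\<^sub>p. r * (\<tau> x \<bullet> gradient \<phi> x + dvg \<tau> x * \<phi> x) =
          (r *\<^sub>R \<tau>) x \<bullet> gradient \<phi> x + dvg (r *\<^sub>R \<tau>) x * \<phi> x"
        using AE_\<Omega>p[OF div_scale[OF assms(1), of r]]
        by eventually_elim (simp add: algebra_simps)
      show "(\<lambda>x. r * (\<tau> x \<bullet> gradient \<phi> x + dvg \<tau> x * \<phi> x)) \<in> borel_measurable (lebesgue_on \<Omega>\<^sub>p)"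
        by (intro borel_measurable_times borel_measurable_const Green_measurable assms \<phi>)
      show "(\<lambda>x. (r *\<^sub>R \<tau>) x \<bullet> gradient \<phi> x + dvg (r *\<^sub>R \<tau>) x * \<phi> x)
          \<in> borel_measurable (lebesgue_on \<Omega>\<^sub>p)"
        by (intro Green_measurable subspace_scale[OF subspace_Hdiv] assms \<phi>)
    qed
    finally show ?thesis .
  qed
  then show ?thesis
    using assms by (auto simp: is_normal_trace_def L2_scale)
qed

lemma trace_0:
  assumes "\<tau> \<in> Hdiv \<Omega>" "AE x in lebesgue_on \<Omega>. \<tau> x = 0"
  shows "is_normal_trace \<Omega> \<Omega>\<^sub>p \<Omega>\<^sub>m \<tau> 0"
proof -
  have "(LINT x|lebesgue_on \<Omega>\<^sub>p. \<tau> x \<bullet> gradient \<phi> x + dvg \<tau> x * \<phi> x) = 0" for \<phi>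
  proof (rule integral_eq_zero_AE)
    show "AE x in lebesgue_on \<Omega>\<^sub>p. \<tau> x \<bullet> gradient \<phi> x + dvg \<tau> x * \<phi> x = 0"
      using AE_\<Omega>p[OF assms(2)] AE_\<Omega>p[OF div_null[OF assms]] by eventually_elim simp
  qed
  then show ?thesis using subspace_0[OF subspace_L2] by (simp add: is_normal_trace_def)
qed

lemma S_trace: "\<tau> \<in> S \<Longrightarrow> is_normal_trace \<Omega> \<Omega>\<^sub>p \<Omega>\<^sub>m \<tau> (ntrace \<tau>)"
  using someI_ex[of "is_normal_trace \<Omega> \<Omega>\<^sub>p \<Omega>\<^sub>m \<tau>"]
  by (simp add: normal_trace_def Sigma_space_def)

lemma S_Hdiv: "\<tau> \<in> S \<Longrightarrow> \<tau> \<in> Hdiv \<Omega>"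
  by (simp add: Sigma_space_def)

lemma trace_L2: "\<tau> \<in> S \<Longrightarrow> ntrace \<tau> \<in> L2 \<mu>\<Gamma>"
  using S_trace by (auto simp: is_normal_trace_def)

lemma subspace_S: "subspace S"
proof (rule subspaceI)
  show "0 \<in> S" using trace_0[of 0] subspace_0[OF subspace_Hdiv] by (auto simp: Sigma_space_def)
qed (auto simp: Sigma_space_def subspace_add[OF subspace_Hdiv] subspace_scale[OF subspace_Hdiv]
      dest: trace_add trace_scale)

lemma normal_trace_add:
  "\<tau> \<in> S \<Longrightarrow> \<eta> \<in> S \<Longrightarrow> AE x in \<mu>\<Gamma>. ntrace (\<tau> + \<eta>) x = ntrace \<tau> x + ntrace \<eta> x"
  using trace_unique[OF S_trace[of "\<tau> + \<eta>"] trace_add[of \<tau> \<eta> "ntrace \<tau>" "ntrace \<eta>"]]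
    subspace_add[OF subspace_S] S_trace S_Hdiv by auto

lemma normal_trace_scale:
  "\<tau> \<in> S \<Longrightarrow> AE x in \<mu>\<Gamma>. ntrace (r *\<^sub>R \<tau>) x = r * ntrace \<tau> x"
  using trace_unique[OF S_trace[of "r *\<^sub>R \<tau>"] trace_scale[of \<tau> "ntrace \<tau>"]]
    subspace_scale[OF subspace_S] S_trace S_Hdiv by auto

lemma normal_trace_null:
  "\<tau> \<in> S \<Longrightarrow> AE x in lebesgue_on \<Omega>. \<tau> x = 0 \<Longrightarrow> AE x in \<mu>\<Gamma>. ntrace \<tau> x = 0"
  using trace_unique[OF S_trace trace_0, of \<tau>] S_Hdiv by auto

end

section \<open>The discrete spaces are finite-dimensional\<close>

lemma span_linear_image: "linear h \<Longrightarrow> x \<in> span B \<Longrightarrow> h x \<in> span (h ` B)"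
  by (simp add: linear_span_image)

lemma subspace_polys: "subspace (polys m :: (real^'d \<Rightarrow> real) set)"
proof (rule subspaceI)
  show "0 \<in> polys m"
    unfolding polys_def by (auto intro!: exI[of _ "\<lambda>_. 0"] simp: fun_eq_iff)
  fix p q :: "real^'d \<Rightarrow> real" and r
  assume "p \<in> polys m"
  then obtain c where c: "p = (\<lambda>x. \<Sum>\<alpha> | sum \<alpha> UNIV \<le> m. c \<alpha> * (\<Prod>i\<in>UNIV. (x $ i) ^ \<alpha> i))"
    by (auto simp: polys_def)
  show "r *\<^sub>R p \<in> polys m"
    unfolding polys_def
    by (intro CollectI exI[of _ "\<lambda>\<alpha>. r * c \<alpha>"]) (simp add: c fun_eq_iff sum_distrib_left mult.assoc)
  assume "q \<in> polys m"
  then obtain d where d: "q = (\<lambda>x. \<Sum>\<alpha> | sum \<alpha> UNIV \<le> m. d \<alpha> * (\<Prod>i\<in>UNIV. (x $ i) ^ \<alpha> i))"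
    by (auto simp: polys_def)
  show "p + q \<in> polys m"
    unfolding polys_def
    by (intro CollectI exI[of _ "\<lambda>\<alpha>. c \<alpha> + d \<alpha>"]) (simp add: c d fun_eq_iff sum.distrib distrib_right)
qed

lemma subspace_vec_polys: "subspace (vec_polys m :: (real^'d \<Rightarrow> real^'d) set)"
proof (rule subspaceI)
  fix p q :: "real^'d \<Rightarrow> real^'d" and r :: real
  show "0 \<in> vec_polys m"
    using subspace_0[OF subspace_polys, of m] by (simp add: vec_polys_def zero_fun_def)
  assume p: "p \<in> vec_polys m"
  then show "r *\<^sub>R p \<in> vec_polys m"
    using subspace_scale[OF subspace_polys, of _ m r] by (auto simp: vec_polys_def scaleR_fun_def)
  assume "q \<in> vec_polys m"
  with p show "p + q \<in> vec_polys m"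
    using subspace_add[OF subspace_polys, of _ m] by (auto simp: vec_polys_def plus_fun_def)
qed

lemma subspace_RT: "subspace (RT l :: (real^'d \<Rightarrow> real^'d) set)"
proof (rule subspaceI)
  fix s t :: "real^'d \<Rightarrow> real^'d" and r :: real
  show "0 \<in> RT l"
    unfolding RT_def using subspace_0[OF subspace_vec_polys, of "l - 1"] subspace_0[OF subspace_polys, of "l - 1"]
    by (intro CollectI exI[of _ 0]) (auto simp: fun_eq_iff)
  assume "s \<in> RT l"
  then obtain q p where s: "s = (\<lambda>x. q x + p x *\<^sub>R x)" "q \<in> vec_polys (l - 1)" "p \<in> polys (l - 1)"
    by (auto simp: RT_def)
  then show "r *\<^sub>R s \<in> RT l"
    unfolding RT_def
    using subspace_scale[OF subspace_vec_polys] subspace_scale[OF subspace_polys]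
    by (intro CollectI exI[of _ "r *\<^sub>R q"] exI[of _ "r *\<^sub>R p"]) (auto simp: fun_eq_iff algebra_simps)
  assume "t \<in> RT l"
  then obtain q' p' where t: "t = (\<lambda>x. q' x + p' x *\<^sub>R x)" "q' \<in> vec_polys (l - 1)" "p' \<in> polys (l - 1)"
    by (auto simp: RT_def)
  then show "s + t \<in> RT l"
    unfolding RT_def using s
      subspace_add[OF subspace_vec_polys] subspace_add[OF subspace_polys]
    by (intro CollectI exI[of _ "q + q'"] exI[of _ "p + p'"]) (auto simp: fun_eq_iff algebra_simps)
qed

definition monomials :: "nat \<Rightarrow> (real^'d \<Rightarrow> real) set" where
  "monomials m = (\<lambda>\<alpha> x. \<Prod>i\<in>UNIV. (x $ i) ^ \<alpha> i) ` {\<alpha>. sum \<alpha> UNIV \<le> m}"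

lemma finite_monomials: "finite (monomials m :: (real^'d \<Rightarrow> real) set)"
proof -
  have "{\<alpha> :: 'd \<Rightarrow> nat. sum \<alpha> UNIV \<le> m} \<subseteq> (UNIV \<rightarrow>\<^sub>E {..m})"
  proof
    fix \<alpha> :: "'d \<Rightarrow> nat" assume "\<alpha> \<in> {\<alpha>. sum \<alpha> UNIV \<le> m}"
    then have "\<alpha> i \<le> m" for i using member_le_sum[of i UNIV \<alpha>] by simp
    then show "\<alpha> \<in> UNIV \<rightarrow>\<^sub>E {..m}" by auto
  qed
  then have "finite {\<alpha> :: 'd \<Rightarrow> nat. sum \<alpha> UNIV \<le> m}"
    by (rule finite_subset) (simp add: finite_PiE)
  then show ?thesis by (simp add: monomials_def)
qed

lemma polys_span: "polys m \<subseteq> span (monomials m :: (real^'d \<Rightarrow> real) set)"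
proof
  fix p :: "real^'d \<Rightarrow> real" assume "p \<in> polys m"
  then obtain c where "p = (\<lambda>x. \<Sum>\<alpha> | sum \<alpha> UNIV \<le> m. c \<alpha> * (\<Prod>i\<in>UNIV. (x $ i) ^ \<alpha> i))"
    by (auto simp: polys_def)
  then have "p = (\<Sum>\<alpha> | sum \<alpha> UNIV \<le> m. c \<alpha> *\<^sub>R (\<lambda>x. \<Prod>i\<in>UNIV. (x $ i) ^ \<alpha> i))"
    by (simp add: fun_eq_iff sum_fun_apply)
  moreover have "(\<lambda>x. \<Prod>i\<in>UNIV. (x $ i) ^ \<alpha> i) \<in> monomials m" if "sum \<alpha> UNIV \<le> m" for \<alpha> :: "'d \<Rightarrow> nat"
    unfolding monomials_def using that by (intro image_eqI[of _ _ \<alpha>]) auto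
  ultimately show "p \<in> span (monomials m)"
    by (simp only:) (intro span_sum span_scale; rule span_base; simp)
qed

lemma monomials_continuous: "q \<in> monomials m \<Longrightarrow> continuous_on UNIV q"
  by (auto simp: monomials_def intro!: continuous_intros)

text \<open>The generators are \<open>x\<^sup>\<alpha> e\<^sub>j\<close> and \<open>x\<^sup>\<alpha> x\<close> with \<open>|\<alpha>| \<le> l - 1\<close>.\<close>

lemma RT_span:
  "\<exists>B :: (real^'d \<Rightarrow> real^'d) set. finite B \<and> (\<forall>q\<in>B. continuous_on UNIV q) \<and> RT l \<subseteq> span B"
proof -
  define M :: "(real^'d \<Rightarrow> real) set" where "M = monomials (l - 1)"
  define h where "h = (\<lambda>j (p :: real^'d \<Rightarrow> real) x. p x *\<^sub>R (axis j 1 :: real^'d))"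
  define k where "k = (\<lambda>(p :: real^'d \<Rightarrow> real) x. p x *\<^sub>R x)"
  define B where "B = (\<Union>j. h j ` M) \<union> k ` M"
  have lin: "linear (h j)" "linear k" for j
    by (rule linearI; simp add: h_def k_def fun_eq_iff algebra_simps)+
  have "RT l \<subseteq> span B"
  proof
    fix t :: "real^'d \<Rightarrow> real^'d" assume "t \<in> RT l"
    then obtain q p where t: "t = (\<lambda>x. q x + p x *\<^sub>R x)" "q \<in> vec_polys (l - 1)" "p \<in> polys (l - 1)"
      by (auto simp: RT_def)
    have "h j (\<lambda>x. q x $ j) \<in> span B" for j
    proof -
      have "(\<lambda>x. q x $ j) \<in> span M" using t(2) polys_span by (auto simp: vec_polys_def M_def)
      then have "h j (\<lambda>x. q x $ j) \<in> span (h j ` M)" by (rule span_linear_image[OF lin(1)])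
      then show ?thesis by (rule subsetD[OF span_mono, rotated]) (auto simp: B_def)
    qed
    moreover have "k p \<in> span B"
    proof -
      have "k p \<in> span (k ` M)" using t(3) polys_span by (intro span_linear_image lin) (auto simp: M_def)
      then show ?thesis by (rule subsetD[OF span_mono, rotated]) (auto simp: B_def)
    qed
    ultimately have "(\<Sum>j\<in>UNIV. h j (\<lambda>x. q x $ j)) + k p \<in> span B"
      by (intro span_add span_sum)
    also have "(\<Sum>j\<in>UNIV. h j (\<lambda>x. q x $ j)) + k p = t"
      by (simp add: t fun_eq_iff sum_fun_apply h_def k_def vec_eq_iff axis_def if_distrib cong: if_cong)
    finally show "t \<in> span B" .
  qed
  moreover have "finite B" by (simp add: B_def M_def finite_monomials)
  moreover have "\<forall>q\<in>B. continuous_on UNIV q"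
    by (auto simp: B_def h_def k_def M_def dest!: monomials_continuous intro!: continuous_intros)
  ultimately show ?thesis by blast
qed

lemma AE_lebesgue_on_Int:
  assumes "AE x in lebesgue_on (T \<inter> \<Omega>). P x" "T \<in> sets lebesgue" "\<Omega> \<in> sets lebesgue"
  shows "AE x in lebesgue_on \<Omega>. x \<in> T \<longrightarrow> P x"
  using assms by (simp add: AE_restrict_space_iff) (auto elim: eventually_mono)

lemma L2_indicator:
  assumes "v \<in> L2 M" "A \<inter> space M \<in> sets M"
  shows "(\<lambda>x. indicator A x *\<^sub>R v x) \<in> L2 M"
proof (rule L2_bound[where C = 1])
  show "v \<in> L2 M" by fact
  have "(\<lambda>x. indicator A x :: real) \<in> borel_measurable M"
    using assms(2) by (simp add: borel_measurable_indicator_iff Int_commute)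
  then show "(\<lambda>x. indicator A x *\<^sub>R v x) \<in> borel_measurable M"
    using assms(1) by (auto simp: L2_def intro!: borel_measurable_scaleR)
qed (auto simp: indicator_def)

text \<open>Cells of a mesh overlap, so the generators are cut off to disjoint pieces of cells: adding a
  cell \<open>T\<close> restricts the generators found so far to the complement of \<open>T\<close>.\<close>

lemma piecewise_span:
  fixes \<Omega> :: "'a::euclidean_space set" and B :: "('a \<Rightarrow> 'b::euclidean_space) set"
  assumes \<Omega>: "\<Omega> \<in> sets lebesgue" and B: "finite B" "B \<subseteq> L2 (lebesgue_on \<Omega>)"
    and \<T>: "finite \<T>" "\<And>T. T \<in> \<T> \<Longrightarrow> closed T"
  shows "\<exists>G\<subseteq>L2 (lebesgue_on \<Omega>). finite G \<and>
     (\<forall>v. (\<forall>T\<in>\<T>. \<exists>q\<in>span B. AE x in lebesgue_on (T \<inter> \<Omega>). v x = q x) \<longrightarrow>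
          (\<exists>g\<in>span G. AE x in lebesgue_on \<Omega>. x \<in> \<Union>\<T> \<longrightarrow> v x = g x))"
  using \<T>
proof (induction \<T> rule: finite_induct)
  case empty
  show ?case by (intro exI[of _ "{}"]) auto
next
  case (insert T \<T>)
  then obtain G where G: "G \<subseteq> L2 (lebesgue_on \<Omega>)" "finite G"
    and G_span: "\<And>v. \<forall>T\<in>\<T>. \<exists>q\<in>span B. AE x in lebesgue_on (T \<inter> \<Omega>). v x = q x \<Longrightarrow>
       \<exists>g\<in>span G. AE x in lebesgue_on \<Omega>. x \<in> \<Union>\<T> \<longrightarrow> v x = g x"
    by auto
  define h where "h = (\<lambda>A (v :: 'a \<Rightarrow> 'b) x. indicator A x *\<^sub>R v x)"
  have lin: "linear (h A)" for A
    by (rule linearI) (simp_all add: h_def fun_eq_iff algebra_simps)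
  define G' where "G' = h (- T) ` G \<union> h T ` B"
  have T: "T \<in> sets lebesgue" using insert.prems[of T] by simp
  then have T': "T \<inter> \<Omega> \<in> sets (lebesgue_on \<Omega>)" "- T \<inter> \<Omega> \<in> sets (lebesgue_on \<Omega>)"
    using \<Omega> by (auto simp: sets_restrict_space_iff)
  have "G' \<subseteq> L2 (lebesgue_on \<Omega>)"
    using G(1) B(2) T' by (auto simp: G'_def h_def intro!: L2_indicator)
  moreover have "finite G'" using G(2) B(1) by (simp add: G'_def)
  moreover have "\<exists>g\<in>span G'. AE x in lebesgue_on \<Omega>. x \<in> \<Union>(insert T \<T>) \<longrightarrow> v x = g x"
    if v: "\<forall>T\<in>insert T \<T>. \<exists>q\<in>span B. AE x in lebesgue_on (T \<inter> \<Omega>). v x = q x" for v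
  proof -
    obtain q where q: "q \<in> span B" "AE x in lebesgue_on (T \<inter> \<Omega>). v x = q x" using v by blast
    obtain g where g: "g \<in> span G" "AE x in lebesgue_on \<Omega>. x \<in> \<Union>\<T> \<longrightarrow> v x = g x"
      using G_span[of v] v by blast
    have "h (- T) g \<in> span G'" "h T q \<in> span G'"
      using span_linear_image[OF lin g(1), of "- T"] span_linear_image[OF lin q(1), of T]
        span_mono[of "h (- T) ` G" G'] span_mono[of "h T ` B" G'] by (auto simp: G'_def)
    then have "h (- T) g + h T q \<in> span G'" by (rule span_add)
    moreover have "AE x in lebesgue_on \<Omega>. x \<in> \<Union>(insert T \<T>) \<longrightarrow> v x = (h (- T) g + h T q) x"
      using g(2) AE_lebesgue_on_Int[OF q(2) T \<Omega>]
      by eventually_elim (auto simp: h_def indicator_def)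
    ultimately show ?thesis by blast
  qed
  ultimately show ?case by blast
qed

text \<open>The generators need not belong to \<open>X\<close>: in general, a cut-off monomial has no square integrable
  weak divergence.  They bound the size of \<open>L\<^sup>2\<close>-orthonormal sets in \<open>X\<close>, and a largest such set spans
  \<open>X\<close> up to null sets.\<close>

lemma pow_finite_dimensional:
  fixes X G :: "('a \<Rightarrow> 'b::euclidean_space) set"
  assumes X: "subspace X" "X \<subseteq> L2 M" and G: "finite G" "G \<subseteq> L2 M"
    and span: "\<And>v. v \<in> X \<Longrightarrow> \<exists>g\<in>span G. AE x in M. v x = g x"
  shows "\<exists>E. finite E \<and> E \<subseteq> (pow X :: ('n::finite \<Rightarrow> _) set) \<and>
     (\<forall>v\<in>pow X. \<exists>g\<in>span E. \<forall>i. AE x in M. v i x = g i x)"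
proof -
  interpret L: semi_inner_product "pow (L2 M) :: ('n \<Rightarrow> 'a \<Rightarrow> 'b) set" "L2_inner M"
    by (rule semi_inner_product_L2)
  define s where "s = (\<lambda>i (g :: 'a \<Rightarrow> 'b) (j :: 'n). if j = i then g else 0)"
  have lin: "linear (s i)" for i
    by (rule linearI) (simp_all add: s_def fun_eq_iff)
  define G' where "G' = (\<Union>i. s i ` G)"
  have G': "finite G'" "G' \<subseteq> pow (L2 M)"
    using G subspace_0[OF subspace_L2, of M] by (auto simp: G'_def s_def pow_def zero_fun_def)
  have "\<exists>g\<in>span G'. L2_inner M (v - g) (v - g) = 0" if v: "v \<in> pow X" for v
  proof -
    have "\<forall>i. \<exists>g\<in>span G. AE x in M. v i x = g x" using v span by (auto simp: pow_def)
    then obtain g where g: "\<And>i. g i \<in> span G" "\<And>i. AE x in M. v i x = g i x" by metis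
    have "(\<Sum>i\<in>UNIV. s i (g i)) = g"
      by (simp add: fun_eq_iff sum_fun_apply s_def if_distrib[of "\<lambda>h. h _"] cong: if_cong)
    moreover have "s i (g i) \<in> span G'" for i
      using span_linear_image[OF lin g(1), of i] span_mono[of "s i ` G" G'] by (auto simp: G'_def)
    then have "(\<Sum>i\<in>UNIV. s i (g i)) \<in> span G'" by (rule span_sum)
    ultimately have gG: "g \<in> span G'" by simp
    have "v \<in> pow (L2 M)" using v X(2) by (auto simp: pow_def)
    moreover have "g \<in> pow (L2 M)" using gG G'(2) span_minimal[OF _ L.subspace_W] by blast
    ultimately have "v - g \<in> pow (L2 M)" by (rule L.W_closed)
    moreover have "AE x in M. (v - g) i x = 0" for i
      using g(2)[of i] by eventually_elim simp
    ultimately have "L2_inner M (v - g) (v - g) = 0" using L2_inner_null_iff by blast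
    then show ?thesis using gG by blast
  qed
  moreover have "pow X \<subseteq> (pow (L2 M) :: ('n \<Rightarrow> 'a \<Rightarrow> 'b) set)" using X(2) by (auto simp: pow_def)
  ultimately obtain E where E: "E \<subseteq> pow X" "L.orthonormal E"
    and complete: "\<And>v. v \<in> pow X \<Longrightarrow> L2_inner M (v - (\<Sum>e\<in>E. L2_inner M v e *\<^sub>R e)) (v - (\<Sum>e\<in>E. L2_inner M v e *\<^sub>R e)) = 0"
    using L.ex_orthonormal_basis[OF subspace_pow[OF X(1)] _ G'] by blast
  have "\<exists>g\<in>span E. \<forall>i. AE x in M. v i x = g i x" if v: "v \<in> pow X" for v
  proof
    define g where "g = (\<Sum>e\<in>E. L2_inner M v e *\<^sub>R e)"
    show "g \<in> span E" unfolding g_def by (intro span_sum span_scale span_base)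
    have "v - g \<in> pow X"
      unfolding g_def using v E subspace_pow[OF X(1)]
      by (intro subspace_diff subspace_sum subspace_scale) auto
    then have "v - g \<in> pow (L2 M)" using X(2) by (auto simp: pow_def)
    then show "\<forall>i. AE x in M. v i x = g i x"
      using complete[OF v] by (simp add: L2_inner_null_iff flip: g_def)
  qed
  then show ?thesis using E by (auto simp: L.orthonormal_def)
qed

context interface_problem
begin

lemma subspace_Sigma_h: "subspace (Sigma_h \<Omega> \<Omega>\<^sub>p \<Omega>\<^sub>m \<T> l)"
proof (rule subspaceI)
  fix \<tau> \<eta> r
  show "0 \<in> Sigma_h \<Omega> \<Omega>\<^sub>p \<Omega>\<^sub>m \<T> l"
    using subspace_0[OF subspace_S] subspace_0[OF subspace_RT, of l]
    by (auto simp: Sigma_h_def intro!: bexI[of _ 0])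
  assume \<tau>: "\<tau> \<in> Sigma_h \<Omega> \<Omega>\<^sub>p \<Omega>\<^sub>m \<T> l"
  show "r *\<^sub>R \<tau> \<in> Sigma_h \<Omega> \<Omega>\<^sub>p \<Omega>\<^sub>m \<T> l"
    unfolding Sigma_h_def
  proof (intro CollectI conjI ballI)
    fix T assume "T \<in> \<T>"
    then obtain q where q: "q \<in> RT l" "AE x in lebesgue_on (T \<inter> \<Omega>). \<tau> x = q x"
      using \<tau> by (auto simp: Sigma_h_def)
    then show "\<exists>q\<in>RT l. AE x in lebesgue_on (T \<inter> \<Omega>). (r *\<^sub>R \<tau>) x = q x"
      using subspace_scale[OF subspace_RT q(1)] by (intro bexI[of _ "r *\<^sub>R q"]) auto
  qed (use \<tau> subspace_scale[OF subspace_S] in \<open>auto simp: Sigma_h_def\<close>)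
  assume \<eta>: "\<eta> \<in> Sigma_h \<Omega> \<Omega>\<^sub>p \<Omega>\<^sub>m \<T> l"
  show "\<tau> + \<eta> \<in> Sigma_h \<Omega> \<Omega>\<^sub>p \<Omega>\<^sub>m \<T> l"
    unfolding Sigma_h_def
  proof (intro CollectI conjI ballI)
    fix T assume "T \<in> \<T>"
    then obtain q q' where q: "q \<in> RT l" "AE x in lebesgue_on (T \<inter> \<Omega>). \<tau> x = q x"
        "q' \<in> RT l" "AE x in lebesgue_on (T \<inter> \<Omega>). \<eta> x = q' x"
      using \<tau> \<eta> unfolding Sigma_h_def by blast
    have "AE x in lebesgue_on (T \<inter> \<Omega>). (\<tau> + \<eta>) x = (q + q') x"
      using q(2,4) by eventually_elim simp
    then show "\<exists>q\<in>RT l. AE x in lebesgue_on (T \<inter> \<Omega>). (\<tau> + \<eta>) x = q x"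
      using subspace_add[OF subspace_RT q(1,3)] by blast
  qed (use \<tau> \<eta> subspace_add[OF subspace_S] in \<open>auto simp: Sigma_h_def\<close>)
qed

lemma subspace_V_h: "subspace (V_h \<Omega> \<T> l)"
proof (rule subspaceI)
  fix v w r
  show "0 \<in> V_h \<Omega> \<T> l"
    using subspace_0[OF subspace_L2, of "lebesgue_on \<Omega>"] subspace_0[OF subspace_polys, of "l - 1"]
    by (auto simp: V_h_def intro!: bexI[of _ 0])
  assume v: "v \<in> V_h \<Omega> \<T> l"
  show "r *\<^sub>R v \<in> V_h \<Omega> \<T> l"
    unfolding V_h_def
  proof (intro CollectI conjI ballI)
    fix T assume "T \<in> \<T>"
    then obtain q where q: "q \<in> polys (l - 1)" "AE x in lebesgue_on (T \<inter> \<Omega>). v x = q x"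
      using v by (auto simp: V_h_def)
    have "AE x in lebesgue_on (T \<inter> \<Omega>). (r *\<^sub>R v) x = (r *\<^sub>R q) x"
      using q(2) by eventually_elim simp
    then show "\<exists>q\<in>polys (l - 1). AE x in lebesgue_on (T \<inter> \<Omega>). (r *\<^sub>R v) x = q x"
      using subspace_scale[OF subspace_polys q(1)] by blast
  qed (use v L2_scale in \<open>auto simp: V_h_def\<close>)
  assume w: "w \<in> V_h \<Omega> \<T> l"
  show "v + w \<in> V_h \<Omega> \<T> l"
    unfolding V_h_def
  proof (intro CollectI conjI ballI)
    fix T assume "T \<in> \<T>"
    then obtain q q' where q: "q \<in> polys (l - 1)" "AE x in lebesgue_on (T \<inter> \<Omega>). v x = q x"
        "q' \<in> polys (l - 1)" "AE x in lebesgue_on (T \<inter> \<Omega>). w x = q' x"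
      using v w unfolding V_h_def by blast
    have "AE x in lebesgue_on (T \<inter> \<Omega>). (v + w) x = (q + q') x"
      using q(2,4) by eventually_elim simp
    then show "\<exists>q\<in>polys (l - 1). AE x in lebesgue_on (T \<inter> \<Omega>). (v + w) x = q x"
      using subspace_add[OF subspace_polys q(1,3)] by blast
  qed (use v w L2_add in \<open>auto simp: V_h_def\<close>)
qed

lemma piecewise_finite_dimensional:
  fixes X B :: "(real^'d \<Rightarrow> 'b::euclidean_space) set"
  assumes mesh: "mesh_of \<Omega> \<T>" and X: "subspace X" "X \<subseteq> L2 (lebesgue_on \<Omega>)"
    and B: "finite B" "\<And>q. q \<in> B \<Longrightarrow> continuous_on UNIV q"
    and piecewise: "\<And>v T. v \<in> X \<Longrightarrow> T \<in> \<T> \<Longrightarrow> \<exists>q\<in>span B. AE x in lebesgue_on (T \<inter> \<Omega>). v x = q x"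
  shows "\<exists>E. finite E \<and> E \<subseteq> (pow X :: ('n::finite \<Rightarrow> _) set) \<and>
     (\<forall>v\<in>pow X. \<exists>g\<in>span E. \<forall>i. AE x in lebesgue_on \<Omega>. v i x = g i x)"
proof -
  have \<T>: "finite \<T>" "\<And>T. T \<in> \<T> \<Longrightarrow> closed T" "\<Omega> \<subseteq> \<Union>\<T>"
    using mesh closure_subset[of \<Omega>]
    by (auto simp: mesh_of_def triangulation_def) (metis compact_imp_closed compact_simplex)
  have BL: "B \<subseteq> L2 (lebesgue_on \<Omega>)" using B(2) by (auto intro: continuous_L2)
  obtain G where G: "G \<subseteq> L2 (lebesgue_on \<Omega>)" "finite G"
    and G_span: "\<And>v. \<forall>T\<in>\<T>. \<exists>q\<in>span B. AE x in lebesgue_on (T \<inter> \<Omega>). v x = q x \<Longrightarrow>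
       \<exists>g\<in>span G. AE x in lebesgue_on \<Omega>. x \<in> \<Union>\<T> \<longrightarrow> v x = g x"
    using piecewise_span[OF \<Omega>_sets(1) B(1) BL \<T>(1,2)] by blast
  have "\<exists>g\<in>span G. AE x in lebesgue_on \<Omega>. v x = g x" if v: "v \<in> X" for v
  proof -
    obtain g where "g \<in> span G" "AE x in lebesgue_on \<Omega>. x \<in> \<Union>\<T> \<longrightarrow> v x = g x"
      using G_span[of v] piecewise[OF v] by blast
    moreover from this(2) have "AE x in lebesgue_on \<Omega>. v x = g x"
      by (rule lebesgue_on_mono) (use \<T>(3) in auto)
    ultimately show ?thesis by blast
  qed
  then show ?thesis by (rule pow_finite_dimensional[OF X G(2,1)])
qed

lemma V_h_L2: "V_h \<Omega> \<T> l \<subseteq> L2 (lebesgue_on \<Omega>)"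
  by (auto simp: V_h_def)

lemma Sigma_h_S: "Sigma_h \<Omega> \<Omega>\<^sub>p \<Omega>\<^sub>m \<T> l \<subseteq> S"
  by (auto simp: Sigma_h_def)

theorem V_h_finite_dimensional:
  assumes "mesh_of \<Omega> \<T>"
  shows "\<exists>E. finite E \<and> E \<subseteq> (pow (V_h \<Omega> \<T> l) :: ('n::finite \<Rightarrow> _) set) \<and>
     (\<forall>v\<in>pow (V_h \<Omega> \<T> l). \<exists>g\<in>span E. \<forall>i. AE x in lebesgue_on \<Omega>. v i x = g i x)"
proof (rule piecewise_finite_dimensional[OF assms subspace_V_h V_h_L2 finite_monomials monomials_continuous])
  fix v T assume "v \<in> V_h \<Omega> \<T> l" "T \<in> \<T>"
  then show "\<exists>q\<in>span (monomials (l - 1)). AE x in lebesgue_on (T \<inter> \<Omega>). v x = q x"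
    using polys_span[of "l - 1"] unfolding V_h_def by blast
qed

theorem Sigma_h_finite_dimensional:
  assumes "mesh_of \<Omega> \<T>"
  shows "\<exists>E. finite E \<and> E \<subseteq> (pow (Sigma_h \<Omega> \<Omega>\<^sub>p \<Omega>\<^sub>m \<T> l) :: ('n::finite \<Rightarrow> _) set) \<and>
     (\<forall>v\<in>pow (Sigma_h \<Omega> \<Omega>\<^sub>p \<Omega>\<^sub>m \<T> l). \<exists>g\<in>span E. \<forall>i. AE x in lebesgue_on \<Omega>. v i x = g i x)"
proof -
  obtain B :: "(real^'d \<Rightarrow> real^'d) set" where B: "finite B" "\<And>q. q \<in> B \<Longrightarrow> continuous_on UNIV q" "RT l \<subseteq> span B"
    using RT_span[of l] by (elim exE conjE) auto
  have sub: "Sigma_h \<Omega> \<Omega>\<^sub>p \<Omega>\<^sub>m \<T> l \<subseteq> L2 (lebesgue_on \<Omega>)"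
    using Hdiv_L2(1)[OF S_Hdiv[OF subsetD[OF Sigma_h_S]]] by (rule subsetI)
  show ?thesis
  proof (rule piecewise_finite_dimensional[OF assms subspace_Sigma_h sub B(1,2)])
    fix \<tau> T assume "\<tau> \<in> Sigma_h \<Omega> \<Omega>\<^sub>p \<Omega>\<^sub>m \<T> l" "T \<in> \<T>"
    then show "\<exists>q\<in>span B. AE x in lebesgue_on (T \<inter> \<Omega>). \<tau> x = q x"
      using B(3) unfolding Sigma_h_def by blast
  qed
qed

end

section \<open>The forms\<close>

lemma semi_inner_product_subspace:
  assumes "semi_inner_product W p" "subspace U" "U \<subseteq> W"
  shows "semi_inner_product U p"
proof -
  interpret semi_inner_product W p by fact
  show ?thesis
    using assms(2,3) sym add_left scale_left nonneg by unfold_locales (auto simp: subset_eq)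
qed

lemma pow_mono: "X \<subseteq> Y \<Longrightarrow> pow X \<subseteq> pow Y"
  by (auto simp: pow_def)

text \<open>The hypothesis applied to constant functions, which are square integrable on a bounded set, holds
  at some point because \<open>\<Omega>\<close> has positive measure.\<close>

lemma Lipschitz_nonlinearity:
  fixes f :: "real^'n \<Rightarrow> real" and \<Omega> :: "(real^'d) set"
  assumes \<Omega>: "open \<Omega>" "bounded \<Omega>" "\<Omega> \<noteq> {}"
    and lip: "\<forall>v\<in>pow (L2 (lebesgue_on \<Omega>)). \<forall>w\<in>pow (L2 (lebesgue_on \<Omega>)). AE x in lebesgue_on \<Omega>.
           \<bar>f (\<chi> j. v j x) - f (\<chi> j. w j x)\<bar> \<le> C * sqrt (\<Sum>j\<in>UNIV. \<bar>v j x - w j x\<bar>\<^sup>2)"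
  shows "\<bar>f y - f z\<bar> \<le> C * norm (y - z)"
proof (rule ccontr)
  assume not_le: "\<not> \<bar>f y - f z\<bar> \<le> C * norm (y - z)"
  have const: "(\<lambda>j x. y $ j) \<in> pow (L2 (lebesgue_on \<Omega>))" for y :: "real^'n"
    using \<Omega> by (simp add: pow_def L2_const finite_measure_lebesgue_on_bounded)
  have "norm (y - z) = sqrt (\<Sum>j\<in>UNIV. \<bar>y $ j - z $ j\<bar>\<^sup>2)"
    by (simp add: norm_vec_def L2_set_def)
  then have "AE x in lebesgue_on \<Omega>. \<bar>f y - f z\<bar> \<le> C * norm (y - z)"
    using lip[rule_format, OF const[of y] const[of z]] by (simp add: vec_lambda_eta)
  then have "AE x in lebesgue. x \<notin> \<Omega>"
    using not_le \<Omega>(1) by (simp add: AE_restrict_space_iff)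
  then have "negligible \<Omega>"
    using \<Omega>(1) by (simp add: negligible_iff_null_sets AE_iff_null_sets)
  then show False using open_not_negligible \<Omega> by blast
qed

text \<open>A Lipschitz function is continuous and grows at most linearly:
  \<open>|f (v)| \<le> |f 0| + |C| (|v\<^sub>1| + \<dots> + |v\<^sub>n|)\<close>.\<close>

lemma L2_Lipschitz_compose:
  fixes f :: "real^'n \<Rightarrow> real"
  assumes M: "finite_measure M" and lip: "\<And>y z. \<bar>f y - f z\<bar> \<le> C * norm (y - z)"
    and v: "v \<in> pow (L2 M)"
  shows "(\<lambda>x. f (\<chi> j. v j x)) \<in> L2 M"
proof -
  have v: "v j \<in> L2 M" for j using v by (simp add: pow_def)
  have "\<bar>C\<bar>-lipschitz_on UNIV f"
  proof (rule lipschitz_onI)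
    show "dist (f y) (f z) \<le> \<bar>C\<bar> * dist y z" for y z
      using lip[of y z] mult_right_mono[OF abs_ge_self[of C] norm_ge_zero[of "y - z"]]
      by (simp add: dist_norm dist_real_def)
  qed simp
  then have "continuous_on UNIV f" by (rule lipschitz_on_continuous_on)
  then have f: "f \<in> borel_measurable borel" by (rule borel_measurable_continuous_onI)
  have "(\<lambda>x. \<chi> j. v j x) = (\<lambda>x. \<Sum>j\<in>UNIV. v j x *\<^sub>R axis j 1)"
    by (simp add: fun_eq_iff vec_eq_iff axis_def if_distrib cong: if_cong)
  then have "(\<lambda>x. \<chi> j. v j x) \<in> borel_measurable M"
    using v by (auto simp: L2_def intro!: borel_measurable_sum borel_measurable_scaleR)
  then have meas: "(\<lambda>x. f (\<chi> j. v j x)) \<in> borel_measurable M"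
    using f by (rule measurable_compose)
  have abs_v: "(\<lambda>x. \<bar>v j x\<bar>) \<in> L2 M" for j
    using v[of j] by (rule L2_bound[where C = 1]) (use v[of j] in \<open>auto simp: L2_def\<close>)
  have "(\<lambda>x. \<bar>f 0\<bar>) + \<bar>C\<bar> *\<^sub>R (\<Sum>j\<in>UNIV. (\<lambda>x. \<bar>v j x\<bar>)) \<in> L2 M"
    by (intro L2_add L2_scale L2_const M subspace_sum[OF subspace_L2] abs_v)
  then show ?thesis
  proof (rule L2_bound[OF _ meas, where C = 1], intro AE_I2)
    fix x
    have "\<bar>f (\<chi> j. v j x)\<bar> \<le> \<bar>f 0\<bar> + \<bar>f (\<chi> j. v j x) - f 0\<bar>" by simp
    also have "\<bar>f (\<chi> j. v j x) - f 0\<bar> \<le> \<bar>C\<bar> * norm (\<chi> j. v j x)"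
      using lip[of "\<chi> j. v j x" 0] mult_right_mono[OF abs_ge_self[of C] norm_ge_zero[of "\<chi> j. v j x"]] by simp
    also have "\<dots> \<le> \<bar>C\<bar> * (\<Sum>j\<in>UNIV. \<bar>v j x\<bar>)"
      using norm_le_l1_cart[of "\<chi> j. v j x"] by (intro mult_left_mono) simp_all
    finally show "norm (f (\<chi> j. v j x)) \<le>
        1 * norm (((\<lambda>x. \<bar>f 0\<bar>) + \<bar>C\<bar> *\<^sub>R (\<Sum>j\<in>UNIV. (\<lambda>x. \<bar>v j x\<bar>))) x)"
      by (simp add: sum_fun_apply)
  qed
qed

context interface_problem
begin

lemma weighted_L2:
  assumes "k \<in> borel_measurable (lebesgue_on \<Omega>)" "0 < lo" "AE x in lebesgue_on \<Omega>. lo \<le> k x"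
    and "\<tau> \<in> L2 (lebesgue_on \<Omega>)"
  shows "(\<lambda>x. inverse (k x) *\<^sub>R \<tau> x) \<in> L2 (lebesgue_on \<Omega>)"
  using assms(4)
proof (rule L2_bound)
  show "(\<lambda>x. inverse (k x) *\<^sub>R \<tau> x) \<in> borel_measurable (lebesgue_on \<Omega>)"
    using assms(1,4) by (auto simp: L2_def)
  show "AE x in lebesgue_on \<Omega>. norm (inverse (k x) *\<^sub>R \<tau> x) \<le> inverse lo * norm (\<tau> x)"
    using assms(3)
  proof eventually_elim
    case (elim x)
    then have "\<bar>inverse (k x)\<bar> \<le> inverse lo" using assms(2) by (simp add: le_imp_inverse_le)
    then show ?case by (simp add: mult_right_mono)
  qed
qed

lemma integrable_trace_product:
  "\<tau> \<in> S \<Longrightarrow> \<eta> \<in> S \<Longrightarrow> integrable \<mu>\<Gamma> (\<lambda>x. (r * ntrace \<tau> x) * ntrace \<eta> x)"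
  using L2_mult_integrable[OF trace_L2 trace_L2] by (simp add: mult.assoc)

lemma trace_product_add:
  assumes S: "\<tau> \<in> S" "\<eta> \<in> S" "\<zeta> \<in> S"
  shows "(LINT x|\<mu>\<Gamma>. (r * ntrace (\<tau> + \<eta>) x) * ntrace \<zeta> x) =
    (LINT x|\<mu>\<Gamma>. (r * ntrace \<tau> x) * ntrace \<zeta> x) + (LINT x|\<mu>\<Gamma>. (r * ntrace \<eta> x) * ntrace \<zeta> x)"
proof -
  note int = integrable_trace_product[OF S(1,3), of r] integrable_trace_product[OF S(2,3), of r]
    integrable_trace_product[OF subspace_add[OF subspace_S S(1,2)] S(3), of r]
  show ?thesis
    unfolding Bochner_Integration.integral_add[OF int(1,2), symmetric]
  proof (rule integral_cong_AE)
    show "AE x in \<mu>\<Gamma>. (r * ntrace (\<tau> + \<eta>) x) * ntrace \<zeta> x =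
        (r * ntrace \<tau> x) * ntrace \<zeta> x + (r * ntrace \<eta> x) * ntrace \<zeta> x"
      using normal_trace_add[OF S(1,2)] by eventually_elim (simp add: algebra_simps)
    show "(\<lambda>x. (r * ntrace (\<tau> + \<eta>) x) * ntrace \<zeta> x) \<in> borel_measurable \<mu>\<Gamma>"
      by (rule borel_measurable_integrable[OF int(3)])
    show "(\<lambda>x. (r * ntrace \<tau> x) * ntrace \<zeta> x + (r * ntrace \<eta> x) * ntrace \<zeta> x) \<in> borel_measurable \<mu>\<Gamma>"
      by (rule borel_measurable_integrable[OF Bochner_Integration.integrable_add[OF int(1,2)]])
  qed
qed

lemma trace_product_scale:
  assumes S: "\<tau> \<in> S" "\<zeta> \<in> S"
  shows "(LINT x|\<mu>\<Gamma>. (r * ntrace (s *\<^sub>R \<tau>) x) * ntrace \<zeta> x) =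
    s * (LINT x|\<mu>\<Gamma>. (r * ntrace \<tau> x) * ntrace \<zeta> x)"
proof -
  note int = integrable_trace_product[OF S, of r]
    integrable_trace_product[OF subspace_scale[OF subspace_S S(1)] S(2), of r s]
  have "(LINT x|\<mu>\<Gamma>. (r * ntrace (s *\<^sub>R \<tau>) x) * ntrace \<zeta> x) =
      (LINT x|\<mu>\<Gamma>. s * ((r * ntrace \<tau> x) * ntrace \<zeta> x))"
  proof (rule integral_cong_AE)
    show "AE x in \<mu>\<Gamma>. (r * ntrace (s *\<^sub>R \<tau>) x) * ntrace \<zeta> x = s * ((r * ntrace \<tau> x) * ntrace \<zeta> x)"
      using normal_trace_scale[OF S(1), of s] by eventually_elim simp
    show "(\<lambda>x. (r * ntrace (s *\<^sub>R \<tau>) x) * ntrace \<zeta> x) \<in> borel_measurable \<mu>\<Gamma>"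
      by (rule borel_measurable_integrable[OF int(2)])
    show "(\<lambda>x. s * ((r * ntrace \<tau> x) * ntrace \<zeta> x)) \<in> borel_measurable \<mu>\<Gamma>"
      by (rule borel_measurable_integrable[OF integrable_mult_right[OF int(1)]])
  qed
  then show ?thesis by simp
qed

text \<open>The volume term is definite up to null sets, and the interface term is nonnegative.  Conversely, a field that vanishes almost everywhere
  is null for the interface term as well, since its normal trace vanishes.\<close>

lemma
  fixes \<kappa> :: "'n::finite \<Rightarrow> real^'d \<Rightarrow> real" and K :: "'n \<Rightarrow> real"
  assumes K: "\<And>i. K i > 0"
    and \<kappa>_meas: "\<And>i. \<kappa> i \<in> borel_measurable (lebesgue_on \<Omega>)"
    and lo: "\<And>i. 0 < lo i" "\<And>i. AE x in lebesgue_on \<Omega>. lo i \<le> \<kappa> i x"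
  shows semi_inner_product_form_a: "semi_inner_product (pow S) (form_a \<Omega> \<Omega>\<^sub>p \<Omega>\<^sub>m \<kappa> K)"
    and form_a_null_iff: "\<tau> \<in> pow S \<Longrightarrow>
      form_a \<Omega> \<Omega>\<^sub>p \<Omega>\<^sub>m \<kappa> K \<tau> \<tau> = 0 \<longleftrightarrow> (\<forall>i. AE x in lebesgue_on \<Omega>. \<tau> i x = 0)"
proof -
  let ?a = "form_a \<Omega> \<Omega>\<^sub>p \<Omega>\<^sub>m \<kappa> K"
  let ?A = "\<lambda>i \<tau> \<eta>. LINT x|lebesgue_on \<Omega>. (inverse (\<kappa> i x) *\<^sub>R \<tau> x) \<bullet> \<eta> x"
  let ?B = "\<lambda>i \<tau> \<eta>. LINT x|\<mu>\<Gamma>. (inverse (K i) * ntrace \<tau> x) * ntrace \<eta> x"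
  have a_eq: "?a \<tau> \<eta> = (\<Sum>i\<in>UNIV. ?A i (\<tau> i) (\<eta> i) + ?B i (\<tau> i) (\<eta> i))" for \<tau> \<eta>
    by (simp add: form_a_def sum.distrib)
  have S: "\<tau> i \<in> S" if "\<tau> \<in> pow S" for \<tau> :: "'n \<Rightarrow> _" and i using that by (simp add: pow_def)
  have S_L2: "\<tau> \<in> L2 (lebesgue_on \<Omega>)" if "\<tau> \<in> S" for \<tau> using that S_Hdiv Hdiv_L2(1) by blast
  have int_A: "integrable (lebesgue_on \<Omega>) (\<lambda>x. (inverse (\<kappa> i x) *\<^sub>R \<tau> x) \<bullet> \<eta> x)"
    if "\<tau> \<in> S" "\<eta> \<in> S" for i \<tau> \<eta>
    using that by (intro L2_inner_integrable weighted_L2[OF \<kappa>_meas lo] S_L2)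
  have A_nonneg_AE: "AE x in lebesgue_on \<Omega>. 0 \<le> (inverse (\<kappa> i x) *\<^sub>R \<tau> x) \<bullet> \<tau> x" for i \<tau>
    using lo(2)[of i] by eventually_elim (use lo(1)[of i] in simp)
  have A_nonneg: "0 \<le> ?A i \<tau> \<tau>" for i \<tau>
    using A_nonneg_AE by (rule integral_nonneg_AE)
  have B_nonneg: "0 \<le> ?B i \<tau> \<tau>" for i \<tau>
    using K[of i] by (intro Bochner_Integration.integral_nonneg) (simp add: mult.assoc)
  show "semi_inner_product (pow S) ?a"
  proof
    show "subspace (pow S :: ('n \<Rightarrow> _) set)" by (intro subspace_pow subspace_S)
    fix x y z :: "'n \<Rightarrow> real^'d \<Rightarrow> real^'d" and r :: real
    assume x: "x \<in> pow S"
    show "?a x y = ?a y x" by (simp add: a_eq inner_commute mult.commute mult.left_commute)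
    show "0 \<le> ?a x x" unfolding a_eq by (intro sum_nonneg add_nonneg_nonneg A_nonneg B_nonneg)
    show "?a (r *\<^sub>R x) z = r * ?a x z" if z: "z \<in> pow S"
    proof -
      have "(inverse (\<kappa> i t) *\<^sub>R (r *\<^sub>R x i) t) \<bullet> z i t =
          r * ((inverse (\<kappa> i t) *\<^sub>R x i t) \<bullet> z i t)" for i t by simp
      then have "?A i (r *\<^sub>R x i) (z i) = r * ?A i (x i) (z i)" for i
        by (simp only: integral_mult_right_zero)
      moreover have "?B i (r *\<^sub>R x i) (z i) = r * ?B i (x i) (z i)" for i
        by (rule trace_product_scale[OF S[OF x] S[OF z]])
      ultimately have "?A i ((r *\<^sub>R x) i) (z i) + ?B i ((r *\<^sub>R x) i) (z i) =
          r * (?A i (x i) (z i) + ?B i (x i) (z i))" for i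
        by (simp only: scaleR_fun_apply[of r x] distrib_left)
      then show ?thesis unfolding a_eq by (simp only: sum_distrib_left)
    qed
    show "?a (x + y) z = ?a x z + ?a y z" if y: "y \<in> pow S" and z: "z \<in> pow S"
    proof -
      have "?A i (x i + y i) (z i) = ?A i (x i) (z i) + ?A i (y i) (z i)" for i
        using int_A[OF S[OF x] S[OF z]] int_A[OF S[OF y] S[OF z]]
        by (simp add: scaleR_add_right inner_add_left)
      moreover have "?B i (x i + y i) (z i) = ?B i (x i) (z i) + ?B i (y i) (z i)" for i
        by (rule trace_product_add[OF S[OF x] S[OF y] S[OF z]])
      ultimately have "?A i ((x + y) i) (z i) + ?B i ((x + y) i) (z i) =
          (?A i (x i) (z i) + ?B i (x i) (z i)) + (?A i (y i) (z i) + ?B i (y i) (z i))" for i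
        by (simp only: plus_fun_apply[of x y] ac_simps)
      then show ?thesis unfolding a_eq by (simp only: sum.distrib)
    qed
  qed
  show "?a \<tau> \<tau> = 0 \<longleftrightarrow> (\<forall>i. AE x in lebesgue_on \<Omega>. \<tau> i x = 0)" if \<tau>: "\<tau> \<in> pow S"
  proof
    assume "?a \<tau> \<tau> = 0"
    then have sum0: "(\<Sum>i\<in>UNIV. ?A i (\<tau> i) (\<tau> i) + ?B i (\<tau> i) (\<tau> i)) = 0"
      by (simp only: a_eq)
    have "\<forall>i\<in>UNIV. ?A i (\<tau> i) (\<tau> i) + ?B i (\<tau> i) (\<tau> i) = 0"
      using sum0 by (subst (asm) sum_nonneg_eq_0_iff) (simp_all only: finite A_nonneg B_nonneg add_nonneg_nonneg)
    then have "?A i (\<tau> i) (\<tau> i) + ?B i (\<tau> i) (\<tau> i) = 0" for i by (rule bspec) simp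
    then have A0: "?A i (\<tau> i) (\<tau> i) = 0" for i
      by (simp only: add_nonneg_eq_0_iff[OF A_nonneg B_nonneg])
    show "\<forall>i. AE x in lebesgue_on \<Omega>. \<tau> i x = 0"
    proof
      fix i
      have "AE x in lebesgue_on \<Omega>. (inverse (\<kappa> i x) *\<^sub>R \<tau> i x) \<bullet> \<tau> i x = 0"
        using A0[of i] integral_nonneg_eq_0_iff_AE[OF int_A[OF S[OF \<tau>] S[OF \<tau>]] A_nonneg_AE] by blast
      with lo(2)[of i] show "AE x in lebesgue_on \<Omega>. \<tau> i x = 0"
        by eventually_elim (use lo(1)[of i] in auto)
    qed
  next
    assume null: "\<forall>i. AE x in lebesgue_on \<Omega>. \<tau> i x = 0"
    have "?A i (\<tau> i) (\<tau> i) = 0" for i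
      using null by (intro integral_eq_zero_AE) (auto elim: eventually_mono)
    moreover have "?B i (\<tau> i) (\<tau> i) = 0" for i
      using normal_trace_null[OF S[OF \<tau>], of i] null
      by (intro integral_eq_zero_AE) (auto elim: eventually_mono)
    ultimately show "?a \<tau> \<tau> = 0" by (simp add: a_eq)
  qed
qed

lemma div_L2: "\<tau> \<in> pow S \<Longrightarrow> dvg (\<tau> i) \<in> L2 (lebesgue_on \<Omega>)"
  using S_Hdiv Hdiv_L2(2) by (auto simp: pow_def)

lemma form_b_eq: "form_b \<Omega> \<tau> v = L2_inner (lebesgue_on \<Omega>) (\<lambda>i. dvg (\<tau> i)) v"
  by (simp add: form_b_def L2_inner_def mult.commute)

lemma L2_inner_cong_AE:
  assumes "v \<in> pow (L2 M)" "v' \<in> pow (L2 M)" "w \<in> pow (L2 M)" "\<And>i. AE x in M. v i x = v' i x"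
  shows "L2_inner M v w = L2_inner M v' w"
  unfolding L2_inner_def
proof (rule sum.cong[OF refl], rule integral_cong_AE)
  fix i
  show "AE x in M. v i x \<bullet> w i x = v' i x \<bullet> w i x"
    using assms(4)[of i] by eventually_elim simp
  show "(\<lambda>x. v i x \<bullet> w i x) \<in> borel_measurable M" "(\<lambda>x. v' i x \<bullet> w i x) \<in> borel_measurable M"
    using assms(1-3) by (simp_all add: pow_def borel_measurable_integrable L2_inner_integrable)
qed

lemma form_b_add_left:
  assumes "\<tau> \<in> pow S" "\<eta> \<in> pow S" "v \<in> pow (L2 (lebesgue_on \<Omega>))"
  shows "form_b \<Omega> (\<tau> + \<eta>) v = form_b \<Omega> \<tau> v + form_b \<Omega> \<eta> v"
proof -
  interpret semi_inner_product "pow (L2 (lebesgue_on \<Omega>)) :: ('a \<Rightarrow> _ \<Rightarrow> real) set" "L2_inner (lebesgue_on \<Omega>)"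
    by (rule semi_inner_product_L2)
  have L2: "(\<lambda>i. dvg (\<tau> i)) \<in> pow (L2 (lebesgue_on \<Omega>))" if "\<tau> \<in> pow S" for \<tau> :: "'a \<Rightarrow> _"
    using div_L2[OF that] by (simp add: pow_def)
  have "form_b \<Omega> (\<tau> + \<eta>) v = L2_inner (lebesgue_on \<Omega>) ((\<lambda>i. dvg (\<tau> i)) + (\<lambda>i. dvg (\<eta> i))) v"
    unfolding form_b_eq
  proof (rule L2_inner_cong_AE)
    show "AE x in lebesgue_on \<Omega>. dvg ((\<tau> + \<eta>) i) x = ((\<lambda>i. dvg (\<tau> i)) + (\<lambda>i. dvg (\<eta> i))) i x" for i
      using div_add[of "\<tau> i" "\<eta> i"] assms(1,2) S_Hdiv by (simp add: pow_def)
    show "(\<lambda>i. dvg ((\<tau> + \<eta>) i)) \<in> pow (L2 (lebesgue_on \<Omega>))"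
      by (intro L2 subspace_add[OF subspace_pow[OF subspace_S]] assms)
    show "(\<lambda>i. dvg (\<tau> i)) + (\<lambda>i. dvg (\<eta> i)) \<in> pow (L2 (lebesgue_on \<Omega>))"
      by (intro W_closed L2 assms)
  qed (rule assms(3))
  then show ?thesis using assms by (simp add: form_b_eq add_left L2)
qed

lemma form_b_scale_left:
  assumes "\<tau> \<in> pow S" "v \<in> pow (L2 (lebesgue_on \<Omega>))"
  shows "form_b \<Omega> (r *\<^sub>R \<tau>) v = r * form_b \<Omega> \<tau> v"
proof -
  interpret semi_inner_product "pow (L2 (lebesgue_on \<Omega>)) :: ('a \<Rightarrow> _ \<Rightarrow> real) set" "L2_inner (lebesgue_on \<Omega>)"
    by (rule semi_inner_product_L2)
  have L2: "(\<lambda>i. dvg (\<tau> i)) \<in> pow (L2 (lebesgue_on \<Omega>))" if "\<tau> \<in> pow S" for \<tau> :: "'a \<Rightarrow> _"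
    using div_L2[OF that] by (simp add: pow_def)
  have "form_b \<Omega> (r *\<^sub>R \<tau>) v = L2_inner (lebesgue_on \<Omega>) (r *\<^sub>R (\<lambda>i. dvg (\<tau> i))) v"
    unfolding form_b_eq
  proof (rule L2_inner_cong_AE)
    show "AE x in lebesgue_on \<Omega>. dvg ((r *\<^sub>R \<tau>) i) x = (r *\<^sub>R (\<lambda>i. dvg (\<tau> i))) i x" for i
      using div_scale[of "\<tau> i"] assms(1) S_Hdiv by (simp add: pow_def)
    show "(\<lambda>i. dvg ((r *\<^sub>R \<tau>) i)) \<in> pow (L2 (lebesgue_on \<Omega>))"
      by (intro L2 subspace_scale[OF subspace_pow[OF subspace_S]] assms)
    show "r *\<^sub>R (\<lambda>i. dvg (\<tau> i)) \<in> pow (L2 (lebesgue_on \<Omega>))"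
      by (intro W_closed L2 assms)
  qed (rule assms(2))
  then show ?thesis using assms by (simp add: form_b_eq scale_left L2)
qed

lemma form_b_null_left:
  assumes "\<tau> \<in> pow S" "\<And>i. AE x in lebesgue_on \<Omega>. \<tau> i x = 0"
  shows "form_b \<Omega> \<tau> v = 0"
  unfolding form_b_def
proof (rule sum.neutral, rule ballI, rule integral_eq_zero_AE)
  fix i
  have "\<tau> i \<in> Hdiv \<Omega>" using assms(1) S_Hdiv by (simp add: pow_def)
  then show "AE x in lebesgue_on \<Omega>. v i x * dvg (\<tau> i) x = 0"
    using div_null[OF _ assms(2)[of i]] by (auto elim: eventually_mono)
qed

lemma form_b_linear_right:
  assumes "\<tau> \<in> pow S" "v \<in> pow (L2 (lebesgue_on \<Omega>))" "w \<in> pow (L2 (lebesgue_on \<Omega>))"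
  shows "form_b \<Omega> \<tau> (v + w) = form_b \<Omega> \<tau> v + form_b \<Omega> \<tau> w"
    and "form_b \<Omega> \<tau> (r *\<^sub>R v) = r * form_b \<Omega> \<tau> v"
    and "(\<And>i. AE x in lebesgue_on \<Omega>. v i x = 0) \<Longrightarrow> form_b \<Omega> \<tau> v = 0"
proof -
  interpret semi_inner_product "pow (L2 (lebesgue_on \<Omega>)) :: ('a \<Rightarrow> _ \<Rightarrow> real) set" "L2_inner (lebesgue_on \<Omega>)"
    by (rule semi_inner_product_L2)
  have L2: "(\<lambda>i. dvg (\<tau> i)) \<in> pow (L2 (lebesgue_on \<Omega>))"
    using div_L2[OF assms(1)] by (simp add: pow_def)
  show "form_b \<Omega> \<tau> (v + w) = form_b \<Omega> \<tau> v + form_b \<Omega> \<tau> w"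
    "form_b \<Omega> \<tau> (r *\<^sub>R v) = r * form_b \<Omega> \<tau> v"
    using assms L2 by (simp_all add: form_b_eq add_right scale_right)
  assume "\<And>i. AE x in lebesgue_on \<Omega>. v i x = 0"
  then have "L2_inner (lebesgue_on \<Omega>) v v = 0" using assms(2) by (simp add: L2_inner_null_iff)
  then show "form_b \<Omega> \<tau> v = 0"
    unfolding form_b_eq using null_left[OF assms(2) L2] sym[OF assms(2) L2] by simp
qed

lemma form_d_eq: "form_d \<Omega> f v w = L2_inner (lebesgue_on \<Omega>) (\<lambda>i x. f i (\<chi> j. v j x)) w"
  by (simp add: form_d_def L2_inner_def)

end

theorem theorem3p1:
  fixes \<Omega> \<Omega>\<^sub>p \<Omega>\<^sub>m :: "(real^'d) set" and \<T> :: "(real^'d) set set" and \<gamma> :: real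
    and K :: "'N::finite \<Rightarrow> real" and \<kappa> :: "'N \<Rightarrow> real^'d \<Rightarrow> real"
    and f :: "'N \<Rightarrow> real^'N \<Rightarrow> real" and l :: nat and \<Delta>t L :: real
    and \<sigma> :: "'N \<Rightarrow> real^'d \<Rightarrow> real^'d" and u :: "'N \<Rightarrow> real^'d \<Rightarrow> real"
  defines "a \<equiv> form_a \<Omega> \<Omega>\<^sub>p \<Omega>\<^sub>m \<kappa> K" and "b \<equiv> form_b \<Omega>" and "c \<equiv> form_c \<Omega>" and "d \<equiv> form_d \<Omega> f"
    and "V \<equiv> pow (L2 (lebesgue_on \<Omega>))"
    and "\<Sigma>h \<equiv> pow (Sigma_h \<Omega> \<Omega>\<^sub>p \<Omega>\<^sub>m \<T> l)" and "Vh \<equiv> pow (V_h \<Omega> \<T> l)"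
  defines "step \<equiv> \<lambda>\<sigma>' u'. \<forall>\<tau>\<in>\<Sigma>h. \<forall>v\<in>Vh.
      1/2 * a (\<sigma> + \<sigma>') \<tau> - 1/2 * b \<tau> (u + u') = 0 \<and>
      1/2 * b (\<sigma> + \<sigma>') v + 1/\<Delta>t * c (u' - u) v - 1/2 * (d u v + d u' v) = 0"
  assumes "CARD('d) = 2 \<or> CARD('d) = 3"
    and "domain \<Omega>" "bounded \<Omega>" "polyhedral_boundary \<Omega>" "lipschitz_boundary \<Omega>"
    and "domain \<Omega>\<^sub>p" "polyhedral_boundary \<Omega>\<^sub>p" "\<Omega>\<^sub>p \<subseteq> \<Omega>"
    and "domain \<Omega>\<^sub>m" "polyhedral_boundary \<Omega>\<^sub>m" "\<Omega>\<^sub>m \<subseteq> \<Omega>"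
    and "\<Omega>\<^sub>p \<inter> \<Omega>\<^sub>m = {}" "closure \<Omega>\<^sub>p \<union> closure \<Omega>\<^sub>m = closure \<Omega>"
    and "mesh_of \<Omega> \<T>" "shape_regular \<gamma> \<T>"
    and "\<forall>i. K i > 0"
    and "\<forall>i. \<kappa> i \<in> borel_measurable (lebesgue_on \<Omega>)"
    and "\<forall>i. \<exists>lo hi. 0 < lo \<and> 0 < hi \<and> (AE x in lebesgue_on \<Omega>. lo \<le> \<kappa> i x \<and> \<kappa> i x \<le> hi)"
    and "\<forall>i. \<exists>Li>0. \<forall>v\<in>V. \<forall>w\<in>V. AE x in lebesgue_on \<Omega>.
           \<bar>f i (\<chi> j. v j x) - f i (\<chi> j. w j x)\<bar> \<le> Li * sqrt (\<Sum>j\<in>UNIV. \<bar>v j x - w j x\<bar>\<^sup>2)"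
    and "l \<ge> 1"
    and "\<Delta>t > 0" and "L > 0"
    and "\<forall>v\<in>V. \<forall>w\<in>V. \<forall>z\<in>V. \<bar>d v z - d w z\<bar> \<le> L * norm_L2 \<Omega> (v - w) * norm_L2 \<Omega> z"
    and "L * \<Delta>t < 2"
    and "\<sigma> \<in> \<Sigma>h" and "u \<in> Vh"
  shows "\<exists>\<sigma>'\<in>\<Sigma>h. \<exists>u'\<in>Vh. step \<sigma>' u' \<and>
           (\<forall>\<rho>\<in>\<Sigma>h. \<forall>w\<in>Vh. step \<rho> w \<longrightarrow>
              (\<forall>i. AE x in lebesgue_on \<Omega>. \<rho> i x = \<sigma>' i x \<and> w i x = u' i x))"
proof -
  interpret P: interface_problem \<Omega> \<Omega>\<^sub>p \<Omega>\<^sub>m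
    using assms by unfold_locales (auto simp: domain_def)
  define S where "S = (pow (Sigma_space \<Omega> \<Omega>\<^sub>p \<Omega>\<^sub>m) :: ('N \<Rightarrow> _) set)"
  have \<Omega>: "open \<Omega>" "bounded \<Omega>" "\<Omega> \<noteq> {}" using assms by (auto simp: domain_def)
  obtain lo where lo: "\<And>i. 0 < lo i" "\<And>i. AE x in lebesgue_on \<Omega>. lo i \<le> \<kappa> i x"
  proof -
    have "\<exists>lo>0. AE x in lebesgue_on \<Omega>. lo \<le> \<kappa> i x" for i
    proof -
      obtain lo hi where "0 < lo" "AE x in lebesgue_on \<Omega>. lo \<le> \<kappa> i x \<and> \<kappa> i x \<le> hi"
        using \<open>\<forall>i. \<exists>lo hi. 0 < lo \<and> 0 < hi \<and> (AE x in lebesgue_on \<Omega>. lo \<le> \<kappa> i x \<and> \<kappa> i x \<le> hi)\<close>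
        by blast
      then show ?thesis by (auto elim: eventually_mono)
    qed
    then show ?thesis using that by metis
  qed
  have K: "K i > 0" and \<kappa>: "\<kappa> i \<in> borel_measurable (lebesgue_on \<Omega>)" for i
    using assms by auto
  have sub: "subspace \<Sigma>h" "subspace Vh" "\<Sigma>h \<subseteq> S" "Vh \<subseteq> V"
    unfolding \<Sigma>h_def Vh_def V_def S_def
    by (intro subspace_pow P.subspace_Sigma_h P.subspace_V_h pow_mono P.Sigma_h_S P.V_h_L2)+
  have a_form: "semi_inner_product S a"
    unfolding S_def a_def by (rule P.semi_inner_product_form_a[OF K \<kappa> lo])
  have a_null: "a \<tau> \<tau> = 0 \<longleftrightarrow> (\<forall>i. AE x in lebesgue_on \<Omega>. \<tau> i x = 0)" if "\<tau> \<in> \<Sigma>h" for \<tau>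
    unfolding a_def using that sub(3) by (intro P.form_a_null_iff[OF K \<kappa> lo]) (auto simp: S_def)
  have c_form: "semi_inner_product V c"
    unfolding V_def c_def form_c_eq by (rule semi_inner_product_L2)
  have c_null: "c v v = 0 \<longleftrightarrow> (\<forall>i. AE x in lebesgue_on \<Omega>. v i x = 0)" if "v \<in> V" for v
    using that unfolding c_def V_def form_c_eq by (rule L2_inner_null_iff)
  interpret a: semi_inner_product \<Sigma>h a by (rule semi_inner_product_subspace[OF a_form sub(1,3)])
  interpret c: semi_inner_product Vh c by (rule semi_inner_product_subspace[OF c_form sub(2,4)])
  interpret cV: semi_inner_product V c by (rule c_form)
  have f_L2: "(\<lambda>i x. f i (\<chi> j. v j x)) \<in> V" if v: "v \<in> V" for v
    unfolding V_def pow_def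
  proof (intro CollectI allI)
    fix i
    obtain C where C: "\<forall>v\<in>V. \<forall>w\<in>V. AE x in lebesgue_on \<Omega>.
           \<bar>f i (\<chi> j. v j x) - f i (\<chi> j. w j x)\<bar> \<le> C * sqrt (\<Sum>j\<in>UNIV. \<bar>v j x - w j x\<bar>\<^sup>2)"
      using \<open>\<forall>i. \<exists>Li>0. \<forall>v\<in>V. \<forall>w\<in>V. AE x in lebesgue_on \<Omega>.
           \<bar>f i (\<chi> j. v j x) - f i (\<chi> j. w j x)\<bar> \<le> Li * sqrt (\<Sum>j\<in>UNIV. \<bar>v j x - w j x\<bar>\<^sup>2)\<close>
      by blast
    show "(\<lambda>x. f i (\<chi> j. v j x)) \<in> L2 (lebesgue_on \<Omega>)"
      using v unfolding V_def
      by (rule L2_Lipschitz_compose[OF P.finite_\<Omega> Lipschitz_nonlinearity[OF \<Omega> C[unfolded V_def]]])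
  qed
  have d_eq: "d v w = c (\<lambda>i x. f i (\<chi> j. v j x)) w" for v w
    by (simp add: d_def c_def P.form_d_eq form_c_eq)
  have d_add: "d z (v + w) = d z v + d z w" and d_scale: "d z (r *\<^sub>R v) = r * d z v"
    if "z \<in> V" "v \<in> V" "w \<in> V" for z v w r
    using that f_L2 by (simp_all add: d_eq cV.add_right cV.scale_right)
  have d_null: "d z v = 0" if "z \<in> V" "v \<in> V" "c v v = 0" for z v
    using cV.null_left[OF that(2) f_L2[OF that(1)] that(3)] cV.sym[OF that(2) f_L2[OF that(1)]]
    by (simp add: d_eq)
  have d_lip: "\<bar>d v z - d w z\<bar> \<le> L * sqrt (c (v - w) (v - w)) * sqrt (c z z)"
    if "v \<in> V" "w \<in> V" "z \<in> V" for v w z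
    using \<open>\<forall>v\<in>V. \<forall>w\<in>V. \<forall>z\<in>V. \<bar>d v z - d w z\<bar> \<le> L * norm_L2 \<Omega> (v - w) * norm_L2 \<Omega> z\<close> that
    by (simp add: norm_L2_def c_def)
  have Vh_V: "v \<in> V" if "v \<in> Vh" for v using that sub(4) by blast
  have \<Sigma>h_S: "\<tau> \<in> pow (Sigma_space \<Omega> \<Omega>\<^sub>p \<Omega>\<^sub>m)" if "\<tau> \<in> \<Sigma>h" for \<tau> using that sub(3) by (auto simp: S_def)
  have Vh_L2: "v \<in> pow (L2 (lebesgue_on \<Omega>))" if "v \<in> Vh" for v using Vh_V[OF that] by (simp add: V_def)
  have b_left: "b (\<tau> + \<eta>) v = b \<tau> v + b \<eta> v" "b (r *\<^sub>R \<tau>) v = r * b \<tau> v"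
    if "\<tau> \<in> \<Sigma>h" "\<eta> \<in> \<Sigma>h" "v \<in> Vh" for \<tau> \<eta> v r
    unfolding b_def using that by (auto intro!: P.form_b_add_left P.form_b_scale_left \<Sigma>h_S Vh_L2)
  have b_right: "b \<tau> (v + w) = b \<tau> v + b \<tau> w" "b \<tau> (r *\<^sub>R v) = r * b \<tau> v"
    if "\<tau> \<in> \<Sigma>h" "v \<in> Vh" "w \<in> Vh" for \<tau> v w r
    unfolding b_def using that by (auto intro!: P.form_b_linear_right \<Sigma>h_S Vh_L2)
  have b_diff: "b (\<tau> - \<eta>) v = b \<tau> v - b \<eta> v" if "\<tau> \<in> \<Sigma>h" "\<eta> \<in> \<Sigma>h" "v \<in> Vh" for \<tau> \<eta> v
    using b_left(1)[of "\<tau> - \<eta>" \<eta> v] that a.W_closed(3) by simp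
  have b_diff_right: "b \<tau> (v - w) = b \<tau> v - b \<tau> w" if "\<tau> \<in> \<Sigma>h" "v \<in> Vh" "w \<in> Vh" for \<tau> v w
    using b_right(1)[of \<tau> "v - w" w] that c.W_closed(3) by simp
  have b_null: "b \<tau> v = 0" if "\<tau> \<in> \<Sigma>h" "v \<in> Vh" "a \<tau> \<tau> = 0 \<or> c v v = 0" for \<tau> v
    using that a_null[OF that(1)] c_null[OF Vh_V[OF that(2)]] \<Sigma>h_S[OF that(1)] Vh_L2[OF that(2)]
    unfolding b_def by (auto intro: P.form_b_null_left P.form_b_linear_right(3))
  note \<sigma> = \<open>\<sigma> \<in> \<Sigma>h\<close> and u = \<open>u \<in> Vh\<close> and \<Delta>t = \<open>\<Delta>t > 0\<close>
  define \<mu> where "\<mu> = 2 / \<Delta>t"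
  have \<mu>: "0 \<le> L" "L < \<mu>" "\<mu> > 0" using \<open>L > 0\<close> \<open>L * \<Delta>t < 2\<close> \<Delta>t by (auto simp: \<mu>_def field_simps)
  \<comment> \<open>the scheme in terms of the sums of the old and the new unknowns\<close>
  have step_iff: "step \<sigma>' u' \<longleftrightarrow> (\<forall>\<tau>\<in>\<Sigma>h. a (\<sigma> + \<sigma>') \<tau> = b \<tau> (u + u')) \<and>
      (\<forall>v\<in>Vh. b (\<sigma> + \<sigma>') v + \<mu> * c (u + u') v = d u' v + 2 * \<mu> * c u v + d u v)"
    if "u' \<in> Vh" for \<sigma>' u'
  proof -
    have "1/2 * b (\<sigma> + \<sigma>') v + 1/\<Delta>t * c (u' - u) v - 1/2 * (d u v + d u' v) = 0 \<longleftrightarrow>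
        b (\<sigma> + \<sigma>') v + \<mu> * c (u + u') v = d u' v + 2 * \<mu> * c u v + d u v" if v: "v \<in> Vh" for v
    proof -
      have "c (u' - u) v = c u' v - c u v" "c (u + u') v = c u v + c u' v"
        using \<open>u' \<in> Vh\<close> u v by (simp_all add: c.diff_left c.add_left)
      then show ?thesis using \<Delta>t by (auto simp: \<mu>_def field_simps)
    qed
    moreover have "0 \<in> \<Sigma>h" "0 \<in> Vh" by (rule a.W_closed c.W_closed)+
    ultimately show ?thesis unfolding step_def by auto
  qed
  obtain GS where GS: "finite GS" "GS \<subseteq> \<Sigma>h"
    "\<And>\<tau>. \<tau> \<in> \<Sigma>h \<Longrightarrow> \<exists>g\<in>span GS. \<forall>i. AE x in lebesgue_on \<Omega>. \<tau> i x = g i x"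
    using P.Sigma_h_finite_dimensional[where 'n = 'N, OF \<open>mesh_of \<Omega> \<T>\<close>, of l, folded \<Sigma>h_def]
    by (elim exE conjE) (rule that, assumption+, erule (1) bspec)
  obtain GV where GV: "finite GV" "GV \<subseteq> Vh"
    "\<And>v. v \<in> Vh \<Longrightarrow> \<exists>g\<in>span GV. \<forall>i. AE x in lebesgue_on \<Omega>. v i x = g i x"
    using P.V_h_finite_dimensional[where 'n = 'N, OF \<open>mesh_of \<Omega> \<T>\<close>, of l, folded Vh_def]
    by (elim exE conjE) (rule that, assumption+, erule (1) bspec)
  have GS_null: "\<exists>g\<in>span GS. a (\<tau> - g) (\<tau> - g) = 0" if \<tau>: "\<tau> \<in> \<Sigma>h" for \<tau>
  proof -
    obtain g where g: "g \<in> span GS" "\<And>i. AE x in lebesgue_on \<Omega>. \<tau> i x = g i x" using GS(3)[OF \<tau>] by blast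
    have "\<tau> - g \<in> \<Sigma>h" using \<tau> g(1) span_minimal[OF GS(2) sub(1)] by (auto intro: a.W_closed)
    moreover have "AE x in lebesgue_on \<Omega>. (\<tau> - g) i x = 0" for i
      using g(2)[of i] by eventually_elim simp
    ultimately show ?thesis using g(1) a_null by blast
  qed
  have GV_null: "\<exists>g\<in>span GV. c (v - g) (v - g) = 0" if v: "v \<in> Vh" for v
  proof -
    obtain g where g: "g \<in> span GV" "\<And>i. AE x in lebesgue_on \<Omega>. v i x = g i x" using GV(3)[OF v] by blast
    have "v - g \<in> Vh" using v g(1) span_minimal[OF GV(2) sub(2)] by (auto intro: c.W_closed)
    moreover have "AE x in lebesgue_on \<Omega>. (v - g) i x = 0" for i
      using g(2)[of i] by eventually_elim simp
    ultimately show ?thesis using g(1) c_null Vh_V by blast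
  qed
  define G where "G = (\<lambda>z v. d (z - u) v + 2 * \<mu> * c u v + d u v)"
  have zu: "z - u \<in> Vh" if "z \<in> Vh" for z using that u by (rule c.W_closed)
  have "\<exists>s\<in>\<Sigma>h. \<exists>y\<in>Vh. (\<forall>t\<in>\<Sigma>h. a s t = b t y) \<and> (\<forall>v\<in>Vh. b s v + \<mu> * c y v = G y v)"
  proof (rule mixed_problem_solvable[OF a.semi_inner_product_axioms c.semi_inner_product_axioms
        GS(1,2) GS_null GV(1,2) GV_null, where L = L])
    fix y z v w assume z: "z \<in> Vh" and v: "v \<in> Vh"
    note V = Vh_V[OF u] Vh_V[OF z] Vh_V[OF v] Vh_V[OF zu[OF z]]
    show "G z (v + w) = G z v + G z w" if "w \<in> Vh"
      using V z u v that by (simp add: G_def d_add Vh_V c.add_right algebra_simps)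
    show "G z (r *\<^sub>R v) = r * G z v" for r
      using V z u v by (simp add: G_def d_scale c.scale_right algebra_simps)
    show "G z v = 0" if "c v v = 0"
      using V c.null_left[OF v u that] c.sym[OF u v] that by (simp add: G_def d_null)
    show "\<bar>G y v - G z v\<bar> \<le> L * sqrt (c (y - z) (y - z)) * sqrt (c v v)" if y: "y \<in> Vh"
      using d_lip[OF Vh_V[OF zu[OF y]] V(4) V(3)] by (simp add: G_def)
  qed (use \<mu> b_left b_right b_null in auto)
  then obtain s y where s: "s \<in> \<Sigma>h" and y: "y \<in> Vh"
    and eqs: "\<And>t. t \<in> \<Sigma>h \<Longrightarrow> a s t = b t y" "\<And>v. v \<in> Vh \<Longrightarrow> b s v + \<mu> * c y v = G y v"
    by blast
  have "step (s - \<sigma>) (y - u)"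
    using eqs by (simp add: step_iff[OF zu[OF y]] G_def)
  moreover have "\<forall>i. AE x in lebesgue_on \<Omega>. \<rho> i x = (s - \<sigma>) i x \<and> w i x = (y - u) i x"
    if \<rho>: "\<rho> \<in> \<Sigma>h" and w: "w \<in> Vh" and step': "step \<rho> w" for \<rho> w
  proof -
    \<comment> \<open>the differences of the two solutions, used as test functions\<close>
    define \<epsilon> where "\<epsilon> = \<sigma> + \<rho> - s"
    define e where "e = w - (y - u)"
    have \<epsilon>: "\<epsilon> \<in> \<Sigma>h" "\<sigma> + \<rho> \<in> \<Sigma>h"
      using a.W_closed(3)[OF a.W_closed(2)[OF \<sigma> \<rho>] s] a.W_closed(2)[OF \<sigma> \<rho>] by (simp_all add: \<epsilon>_def)
    have e: "e \<in> Vh" "u + w \<in> Vh"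
      using c.W_closed(3)[OF w zu[OF y]] c.W_closed(2)[OF u w] by (simp_all only: e_def)
    have e': "e = (u + w) - y" by (simp add: e_def)
    have eqs': "a (\<sigma> + \<rho>) \<epsilon> = b \<epsilon> (u + w)"
      "b (\<sigma> + \<rho>) e + \<mu> * c (u + w) e = d w e + 2 * \<mu> * c u e + d u e"
      using step' \<epsilon> e by (auto simp: step_iff[OF w])
    have "a \<epsilon> \<epsilon> = b \<epsilon> e"
      using eqs'(1) eqs(1)[OF \<epsilon>(1)] s y \<epsilon> e
      by (simp add: \<epsilon>_def[THEN arg_cong, of "\<lambda>t. a t \<epsilon>"] a.diff_left e'[THEN arg_cong, of "b \<epsilon>"] b_diff_right)
    moreover have "b \<epsilon> e + \<mu> * c e e = d w e - d (y - u) e"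
    proof -
      have "b \<epsilon> e = b (\<sigma> + \<rho>) e - b s e" unfolding \<epsilon>_def using \<epsilon>(2) s e(1) by (rule b_diff)
      moreover have "c e e = c (u + w) e - c y e"
        using c.diff_left[OF e(2) y e(1)] by (simp add: e')
      then have "\<mu> * c e e = \<mu> * c (u + w) e - \<mu> * c y e"
        by (simp only: right_diff_distrib)
      ultimately show ?thesis
        using eqs'(2) eqs(2)[OF e(1)] unfolding G_def by linarith
    qed
    ultimately have "a \<epsilon> \<epsilon> + \<mu> * c e e = d w e - d (y - u) e" by simp
    also have "\<dots> \<le> L * c e e"
      using d_lip[OF Vh_V[OF w] Vh_V[OF zu[OF y]] Vh_V[OF e(1)]] c.nonneg[OF e(1)]
      by (simp add: mult.assoc flip: e_def)
    finally have "a \<epsilon> \<epsilon> + (\<mu> - L) * c e e \<le> 0" by (simp add: algebra_simps)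
    moreover have "0 \<le> a \<epsilon> \<epsilon>" "0 \<le> (\<mu> - L) * c e e"
      using \<mu> a.nonneg[OF \<epsilon>(1)] c.nonneg[OF e(1)] by auto
    ultimately have "a \<epsilon> \<epsilon> = 0" "(\<mu> - L) * c e e = 0" by linarith+
    then have "\<forall>i. AE x in lebesgue_on \<Omega>. \<epsilon> i x = 0" "\<forall>i. AE x in lebesgue_on \<Omega>. e i x = 0"
      using a_null[OF \<epsilon>(1)] c_null[OF Vh_V[OF e(1)]] \<mu> by auto
    then have ae: "AE x in lebesgue_on \<Omega>. \<epsilon> i x = 0" "AE x in lebesgue_on \<Omega>. e i x = 0" for i by auto
    show ?thesis
    proof
      fix i
      show "AE x in lebesgue_on \<Omega>. \<rho> i x = (s - \<sigma>) i x \<and> w i x = (y - u) i x"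
        using ae(1)[of i] ae(2)[of i]
        by eventually_elim (simp add: \<epsilon>_def e_def algebra_simps)
    qed
  qed
  moreover have "s - \<sigma> \<in> \<Sigma>h" using s \<sigma> by (rule a.W_closed)
  ultimately show ?thesis using zu[OF y] by blast
qed

end
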